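(* Let $(p_n)_n$ be a sequence of alternatives contiguous to $p$ (in the sense defined in the context, with associated function $h$ and constant $\delta>0$), and let $X_{n,1},\dots,X_{n,n}$ be a triangular array of i.i.d. samples drawn from $p_n$. Then: 1. As $n\to\infty$, $$\sqrt n\Big(\widehat\rho_{k,n}-\min_{j\in\mathcal S_k}\nabla^kp_n(j)\Big)\overset{d}{\longrightarrow}\min_{j\in I_0}\big(Z_j+\nabla^kh(j)\big)+\delta,$$ with $(Z_j)_{j\in\mathcal S_k}\sim\mathcal N(0,\Sigma_k)$, where $(\Sigma_k)_{r,s}=\operatorname{Cov}[\nabla^k\mathbf 1_{\{X_1=m+r-1\}},\nabla^k\mathbf 1_{\{X_1=m+s-1\}}]$ for $r,s\in\{1,\dots,M-k-m+1\}$ and $X_1\sim p$ (the $r$-th coordinate corresponds to the index $j=m+r-1$). 2. $P(\widehat I_{0,n}\ne I_0)=O(1/\sqrt n)$. 3. For all $\alpha\in(0,1)$, $$\liminf_{n\to\infty}P\big(\widehat T_{k,n}<\widehat t_{\alpha,n}(\widehat I_{0,n})\big)\ge\alpha .$$ If $\max_{j\in I_0}\nabla^kh(j)=-\kappa$ for some $\kappa\in(0,\delta]$, then $$\liminf_{n\to\infty}P\big(\widehat T_{k,n}<\widehat t_{\alpha,n}(\widehat I_{0,n})\big)\ge P\big(W_{I_0}\le t_\alpha(I_0)+\kappa\big)>\alpha,$$ where $W_{I_0}=\min_{j\in I_0}Z_j$ and $t_\alpha(I_0)$ is the $\alpha$-quantile of $W_{I_0}$.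
   Context: Let $k\ge1$ be an integer, let $m\le M-k$ be integers, $\mathcal S=\{m,\dots,M\}$, $\mathcal S_k=\{m,\dots,M-k\}$, and let $p$ be a p.m.f. on $\mathbb Z$ with support $\mathcal S$ (i.e. $p(j)>0$ iff $j\in\mathcal S$). For a real function $q$ of an integer variable, $\nabla^kq(j)=(-1)^k\Delta^kq(j)$, where $\Delta^0q(j)=q(j)$, $\Delta^1q(j)=q(j+1)-q(j)$, $\Delta^rq(j)=\Delta^1[\Delta^{r-1}q](j)$ for $r\ge2$. The notation $\nabla^k\mathbf 1_{\{X=j\}}$ means $\nabla^k$ applied to $j\mapsto\mathbf 1_{\{X=j\}}$. Contiguous alternatives: suppose $\rho_k:=\min_{j\in\mathcal S_k}\nabla^kp(j)=0$ and let $I_0=\{j\in\mathcal S_k:\nabla^kp(j)=0\}$ be the set of non-knots of $p$. A sequence $(p_n)_n$ of p.m.f.s is a sequence of alternatives contiguous to $p$ if $p_n(j)=p(j)+h(j)/\sqrt n$ for $j\in\mathcal S$, for some function $h:\mathcal S\to\mathbb R$ such that $\sum_{j\in\mathcal S}h(j)=0$, $\nabla^kh(j)\le0$ for all $j\in I_0$, and $\min_{j\in I_0}\nabla^kh(j)=-\delta$ for some $\delta>0$. (Here $n$ is taken large enough that $p_n$ is a p.m.f.) All statistics below are built from $X_{n,1},\dots,X_{n,n}$: $\widehat p_n(j)=\frac1n\sum_{i=1}^n\mathbf 1_{\{X_{n,i}=j\}}$; $X_{(1)}$, $X_{(n)}$ are the minimum and maximum of the sample; $\widehat{\mathcal S}_{k,n}=\{X_{(1)},\dots,X_{(n)}-k\}$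 (all integers between the endpoints); $\widehat\rho_{k,n}=\min_{j\in\widehat{\mathcal S}_{k,n}}\nabla^k\widehat p_n(j)$ (set to $0$ if $\widehat{\mathcal S}_{k,n}=\emptyset$); $\widehat T_{k,n}=\sqrt n\,\widehat\rho_{k,n}$. Conditionally on the sample, $(\widehat Z_{j,n})_{j\in\mathcal S_k}$ is centred Gaussian with covariances $\frac1n\sum_{l=1}^n\nabla^k\mathbf 1_{\{X_{n,l}=i\}}\nabla^k\mathbf 1_{\{X_{n,l}=j\}}-\nabla^k\widehat p_n(i)\nabla^k\widehat p_n(j)$, $i,j\in\mathcal S_k$, and $\widehat\sigma^2_{j,n}$ denotes the entry $i=j$. For $I\subseteq\mathcal S_k$, $\widehat t_{\alpha,n}(I)$ is $0$ if $I=\emptyset$, and otherwise the $\alpha$-quantile of the conditional law given the sample of $\min_{j\in I}\widehat Z_{j,n}$. With $z_\beta$ the $\beta$-quantile of the standard Gaussian and $n\ge2$, $\widehat I_{0,n}=\{j\in\widehat{\mathcal S}_{k,n}:\sqrt n\,\nabla^k\widehat p_n(j)/\widehat\sigma_{j,n}\le z_{1-1/n}\}$, where, if $\widehat\sigma_{j,n}=0$, the inequality is read as $\sqrt n\,\nabla^k\widehat p_n(j)\le z_{1-1/n}\widehat\sigma_{j,n}$. *)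

theory Defs
  imports "HOL-Probability.Probability" "HOL-Library.Landau_Symbols"
begin

section \<open>Finite differences\<close>

fun fdiff :: "nat \<Rightarrow> (int \<Rightarrow> real) \<Rightarrow> int \<Rightarrow> real" where
  "fdiff 0 q j = q j"
| "fdiff (Suc r) q j = fdiff r q (j + 1) - fdiff r q j"

definition nabla :: "nat \<Rightarrow> (int \<Rightarrow> real) \<Rightarrow> int \<Rightarrow> real" where
  "nabla k q j = (-1) ^ k * fdiff k q j"

text \<open>\<open>nabla_ind k x j\<close> is the operator applied to the indicator of \<open>{x = j}\<close> as a function of \<open>j\<close>.\<close>

definition nabla_ind :: "nat \<Rightarrow> int \<Rightarrow> int \<Rightarrow> real" where
  "nabla_ind k x j = nabla k (\<lambda>i. of_bool (x = i)) j"


section \<open>Quantiles and Gaussian families\<close>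

definition quantile :: "real \<Rightarrow> real measure \<Rightarrow> real" where
  "quantile \<alpha> \<mu> = Inf {t. \<alpha> \<le> cdf \<mu> t}"

text \<open>The centred normal law with variance \<open>v \<ge> 0\<close>; it is the point mass at 0 if \<open>v = 0\<close>.\<close>

definition centred_normal :: "real \<Rightarrow> real measure" where
  "centred_normal v =
     (if v = 0 then return borel 0 else density lborel (normal_density 0 (sqrt v)))"

text \<open>A (possibly degenerate) centred Gaussian vector with covariance matrix \<open>C\<close>: every linear
  combination of the coordinates is a centred normal variable with the variance given by \<open>C\<close>.\<close>

definition centred_gaussian ::
  "'a measure \<Rightarrow> 'i set \<Rightarrow> ('i \<Rightarrow> 'a \<Rightarrow> real) \<Rightarrow> ('i \<Rightarrow> 'i \<Rightarrow> real) \<Rightarrow> bool" where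
  "centred_gaussian N I Z C \<longleftrightarrow>
     prob_space N \<and>
     (\<forall>j\<in>I. Z j \<in> borel_measurable N) \<and>
     (\<forall>a :: 'i \<Rightarrow> real. distr N borel (\<lambda>\<omega>. \<Sum>j\<in>I. a j * Z j \<omega>) =
        centred_normal (\<Sum>i\<in>I. \<Sum>j\<in>I. a i * a j * C i j))"


section \<open>The model\<close>

definition non_knots :: "nat \<Rightarrow> int \<Rightarrow> int \<Rightarrow> int pmf \<Rightarrow> int set" where
  "non_knots k m M p = {j \<in> {m..M - int k}. nabla k (pmf p) j = 0}"

definition pmf_cov :: "int pmf \<Rightarrow> (int \<Rightarrow> real) \<Rightarrow> (int \<Rightarrow> real) \<Rightarrow> real" where
  "pmf_cov p f g = measure_pmf.expectation p
     (\<lambda>x. (f x - measure_pmf.expectation p f) * (g x - measure_pmf.expectation p g))"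

text \<open>The limiting covariance matrix, indexed directly by the points of \<open>{m..M - k}\<close>.\<close>

definition Sigma_k :: "nat \<Rightarrow> int pmf \<Rightarrow> int \<Rightarrow> int \<Rightarrow> real" where
  "Sigma_k k p i j = pmf_cov p (\<lambda>x. nabla_ind k x i) (\<lambda>x. nabla_ind k x j)"

text \<open>The identity \<open>pmf (P n) j = pmf p j + h j / sqrt n\<close> is required for large \<open>n\<close> only, since
  its right-hand side need not be a p.m.f. for small \<open>n\<close>. As \<open>h\<close> sums to 0, it forces \<open>P n\<close> to be
  concentrated on \<open>{m..M}\<close>. The values of \<open>h\<close> outside \<open>{m..M}\<close> play no role.\<close>

definition contiguous_alternatives ::
  "nat \<Rightarrow> int \<Rightarrow> int \<Rightarrow> int pmf \<Rightarrow> (int \<Rightarrow> real) \<Rightarrow> real \<Rightarrow> (nat \<Rightarrow> int pmf) \<Rightarrow> bool" where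
  "contiguous_alternatives k m M p h \<delta> P \<longleftrightarrow>
     (\<Sum>j\<in>{m..M}. h j) = 0 \<and>
     (\<forall>j\<in>non_knots k m M p. nabla k h j \<le> 0) \<and>
     \<delta> > 0 \<and>
     Min (nabla k h ` non_knots k m M p) = - \<delta> \<and>
     (\<forall>\<^sub>F n in sequentially. \<forall>j\<in>{m..M}. pmf (P n) j = pmf p j + h j / sqrt (real n))"

definition iid_rows :: "'a measure \<Rightarrow> (nat \<Rightarrow> nat \<Rightarrow> 'a \<Rightarrow> int) \<Rightarrow> (nat \<Rightarrow> int pmf) \<Rightarrow> bool" where
  "iid_rows \<Omega> X P \<longleftrightarrow>
     (\<forall>n. prob_space.indep_vars \<Omega> (\<lambda>_. count_space UNIV) (X n) {1..n} \<and>
          (\<forall>i\<in>{1..n}. distr \<Omega> (count_space UNIV) (X n i) = measure_pmf (P n)))"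


section \<open>Statistics of a sample \<open>x 1, \<dots>, x n\<close>\<close>

definition emp_pmf :: "nat \<Rightarrow> (nat \<Rightarrow> int) \<Rightarrow> int \<Rightarrow> real" where
  "emp_pmf n x j = (\<Sum>i\<in>{1..n}. of_bool (x i = j)) / real n"

definition S_hat :: "nat \<Rightarrow> nat \<Rightarrow> (nat \<Rightarrow> int) \<Rightarrow> int set" where
  "S_hat k n x = {Min (x ` {1..n}) .. Max (x ` {1..n}) - int k}"

definition rho_hat :: "nat \<Rightarrow> nat \<Rightarrow> (nat \<Rightarrow> int) \<Rightarrow> real" where
  "rho_hat k n x =
     (if S_hat k n x = {} then 0 else Min (nabla k (emp_pmf n x) ` S_hat k n x))"

definition T_hat :: "nat \<Rightarrow> nat \<Rightarrow> (nat \<Rightarrow> int) \<Rightarrow> real" where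
  "T_hat k n x = sqrt (real n) * rho_hat k n x"

definition emp_cov :: "nat \<Rightarrow> nat \<Rightarrow> (nat \<Rightarrow> int) \<Rightarrow> int \<Rightarrow> int \<Rightarrow> real" where
  "emp_cov k n x i j =
     (\<Sum>l\<in>{1..n}. nabla_ind k (x l) i * nabla_ind k (x l) j) / real n
     - nabla k (emp_pmf n x) i * nabla k (emp_pmf n x) j"

definition sigma_hat :: "nat \<Rightarrow> nat \<Rightarrow> (nat \<Rightarrow> int) \<Rightarrow> int \<Rightarrow> real" where
  "sigma_hat k n x j = sqrt (emp_cov k n x j j)"

definition I0_hat :: "nat \<Rightarrow> nat \<Rightarrow> (nat \<Rightarrow> int) \<Rightarrow> int set" where
  "I0_hat k n x =
     {j \<in> S_hat k n x.
        let z = quantile (1 - 1 / real n) std_normal_distribution in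
        if sigma_hat k n x j = 0
        then sqrt (real n) * nabla k (emp_pmf n x) j \<le> z * sigma_hat k n x j
        else sqrt (real n) * nabla k (emp_pmf n x) j / sigma_hat k n x j \<le> z}"


section \<open>Conditioning on the sample\<close>

text \<open>The sample is discrete, so conditioning on it is elementary conditioning on the events
  \<open>{X 1 = x 1, \<dots>, X n = x n}\<close> of positive probability.\<close>

definition sample_event :: "'a measure \<Rightarrow> nat \<Rightarrow> (nat \<Rightarrow> 'a \<Rightarrow> int) \<Rightarrow> (nat \<Rightarrow> int) \<Rightarrow> 'a set" where
  "sample_event \<Omega> n X x = {\<omega> \<in> space \<Omega>. \<forall>i\<in>{1..n}. X i \<omega> = x i}"

definition given_sample ::
  "'a measure \<Rightarrow> nat \<Rightarrow> (nat \<Rightarrow> 'a \<Rightarrow> int) \<Rightarrow> (nat \<Rightarrow> int) \<Rightarrow> 'a measure" where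
  "given_sample \<Omega> n X x = uniform_measure \<Omega> (sample_event \<Omega> n X x)"

definition conditionally_gaussian ::
  "nat \<Rightarrow> int \<Rightarrow> int \<Rightarrow> 'a measure \<Rightarrow> (nat \<Rightarrow> nat \<Rightarrow> 'a \<Rightarrow> int) \<Rightarrow> (nat \<Rightarrow> int \<Rightarrow> 'a \<Rightarrow> real) \<Rightarrow> bool"
  where
  "conditionally_gaussian k m M \<Omega> X Zh \<longleftrightarrow>
     (\<forall>n\<ge>1. \<forall>x. measure \<Omega> (sample_event \<Omega> n (X n) x) > 0 \<longrightarrow>
        centred_gaussian (given_sample \<Omega> n (X n) x) {m..M - int k} (Zh n) (emp_cov k n x))"

text \<open>\<open>\<omega>\<close> enters only through the observed sample \<open>(X 1 \<omega>, \<dots>, X n \<omega>)\<close>.\<close>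

definition t_hat ::
  "'a measure \<Rightarrow> nat \<Rightarrow> (nat \<Rightarrow> 'a \<Rightarrow> int) \<Rightarrow> (int \<Rightarrow> 'a \<Rightarrow> real) \<Rightarrow> real \<Rightarrow> int set \<Rightarrow> 'a \<Rightarrow> real" where
  "t_hat \<Omega> n X Zh \<alpha> I \<omega> =
     (if I = {} then 0
      else quantile \<alpha> (distr (given_sample \<Omega> n X (\<lambda>i. X i \<omega>)) borel
                          (\<lambda>\<omega>'. Min ((\<lambda>j. Zh j \<omega>') ` I))))"

end

theory Submission
  imports Defs "HOL-Real_Asymp.Real_Asymp"
begin

text \<open>On an event whose complement has probability \<open>O(1 / sqrt n)\<close>, the estimated range and the
  estimated set of non-knots are correct and the statistic equals the minimum over the non-knots \<open>j\<close>
  of \<open>Z\<^sub>n\<^sub>,\<^sub>j + nabla k h j\<close>, where \<open>Z\<^sub>n\<^sub>,\<^sub>j\<close> are the scaled deviations of the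
  empirical differences from their means. Hoeffding's inequality controls all events of that kind
  except the erroneous exclusion of a non-knot; as the threshold grows like \<open>sqrt (2 ln n)\<close> only, the
  latter needs a Chernoff bound with the correct variance.

  The multivariate limit theorem behind both the distribution of the statistic and the stability of
  the Gaussian quantiles is the Cramer--Wold device: bounded continuous functions are approximated by
  trigonometric polynomials, so that convergence of the characteristic functions of all linear
  combinations suffices. The same device identifies every Gaussian vector with covariance \<open>Sigma_k\<close>
  with an explicit linear image of independent standard normals. Since some function on \<open>{m..M}\<close> has sum 0
  and constant \<open>k\<close>-th difference 1, that representation allows shifting all coordinates
  simultaneously, so the minimum has a strictly increasing distribution function.\<close>

section \<open>Finite differences\<close>

text \<open>Wrong exclusion of a non-knot is a moderate deviation at level
  \<open>sqrt (2 * ln n)\<close>, heuristically of probability at most about 1/n. Hoeffding's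
  inequality sees the range instead of the variance and may give an exponent below 1/2. The rate 1 /
  sqrt n leaves room for crude constants: 3/2 instead of 2 in the squared quantile and 8/9 for the
  estimated variance multiply to 4/3, the Chernoff correction is 5/4, and 4/3 - (4/3) * (5/4) / 2 is
  exactly 1/2.

  For the power, the critical value is a random quantile of a law that changes with the sample. Only
  one side is controlled: for every s below the limiting quantile, the critical value is at least s
  outside an event of probability O(1 / sqrt n). This suffices because a larger critical value
  enlarges the event that the statistic lies below it, and s can be moved up to the limiting
  quantile by continuity of the limiting distribution function.\<close>

lemma fdiff_cong:
  assumes "\<And>i. i \<in> {j..j + int k} \<Longrightarrow> q i = r i"
  shows "fdiff k q j = fdiff k r j"
  using assms
proof (induction k arbitrary: j)
  case (Suc k)
  have "fdiff k q (j + 1) = fdiff k r (j + 1)" "fdiff k q j = fdiff k r j"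
    by (rule Suc.IH, rule Suc.prems, simp)+
  then show ?case by simp
qed simp

lemma fdiff_sum:
  "fdiff k (\<lambda>i. \<Sum>l\<in>L. c l * q l i) j = (\<Sum>l\<in>L. c l * fdiff k (q l) j)"
  by (induction k arbitrary: j) (simp_all add: right_diff_distrib sum_subtractf)

lemma nabla_sum:
  "nabla k (\<lambda>i. \<Sum>l\<in>L. c l * q l i) j = (\<Sum>l\<in>L. c l * nabla k (q l) j)"
  by (simp add: nabla_def fdiff_sum sum_distrib_left mult_ac)

lemma fdiff_add_scaled: "fdiff k (\<lambda>i. q i + c * r i) j = fdiff k q j + c * fdiff k r j"
  by (induction k arbitrary: j) (simp_all add: algebra_simps)

lemma nabla_add_scaled: "nabla k (\<lambda>i. q i + c * r i) j = nabla k q j + c * nabla k r j"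
  by (simp add: nabla_def fdiff_add_scaled algebra_simps)

lemma nabla_cong:
  assumes "\<And>i. i \<in> {j..j + int k} \<Longrightarrow> q i = r i"
  shows "nabla k q j = nabla k r j"
  using fdiff_cong[OF assms] by (simp add: nabla_def)

text \<open>For \<open>j\<close> in \<open>{m..M - int k}\<close> the window
  \<open>{j..j + int k}\<close> read by the operator stays inside \<open>{m..M}\<close>, so
  \<open>q\<close> may be replaced by its expansion in indicators of points. This turns differences
  of p.m.f.s into means of the bounded functions \<open>nabla_ind k x j\<close>.\<close>

lemma nabla_eq_sum:
  assumes "j \<in> {m..M - int k}"
  shows "nabla k q j = (\<Sum>x\<in>{m..M}. q x * nabla_ind k x j)"
proof -
  have "nabla k q j = nabla k (\<lambda>i. \<Sum>x\<in>{m..M}. q x * of_bool (x = i)) j"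
    using assms by (intro nabla_cong)
      (simp add: of_bool_def if_distrib[of "\<lambda>y. _ * y"] cong: if_cong)
  then show ?thesis by (simp only: nabla_sum nabla_ind_def)
qed

lemma abs_fdiff_le: "(\<And>i. \<bar>q i\<bar> \<le> B) \<Longrightarrow> \<bar>fdiff k q j\<bar> \<le> 2 ^ k * B"
proof (induction k arbitrary: j)
  case (Suc k)
  then have "\<bar>fdiff k q (j + 1)\<bar> \<le> 2 ^ k * B" "\<bar>fdiff k q j\<bar> \<le> 2 ^ k * B" by blast+
  then show ?case by simp
qed simp

lemma abs_nabla_ind_le: "\<bar>nabla_ind k x j\<bar> \<le> 2 ^ k"
  using abs_fdiff_le[of "\<lambda>i. of_bool (x = i)" 1 k j]
  by (simp add: nabla_ind_def nabla_def abs_mult power_abs)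

lemma fdiff_const: "k \<ge> 1 \<Longrightarrow> fdiff k (\<lambda>_. c) j = 0"
proof (induction k arbitrary: j)
  case (Suc k) then show ?case by (cases "k = 0") auto
qed simp

text \<open>Pascal's rule: one difference lowers the lower index by one. The extra \<open>s\<close>
  is what the induction on \<open>r\<close> consumes.\<close>

lemma fdiff_gchoose: "fdiff r (\<lambda>x. of_int x gchoose (r + s)) j = of_int j gchoose s"
proof (induction r arbitrary: s j)
  case (Suc r)
  show ?case using Suc.IH[of "Suc s" "j + 1"] Suc.IH[of "Suc s" j]
    by (simp add: gbinomial_Suc_Suc)
qed simp

text \<open>A binomial polynomial of degree \<open>k\<close> has constant \<open>k\<close>-th
  difference 1, the sign \<open>(-1) ^ k\<close> adapts it to \<open>nabla\<close>, and subtracting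
  its average over \<open>{m..M}\<close> leaves the difference unchanged because
  \<open>k \<ge> 1\<close>. The result becomes the common shift direction in
  \<open>exists_shift\<close>.\<close>

lemma exists_nabla_eq_1:
  fixes m M :: int
  assumes "k \<ge> 1" "m \<le> M"
  obtains \<phi> where "(\<Sum>x\<in>{m..M}. \<phi> x) = 0" "\<And>j. nabla k \<phi> j = 1"
proof -
  define q :: "int \<Rightarrow> real" where "q x = (-1) ^ k * (of_int x gchoose k)" for x
  define c where "c = (\<Sum>x\<in>{m..M}. q x) / real (card {m..M})"
  have fd: "fdiff k (\<lambda>x. of_int x gchoose k) j = 1" for j
    using fdiff_gchoose[of k 0 j] by simp
  have "nabla k (\<lambda>x. q x + (-c) * 1) j = 1" for j
    using fdiff_add_scaled[of k "\<lambda>_. 0" "(-1) ^ k" "\<lambda>x. of_int x gchoose k" j] assms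
    unfolding nabla_add_scaled
    by (simp add: nabla_def q_def[abs_def] fd fdiff_const flip: power_mult_distrib)
  moreover have "(\<Sum>x\<in>{m..M}. q x + (-c) * 1) = 0"
    using assms by (simp add: c_def sum.distrib sum_subtractf)
  ultimately show ?thesis by (rule that[rotated])
qed

lemma nabla_emp_pmf: "nabla k (emp_pmf n x) j = (\<Sum>l\<in>{1..n}. nabla_ind k (x l) j) / real n"
proof -
  have "emp_pmf n x = (\<lambda>i. \<Sum>l\<in>{1..n}. (1 / real n) * of_bool (x l = i))"
    unfolding emp_pmf_def fun_eq_iff sum_divide_distrib by simp
  then show ?thesis
    by (simp only: nabla_sum nabla_ind_def sum_divide_distrib) simp
qed

section \<open>The Cramer--Wold device\<close>

text \<open>The span of cosines and sines of linear forms, whose expectations are real and imaginary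
  parts of characteristic functions. Generating it inductively makes closure under products and
  convergence of expectations inductions on membership.\<close>

inductive_set trig_poly :: "'i set \<Rightarrow> (('i \<Rightarrow> real) \<Rightarrow> real) set" for I where
  cos: "(\<lambda>x. cos (\<Sum>i\<in>I. a i * x i)) \<in> trig_poly I"
| sin: "(\<lambda>x. sin (\<Sum>i\<in>I. a i * x i)) \<in> trig_poly I"
| add: "f \<in> trig_poly I \<Longrightarrow> g \<in> trig_poly I \<Longrightarrow> (\<lambda>x. f x + g x) \<in> trig_poly I"
| scale: "f \<in> trig_poly I \<Longrightarrow> (\<lambda>x. c * f x) \<in> trig_poly I"

text \<open>The product-to-sum formulas produce the sum or difference of two linear forms, which is
  again a linear form, with coefficients \<open>a i + b i\<close> or
  \<open>a i - b i\<close>.\<close>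

lemma trig_poly_add_phase:
  "(\<lambda>x. cos ((\<Sum>i\<in>I. a i * x i) + (\<Sum>i\<in>I. b i * x i))) \<in> trig_poly I"
  "(\<lambda>x. cos ((\<Sum>i\<in>I. a i * x i) - (\<Sum>i\<in>I. b i * x i))) \<in> trig_poly I"
  "(\<lambda>x. sin ((\<Sum>i\<in>I. a i * x i) + (\<Sum>i\<in>I. b i * x i))) \<in> trig_poly I"
  "(\<lambda>x. sin ((\<Sum>i\<in>I. a i * x i) - (\<Sum>i\<in>I. b i * x i))) \<in> trig_poly I"
  using trig_poly.cos[of "\<lambda>i. a i + b i" I] trig_poly.cos[of "\<lambda>i. a i - b i" I]
    trig_poly.sin[of "\<lambda>i. a i + b i" I] trig_poly.sin[of "\<lambda>i. a i - b i" I]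
  by (simp_all add: distrib_right left_diff_distrib sum.distrib sum_subtractf)

lemma trig_poly_diff:
  assumes "f \<in> trig_poly I" "g \<in> trig_poly I" shows "(\<lambda>x. f x - g x) \<in> trig_poly I"
  using trig_poly.add[OF assms(1) trig_poly.scale[OF assms(2), of "-1"]] by simp

lemma trig_poly_half:
  assumes "f \<in> trig_poly I" shows "(\<lambda>x. f x / 2) \<in> trig_poly I"
  using trig_poly.scale[OF assms, of "1/2"] by simp

lemma trig_poly_mult_cos:
  assumes "g \<in> trig_poly I"
  shows "(\<lambda>x. cos (\<Sum>i\<in>I. a i * x i) * g x) \<in> trig_poly I"
  using assms
proof induction
  case (cos b)
  then show ?case by (simp only: cos_times_cos) (intro trig_poly_half trig_poly.add trig_poly_add_phase)
next
  case (sin b)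
  then show ?case by (simp only: cos_times_sin) (intro trig_poly_half trig_poly_diff trig_poly_add_phase)
next
  case (add f g)
  then show ?case using trig_poly.add by (fastforce simp: distrib_left)
next
  case (scale f c)
  then show ?case using trig_poly.scale[OF scale.IH, of c] by (simp add: mult.left_commute)
qed

lemma trig_poly_mult_sin:
  assumes "g \<in> trig_poly I"
  shows "(\<lambda>x. sin (\<Sum>i\<in>I. a i * x i) * g x) \<in> trig_poly I"
  using assms
proof induction
  case (cos b)
  then show ?case by (simp only: sin_times_cos) (intro trig_poly_half trig_poly.add trig_poly_add_phase)
next
  case (sin b)
  then show ?case by (simp only: sin_times_sin) (intro trig_poly_half trig_poly_diff trig_poly_add_phase)
next
  case (add f g)
  then show ?case using trig_poly.add by (fastforce simp: distrib_left)
next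
  case (scale f c)
  then show ?case using trig_poly.scale[OF scale.IH, of c] by (simp add: mult.left_commute)
qed

text \<open>By bilinearity it suffices to multiply two generators. This closure is the algebra
  condition of the Stone-Weierstrass theorem.\<close>

lemma trig_poly_mult:
  assumes "f \<in> trig_poly I" "g \<in> trig_poly I"
  shows "(\<lambda>x. f x * g x) \<in> trig_poly I"
  using assms(1)
proof induction
  case (cos a)
  then show ?case by (rule trig_poly_mult_cos[OF assms(2)])
next
  case (sin a)
  then show ?case by (rule trig_poly_mult_sin[OF assms(2)])
next
  case (add f g)
  then show ?case using trig_poly.add by (fastforce simp: distrib_right)
next
  case (scale f c)
  then show ?case using trig_poly.scale[OF scale.IH, of c] by (simp add: mult.assoc)
qed

lemma trig_poly_const: "(\<lambda>x. c) \<in> trig_poly I"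
  using trig_poly.scale[OF trig_poly.cos[of "\<lambda>_. 0" I], of c] by simp

lemma trig_poly_sin_coord:
  assumes "finite I" "j \<in> I" shows "(\<lambda>x. sin (c * x j)) \<in> trig_poly I"
proof -
  have "(\<Sum>i\<in>I. (if i = j then c else 0) * x i) = c * x j" for x :: "'a \<Rightarrow> real"
    using assms by (subst sum.remove[of _ j]) auto
  then show ?thesis using trig_poly.sin[of "\<lambda>i. if i = j then c else 0" I] by simp
qed

text \<open>Substituting \<open>x = L arcsin s\<close> turns uniform polynomial approximation on the cube into
  approximation by trigonometric polynomials that are globally bounded.\<close>

lemma trig_poly_approx:
  fixes f :: "('i :: countable \<Rightarrow> real) \<Rightarrow> real"
  assumes fin: "finite I" and cont: "continuous_on UNIV f"
    and dep: "\<And>x y. (\<And>i. i \<in> I \<Longrightarrow> x i = y i) \<Longrightarrow> f x = f y"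
    and bd: "\<And>x. \<bar>f x\<bar> \<le> B" and L: "L > 0" and e: "e > 0"
  obtains g where "g \<in> trig_poly I" "\<And>x. \<bar>g x\<bar> \<le> B + e"
    "\<And>x. (\<And>i. i \<in> I \<Longrightarrow> \<bar>x i\<bar> \<le> L) \<Longrightarrow> \<bar>f x - g x\<bar> \<le> e"
proof -
  \<comment> \<open>Coordinates outside \<open>I\<close> are frozen at 0: the cube is compact in the
    full function space, and its points are separated by the coordinates in \<open>I\<close>
    alone.\<close>
  define K where "K = Pi\<^sub>E UNIV (\<lambda>i::'i. if i \<in> I then {-1..1::real} else {0})"
  define s where "s x = (\<lambda>i. if i \<in> I then sin (x i / L) else 0)" for x :: "'i \<Rightarrow> real"
  \<comment> \<open>Membership in the ring is tested after substituting \<open>s\<close>, so that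
    the approximant supplied by Stone-Weierstrass is a trigonometric polynomial by
    construction.\<close>
  define R where "R = {F. continuous_on K F \<and> (\<lambda>x. F (s x)) \<in> trig_poly I}"
  define F where "F u = f (\<lambda>i. L * arcsin (u i))" for u
  have K_iff: "u \<in> K \<longleftrightarrow> (\<forall>i. (i \<in> I \<longrightarrow> \<bar>u i\<bar> \<le> 1) \<and> (i \<notin> I \<longrightarrow> u i = 0))" for u
    unfolding K_def by (auto simp: PiE_iff abs_le_iff split: if_splits)
  have "compactin (product_topology (\<lambda>_::'i. euclidean :: real topology) UNIV) K"
    unfolding K_def by (subst compactin_PiE) (auto simp: compactin_euclidean_iff)
  then have "compact K"
    by (simp add: euclidean_product_topology compactin_euclidean_iff)
  interpret function_ring_on R K
  proof
    show "compact K" by fact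
    show "continuous_on K F" if "F \<in> R" for F using that by (simp add: R_def)
    show "(\<lambda>x. F x + G x) \<in> R" "(\<lambda>x. F x * G x) \<in> R" if "F \<in> R" "G \<in> R" for F G
      using that by (auto simp: R_def intro: continuous_intros trig_poly.add trig_poly_mult)
    show "(\<lambda>_. c) \<in> R" for c by (simp add: R_def trig_poly_const)
    show "\<exists>F\<in>R. F u \<noteq> F v" if "u \<in> K" "v \<in> K" "u \<noteq> v" for u v
    proof -
      obtain j where j: "u j \<noteq> v j" using \<open>u \<noteq> v\<close> by auto
      then have "j \<in> I" using that by (auto simp: K_iff)
      then have "(\<lambda>u. u j) \<in> R"
        using trig_poly_sin_coord[OF fin, of j "1/L"]
        by (auto simp: R_def s_def intro!: continuous_on_subset[OF continuous_on_product_coordinates])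
      with j show ?thesis by (intro bexI[of _ "\<lambda>u. u j"])
    qed
  qed
  have "continuous_on K F"
    unfolding F_def[abs_def]
  proof (rule continuous_on_compose2[OF cont])
    have "continuous_on K (\<lambda>u. L * arcsin (u i))" for i
    proof (intro continuous_on_mult_left continuous_on_arcsin)
      show "continuous_on K (\<lambda>u. u i)" by (rule continuous_on_subset[OF continuous_on_product_coordinates]) simp
      show "\<forall>u\<in>K. - 1 \<le> u i \<and> u i \<le> 1"
      proof
        fix u assume "u \<in> K"
        then show "- 1 \<le> u i \<and> u i \<le> 1" by (cases "i \<in> I") (auto simp: K_iff abs_le_iff)
      qed
    qed
    then show "continuous_on K (\<lambda>u i. L * arcsin (u i))"
      by (intro continuous_on_coordinatewise_then_product) auto
  qed auto
  then obtain G where G: "G \<in> R" "\<And>u. u \<in> K \<Longrightarrow> \<bar>F u - G u\<bar> < e"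
    using Stone_Weierstrass_basic[of F e] e by blast
  have sK: "s x \<in> K" for x by (simp add: K_iff s_def)
  show ?thesis
  proof
    show "(\<lambda>x. G (s x)) \<in> trig_poly I" using G by (simp add: R_def)
    \<comment> \<open>\<open>s\<close> maps every point into the cube, even one with coordinates
      beyond \<open>L\<close>; hence the bound is global.\<close>
    show "\<bar>G (s x)\<bar> \<le> B + e" for x
      using G(2)[OF sK, of x] bd[of "\<lambda>i. L * arcsin (s x i)"] unfolding F_def by linarith
    fix x assume x: "\<And>i. i \<in> I \<Longrightarrow> \<bar>x i\<bar> \<le> L"
    have "L * arcsin (s x i) = x i" if "i \<in> I" for i
    proof -
      have "\<bar>x i / L\<bar> \<le> 1" using x[OF that] L by (simp add: abs_divide)
      \<comment> \<open>Since 1 is at most \<open>pi / 2\<close>, the argument lies where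
        \<open>arcsin\<close> inverts \<open>sin\<close>.\<close>
      then have "arcsin (sin (x i / L)) = x i / L"
        using pi_ge_two unfolding abs_le_iff by (intro arcsin_sin) linarith+
      then show ?thesis using L that by (simp add: s_def)
    qed
    then have "F (s x) = f x" unfolding F_def by (intro dep)
    then show "\<bar>f x - G (s x)\<bar> \<le> e" using G(2)[OF sK, of x] by simp
  qed
qed

lemma Re_Im_char_distr:
  assumes "prob_space M" "u \<in> borel_measurable M"
  shows "Re (char (distr M borel u) 1) = (\<integral>\<omega>. cos (u \<omega>) \<partial>M)"
    "Im (char (distr M borel u) 1) = (\<integral>\<omega>. sin (u \<omega>) \<partial>M)"
proof -
  interpret prob_space M by fact
  have "integrable M (\<lambda>x. iexp (u x))"
    using assms(2) by (intro integrable_const_bound[where B=1]) auto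
  moreover have "char (distr M borel u) 1 = (CLINT x|M. iexp (u x))"
    unfolding char_def using assms(2) by (subst integral_distr) auto
  ultimately show "Re (char (distr M borel u) 1) = (\<integral>\<omega>. cos (u \<omega>) \<partial>M)"
    "Im (char (distr M borel u) 1) = (\<integral>\<omega>. sin (u \<omega>) \<partial>M)"
    by (simp_all add: Re_exp Im_exp flip: integral_Re integral_Im)
qed

lemma trig_poly_measurable_bounded:
  assumes "g \<in> trig_poly I" "\<And>i. i \<in> I \<Longrightarrow> Y i \<in> borel_measurable M"
  shows "(\<lambda>\<omega>. g (\<lambda>i. Y i \<omega>)) \<in> borel_measurable M \<and> (\<exists>C. \<forall>x. \<bar>g x\<bar> \<le> C)"
  using assms(1)
proof induction
  case (cos a)
  have "(\<lambda>\<omega>. \<Sum>i\<in>I. a i * Y i \<omega>) \<in> borel_measurable M" using assms(2) by measurable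
  then show ?case by (auto intro: exI[of _ 1])
next
  case (sin a)
  have "(\<lambda>\<omega>. \<Sum>i\<in>I. a i * Y i \<omega>) \<in> borel_measurable M" using assms(2) by measurable
  then show ?case by (auto intro: exI[of _ 1])
next
  case (add f g)
  then obtain C D where "\<And>x. \<bar>f x\<bar> \<le> C" "\<And>x. \<bar>g x\<bar> \<le> D" by blast
  then have "\<bar>f x + g x\<bar> \<le> C + D" for x by (meson abs_triangle_ineq add_mono order_trans)
  then show ?case using add.IH by auto
next
  case (scale f c)
  then obtain C where "\<And>x. \<bar>f x\<bar> \<le> C" by blast
  then have "\<bar>c * f x\<bar> \<le> \<bar>c\<bar> * C" for x by (simp add: abs_mult mult_left_mono)
  then show ?case using scale.IH by auto
qed

lemma (in prob_space) trig_poly_integrable: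
  assumes "g \<in> trig_poly I" "\<And>i. i \<in> I \<Longrightarrow> Y i \<in> borel_measurable M"
  shows "integrable M (\<lambda>\<omega>. g (\<lambda>i. Y i \<omega>))"
proof -
  obtain C where "\<And>x. \<bar>g x\<bar> \<le> C" and "(\<lambda>\<omega>. g (\<lambda>i. Y i \<omega>)) \<in> borel_measurable M"
    using trig_poly_measurable_bounded[of g I Y M] assms by blast
  then show ?thesis by (intro integrable_const_bound[where B=C]) auto
qed

text \<open>For a generator the claim is the real or imaginary part of \<open>char\<close>; the
  general case follows by linearity.\<close>

lemma trig_poly_expectation_tendsto:
  assumes M: "\<And>n::nat. prob_space (M n)" and N: "prob_space N"
    and Y: "\<And>n i. i \<in> I \<Longrightarrow> Y n i \<in> borel_measurable (M n)"
    and Z: "\<And>i. i \<in> I \<Longrightarrow> Z i \<in> borel_measurable N"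
    and char: "\<And>a. (\<lambda>n. char (distr (M n) borel (\<lambda>\<omega>. \<Sum>i\<in>I. a i * Y n i \<omega>)) 1)
        \<longlonglongrightarrow> char (distr N borel (\<lambda>\<omega>. \<Sum>i\<in>I. a i * Z i \<omega>)) 1"
    and g: "g \<in> trig_poly I"
  shows "(\<lambda>n. \<integral>\<omega>. g (\<lambda>i. Y n i \<omega>) \<partial>M n) \<longlonglongrightarrow> (\<integral>\<omega>. g (\<lambda>i. Z i \<omega>) \<partial>N)"
  using g
proof induction
  case (cos a)
  have "(\<lambda>\<omega>. \<Sum>i\<in>I. a i * Y n i \<omega>) \<in> borel_measurable (M n)" for n using Y by measurable
  moreover have "(\<lambda>\<omega>. \<Sum>i\<in>I. a i * Z i \<omega>) \<in> borel_measurable N" using Z by measurable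
  ultimately show ?case using tendsto_Re[OF char[of a]] by (simp add: Re_Im_char_distr M N)
next
  case (sin a)
  have "(\<lambda>\<omega>. \<Sum>i\<in>I. a i * Y n i \<omega>) \<in> borel_measurable (M n)" for n using Y by measurable
  moreover have "(\<lambda>\<omega>. \<Sum>i\<in>I. a i * Z i \<omega>) \<in> borel_measurable N" using Z by measurable
  ultimately show ?case using tendsto_Im[OF char[of a]] by (simp add: Re_Im_char_distr M N)
next
  case (add f g)
  then show ?case
    using prob_space.trig_poly_integrable[where Y="Y _", OF M _ Y]
      prob_space.trig_poly_integrable[where Y=Z, OF N _ Z]
    by (simp add: tendsto_add)
next
  case (scale f c)
  then show ?case by (simp add: tendsto_mult_left)
qed

text \<open>The second moments provide tightness, in the form of the pointwise bound
  \<open>\<bar>f - g\<bar> \<le> e + (2 B + e) / L\<^sup>2 \<cdot> (\<Sum>i\<in>I. x\<^sub>i\<^sup>2)\<close>.\<close>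

theorem cramer_wold_tendsto:
  fixes f :: "('i :: countable \<Rightarrow> real) \<Rightarrow> real"
  assumes fin: "finite I" and M: "\<And>n::nat. prob_space (M n)" and N: "prob_space N"
    and Y: "\<And>n i. i \<in> I \<Longrightarrow> Y n i \<in> borel_measurable (M n)"
    and Z: "\<And>i. i \<in> I \<Longrightarrow> Z i \<in> borel_measurable N"
    and Y2: "\<And>n i. i \<in> I \<Longrightarrow> integrable (M n) (\<lambda>\<omega>. (Y n i \<omega>)\<^sup>2)"
      "\<And>n i. i \<in> I \<Longrightarrow> (\<integral>\<omega>. (Y n i \<omega>)\<^sup>2 \<partial>M n) \<le> C"
    and Z2: "\<And>i. i \<in> I \<Longrightarrow> integrable N (\<lambda>\<omega>. (Z i \<omega>)\<^sup>2)"
      "\<And>i. i \<in> I \<Longrightarrow> (\<integral>\<omega>. (Z i \<omega>)\<^sup>2 \<partial>N) \<le> C"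
    and char: "\<And>a. (\<lambda>n. char (distr (M n) borel (\<lambda>\<omega>. \<Sum>i\<in>I. a i * Y n i \<omega>)) 1)
        \<longlonglongrightarrow> char (distr N borel (\<lambda>\<omega>. \<Sum>i\<in>I. a i * Z i \<omega>)) 1"
    and cont: "continuous_on UNIV f"
    and dep: "\<And>x y. (\<And>i. i \<in> I \<Longrightarrow> x i = y i) \<Longrightarrow> f x = f y"
    and bd: "\<And>x. \<bar>f x\<bar> \<le> B"
    and fY: "\<And>n. (\<lambda>\<omega>. f (\<lambda>i. Y n i \<omega>)) \<in> borel_measurable (M n)"
    and fZ: "(\<lambda>\<omega>. f (\<lambda>i. Z i \<omega>)) \<in> borel_measurable N"
  shows "(\<lambda>n. \<integral>\<omega>. f (\<lambda>i. Y n i \<omega>) \<partial>M n) \<longlonglongrightarrow> (\<integral>\<omega>. f (\<lambda>i. Z i \<omega>) \<partial>N)"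
proof (rule LIMSEQ_I)
  fix r :: real assume r: "r > 0"
  have B: "B \<ge> 0" using bd[of "\<lambda>_. 0"] by linarith
  \<comment> \<open>Replacing \<open>f\<close> by \<open>g\<close> costs \<open>2 * e\<close> on
    each side and convergence for \<open>g\<close> costs \<open>e\<close>: in total less than
    \<open>5 * e\<close>, which is below \<open>r\<close>.\<close>
  define e where "e = r / 8"
  have e: "e > 0" using r by (simp add: e_def)
  define A where "A = (2 * B + e) * (real (card I) * \<bar>C\<bar>)"
  \<comment> \<open>Chosen so that the second-moment part of the error,
    \<open>A / L\<^sup>2\<close>, is at most \<open>e\<close>.\<close>
  define L where "L = sqrt (A / e + 1)"
  have A: "A \<ge> 0" using B e by (simp add: A_def)
  have L2: "L\<^sup>2 = A / e + 1" and L: "L > 0" using A e by (simp_all add: L_def add_nonneg_pos)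
  have AL: "A / L\<^sup>2 \<le> e" using A e by (simp add: L2 field_simps)
  obtain g where g: "g \<in> trig_poly I" "\<And>x. \<bar>g x\<bar> \<le> B + e"
    "\<And>x. (\<And>i. i \<in> I \<Longrightarrow> \<bar>x i\<bar> \<le> L) \<Longrightarrow> \<bar>f x - g x\<bar> \<le> e"
    using trig_poly_approx[OF fin cont dep bd L e] by metis
  have ptw: "\<bar>f x - g x\<bar> \<le> e + (2 * B + e) / L\<^sup>2 * (\<Sum>i\<in>I. (x i)\<^sup>2)" for x
  proof (cases "\<forall>i\<in>I. \<bar>x i\<bar> \<le> L")
    case True
    then have "\<bar>f x - g x\<bar> \<le> e" using g(3) by blast
    moreover have "0 \<le> (2 * B + e) / L\<^sup>2 * (\<Sum>i\<in>I. (x i)\<^sup>2)"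
      using B e by (intro mult_nonneg_nonneg sum_nonneg) auto
    ultimately show ?thesis by linarith
  next
    \<comment> \<open>Outside the box the sum of squares exceeds \<open>L\<^sup>2\<close>, while
      \<open>\<bar>f x - g x\<bar>\<close> never exceeds \<open>2 * B + e\<close>.\<close>
    case False
    then obtain i where i: "i \<in> I" "\<bar>x i\<bar> > L" by auto
    then have "L\<^sup>2 \<le> (x i)\<^sup>2" using L by (metis abs_le_square_iff abs_of_pos less_imp_le)
    also have "\<dots> \<le> (\<Sum>i\<in>I. (x i)\<^sup>2)" using fin i by (intro member_le_sum) auto
    finally have "1 \<le> (\<Sum>i\<in>I. (x i)\<^sup>2) / L\<^sup>2" using L by simp
    then have "(2 * B + e) * 1 \<le> (2 * B + e) * ((\<Sum>i\<in>I. (x i)\<^sup>2) / L\<^sup>2)"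
      using B e by (intro mult_left_mono) auto
    then show ?thesis using bd[of x] g(2)[of x] e by (simp add: abs_le_iff)
  qed
  have close: "\<bar>(\<integral>\<omega>. f (\<lambda>i. V i \<omega>) \<partial>Q) - (\<integral>\<omega>. g (\<lambda>i. V i \<omega>) \<partial>Q)\<bar> \<le> 2 * e"
    if Q: "prob_space Q" and V: "\<And>i. i \<in> I \<Longrightarrow> V i \<in> borel_measurable Q"
      and V2: "\<And>i. i \<in> I \<Longrightarrow> integrable Q (\<lambda>\<omega>. (V i \<omega>)\<^sup>2)"
        "\<And>i. i \<in> I \<Longrightarrow> (\<integral>\<omega>. (V i \<omega>)\<^sup>2 \<partial>Q) \<le> C"
      and fV: "(\<lambda>\<omega>. f (\<lambda>i. V i \<omega>)) \<in> borel_measurable Q"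
    for V :: "'i \<Rightarrow> 'x \<Rightarrow> real" and Q :: "'x measure"
  proof -
    interpret Q: prob_space Q by fact
    have if': "integrable Q (\<lambda>\<omega>. f (\<lambda>i. V i \<omega>))"
      using fV bd by (intro Q.integrable_const_bound[where B=B]) auto
    have ig: "integrable Q (\<lambda>\<omega>. g (\<lambda>i. V i \<omega>))"
      by (rule Q.trig_poly_integrable[OF g(1) V])
    have sq: "integrable Q (\<lambda>\<omega>. \<Sum>i\<in>I. (V i \<omega>)\<^sup>2)" using V2 by auto
    have "\<bar>(\<integral>\<omega>. f (\<lambda>i. V i \<omega>) \<partial>Q) - (\<integral>\<omega>. g (\<lambda>i. V i \<omega>) \<partial>Q)\<bar>
        = \<bar>\<integral>\<omega>. f (\<lambda>i. V i \<omega>) - g (\<lambda>i. V i \<omega>) \<partial>Q\<bar>" using if' ig by simp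
    also have "\<dots> \<le> (\<integral>\<omega>. \<bar>f (\<lambda>i. V i \<omega>) - g (\<lambda>i. V i \<omega>)\<bar> \<partial>Q)" by (rule integral_abs_bound)
    also have "\<dots> \<le> (\<integral>\<omega>. e + (2 * B + e) / L\<^sup>2 * (\<Sum>i\<in>I. (V i \<omega>)\<^sup>2) \<partial>Q)"
      using if' ig sq ptw by (intro integral_mono) auto
    also have "\<dots> = e + (2 * B + e) / L\<^sup>2 * (\<Sum>i\<in>I. \<integral>\<omega>. (V i \<omega>)\<^sup>2 \<partial>Q)"
      using sq V2 by (simp add: Q.prob_space)
    also have "\<dots> \<le> e + (2 * B + e) / L\<^sup>2 * (\<Sum>i\<in>I. \<bar>C\<bar>)"
      using V2 B e by (intro add_left_mono mult_left_mono sum_mono) (auto intro: order_trans[OF _ abs_ge_self])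
    also have "\<dots> = e + A / L\<^sup>2" by (simp add: A_def)
    finally show ?thesis using AL by simp
  qed
  have "(\<lambda>n. \<integral>\<omega>. g (\<lambda>i. Y n i \<omega>) \<partial>M n) \<longlonglongrightarrow> (\<integral>\<omega>. g (\<lambda>i. Z i \<omega>) \<partial>N)"
    by (rule trig_poly_expectation_tendsto[OF M N Y Z char g(1)])
  from tendstoD[OF this e] obtain n0 where n0: "\<And>n. n \<ge> n0 \<Longrightarrow>
      \<bar>(\<integral>\<omega>. g (\<lambda>i. Y n i \<omega>) \<partial>M n) - (\<integral>\<omega>. g (\<lambda>i. Z i \<omega>) \<partial>N)\<bar> < e"
    by (auto simp: eventually_sequentially dist_real_def)
  show "\<exists>n0. \<forall>n\<ge>n0. norm ((\<integral>\<omega>. f (\<lambda>i. Y n i \<omega>) \<partial>M n) - (\<integral>\<omega>. f (\<lambda>i. Z i \<omega>) \<partial>N)) < r"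
  proof (intro exI allI impI)
    fix n assume "n \<ge> n0"
    then show "norm ((\<integral>\<omega>. f (\<lambda>i. Y n i \<omega>) \<partial>M n) - (\<integral>\<omega>. f (\<lambda>i. Z i \<omega>) \<partial>N)) < r"
      using n0[of n] close[OF M Y Y2 fY, of n] close[OF N Z Z2 fZ] r
      unfolding e_def real_norm_def by linarith
  qed
qed

section \<open>Gaussian vectors and their minima\<close>

lemma continuous_on_Min_image:
  fixes f :: "'i \<Rightarrow> 'a::topological_space \<Rightarrow> real"
  assumes "finite J" "J \<noteq> {}" "\<And>j. j \<in> J \<Longrightarrow> continuous_on S (f j)"
  shows "continuous_on S (\<lambda>x. Min ((\<lambda>j. f j x) ` J))"
  using assms
proof (induction J rule: finite_ne_induct)
  case (insert j J)
  then have "(\<lambda>x. Min ((\<lambda>j. f j x) ` insert j J)) = (\<lambda>x. min (f j x) (Min ((\<lambda>j. f j x) ` J)))"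
    by simp
  then show ?case using insert by (auto intro: continuous_on_min)
qed simp

text \<open>A continuous step function of the shifted minimum is a bounded continuous function of
  the coordinates in \<open>J\<close>, hence an admissible test function for
  \<open>cramer_wold_tendsto\<close>. The result serves both the scaled sample deviations and
  Gaussian vectors with converging covariances.\<close>

theorem weak_conv_Min:
  fixes Y :: "nat \<Rightarrow> 'i::countable \<Rightarrow> 'a \<Rightarrow> real"
  assumes J: "finite J" "J \<noteq> {}" and M: "\<And>n. prob_space (M n)" and N: "prob_space N"
    and Y: "\<And>n i. i \<in> J \<Longrightarrow> Y n i \<in> borel_measurable (M n)"
    and Z: "\<And>i. i \<in> J \<Longrightarrow> Z i \<in> borel_measurable N"
    and Y2: "\<And>n i. i \<in> J \<Longrightarrow> integrable (M n) (\<lambda>\<omega>. (Y n i \<omega>)\<^sup>2)"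
      "\<And>n i. i \<in> J \<Longrightarrow> (\<integral>\<omega>. (Y n i \<omega>)\<^sup>2 \<partial>M n) \<le> C"
    and Z2: "\<And>i. i \<in> J \<Longrightarrow> integrable N (\<lambda>\<omega>. (Z i \<omega>)\<^sup>2)"
      "\<And>i. i \<in> J \<Longrightarrow> (\<integral>\<omega>. (Z i \<omega>)\<^sup>2 \<partial>N) \<le> C"
    and char: "\<And>a. (\<lambda>n. char (distr (M n) borel (\<lambda>\<omega>. \<Sum>i\<in>J. a i * Y n i \<omega>)) 1)
        \<longlonglongrightarrow> char (distr N borel (\<lambda>\<omega>. \<Sum>i\<in>J. a i * Z i \<omega>)) 1"
  shows "weak_conv_m (\<lambda>n. distr (M n) borel (\<lambda>\<omega>. Min ((\<lambda>j. Y n j \<omega> + c j) ` J)))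
    (distr N borel (\<lambda>\<omega>. Min ((\<lambda>j. Z j \<omega> + c j) ` J)))"
proof (rule integral_cts_step_conv_imp_weak_conv)
  have mY: "(\<lambda>\<omega>. Min ((\<lambda>j. Y n j \<omega> + c j) ` J)) \<in> borel_measurable (M n)" for n
    using J Y by measurable
  have mZ: "(\<lambda>\<omega>. Min ((\<lambda>j. Z j \<omega> + c j) ` J)) \<in> borel_measurable N"
    using J Z by measurable
  show "real_distribution (distr (M n) borel (\<lambda>\<omega>. Min ((\<lambda>j. Y n j \<omega> + c j) ` J)))" for n
    by (rule prob_space.real_distribution_distr[OF M mY])
  show "real_distribution (distr N borel (\<lambda>\<omega>. Min ((\<lambda>j. Z j \<omega> + c j) ` J)))"
    by (rule prob_space.real_distribution_distr[OF N mZ])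
  fix x y :: real assume "x < y"
  have cs: "continuous_on UNIV (cts_step x y)"
    using cts_step_uniformly_continuous[OF \<open>x < y\<close>] by (rule uniformly_continuous_imp_continuous)
  then have [measurable]: "cts_step x y \<in> borel_measurable borel"
    by (rule borel_measurable_continuous_onI)
  define f where "f v = cts_step x y (Min ((\<lambda>j. v j + c j) ` J))" for v
  have "continuous_on UNIV f"
    unfolding f_def[abs_def]
    by (intro continuous_on_compose2[OF cs] continuous_on_Min_image J continuous_intros
        continuous_on_product_coordinates) auto
  moreover have "f v = f w" if "\<And>i. i \<in> J \<Longrightarrow> v i = w i" for v w
    unfolding f_def using that by (simp cong: image_cong)
  moreover have "\<bar>f v\<bar> \<le> 1" for v
    using \<open>x < y\<close> by (auto simp: f_def cts_step_def)
  moreover have "(\<lambda>\<omega>. f (\<lambda>i. Y n i \<omega>)) \<in> borel_measurable (M n)" for n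
    unfolding f_def using mY by measurable
  moreover have "(\<lambda>\<omega>. f (\<lambda>i. Z i \<omega>)) \<in> borel_measurable N"
    unfolding f_def using mZ by measurable
  ultimately have "(\<lambda>n. \<integral>\<omega>. f (\<lambda>i. Y n i \<omega>) \<partial>M n) \<longlonglongrightarrow> (\<integral>\<omega>. f (\<lambda>i. Z i \<omega>) \<partial>N)"
    by (rule cramer_wold_tendsto[OF J(1) M N Y Z Y2 Z2 char, rotated -5])
  then show "(\<lambda>n. integral\<^sup>L (distr (M n) borel (\<lambda>\<omega>. Min ((\<lambda>j. Y n j \<omega> + c j) ` J))) (cts_step x y))
      \<longlonglongrightarrow> integral\<^sup>L (distr N borel (\<lambda>\<omega>. Min ((\<lambda>j. Z j \<omega> + c j) ` J))) (cts_step x y)"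
    by (simp add: integral_distr mY mZ f_def)
qed

section \<open>Centred normal laws on the line\<close>

lemma centred_normal_eq_scaled:
  "centred_normal v = distr std_normal_distribution borel (\<lambda>x. sqrt v * x)"
proof (cases "v = 0")
  case True
  have "distr std_normal_distribution borel (\<lambda>x. 0 :: real) = return borel 0"
    by (rule prob_space.distr_const[OF prob_space_normal_density]) simp_all
  then show ?thesis by (simp only: centred_normal_def True real_sqrt_zero mult_zero_left if_True simp_thms)
next
  case False
  interpret S: prob_space std_normal_distribution by (rule prob_space_normal_density) simp
  have "distributed std_normal_distribution lborel (\<lambda>x. x) std_normal_density"
    by (auto simp: distributed_def distr_id2)
  from S.normal_density_affine[OF this, of "sqrt v" 0] False
  have "distr std_normal_distribution lborel (\<lambda>x. sqrt v * x) = density lborel (normal_density 0 \<bar>sqrt v\<bar>)"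
    by (simp add: distributed_def)
  moreover have "normal_density 0 \<bar>sqrt v\<bar> = normal_density 0 (sqrt v)"
    by (simp add: normal_density_def fun_eq_iff)
  moreover have "distr std_normal_distribution lborel (\<lambda>x. sqrt v * x) = distr std_normal_distribution borel (\<lambda>x. sqrt v * x)"
    by (rule distr_cong) auto
  ultimately show ?thesis using False by (simp add: centred_normal_def)
qed

lemma real_distribution_centred_normal: "real_distribution (centred_normal v)"
  unfolding centred_normal_eq_scaled
  by (intro prob_space.real_distribution_distr prob_space_normal_density) auto

text \<open>\<open>sqrt\<close> is odd on the reals, so a negative \<open>v\<close> gives the same
  normal law as its absolute value. Carrying \<open>\<bar>v\<bar>\<close> through characteristic
  functions and moments avoids a sign condition on every quadratic form.\<close>

lemma sqrt_power2: "(sqrt v)\<^sup>2 = \<bar>v\<bar>"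
  by (simp add: power2_eq_square)

lemma char_centred_normal: "char (centred_normal v) t = exp (- (\<bar>v\<bar> * t\<^sup>2) / 2)"
proof -
  have "char (centred_normal v) t = char std_normal_distribution (sqrt v * t)"
    unfolding centred_normal_eq_scaled char_def by (simp add: integral_distr mult_ac)
  also have "\<dots> = exp (- (\<bar>v\<bar> * t\<^sup>2) / 2)"
    by (simp add: char_std_normal_distribution power_mult_distrib sqrt_power2)
  finally show ?thesis .
qed

lemma centred_normal_second_moment:
  "integrable (centred_normal v) (\<lambda>x. x\<^sup>2)" "(\<integral>x. x\<^sup>2 \<partial>centred_normal v) = \<bar>v\<bar>"
proof -
  show "integrable (centred_normal v) (\<lambda>x. x\<^sup>2)"
    unfolding centred_normal_eq_scaled using integrable_std_normal_distribution_moment[of 2]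
    by (simp add: integrable_distr_eq power_mult_distrib)
  show "(\<integral>x. x\<^sup>2 \<partial>centred_normal v) = \<bar>v\<bar>"
    unfolding centred_normal_eq_scaled using std_normal_distribution_even_moments(1)[of 1]
    by (simp add: integral_distr power_mult_distrib sqrt_power2 fact_numeral)
qed

lemma centred_normal_singleton:
  assumes "v \<noteq> 0" shows "measure (centred_normal v) {t} = 0"
proof -
  have "{t} \<in> null_sets lborel" by (simp add: finite_imp_null_set_lborel)
  then have "{t} \<in> null_sets (density lborel (normal_density 0 (sqrt v)))"
    using absolutely_continuousI_density[of "normal_density 0 (sqrt v)" lborel]
    by (auto simp: absolutely_continuous_def)
  then have "emeasure (centred_normal v) {t} = 0"
    using assms by (simp add: centred_normal_def null_setsD1)
  then show ?thesis by (simp add: measure_def)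
qed

section \<open>Marginals, moments and minima of Gaussian vectors\<close>

context
  fixes N :: "'b measure" and I :: "'i set" and Z :: "'i \<Rightarrow> 'b \<Rightarrow> real" and C :: "'i \<Rightarrow> 'i \<Rightarrow> real"
  assumes G: "centred_gaussian N I Z C" and fin: "finite I"
begin

text \<open>A linear form in the coordinates of \<open>J\<close> is one in those of \<open>I\<close>
  with zero coefficients elsewhere.\<close>

lemma gaussian_subset:
  assumes "J \<subseteq> I" shows "centred_gaussian N J Z C"
  unfolding centred_gaussian_def
proof (intro conjI allI)
  fix a :: "'i \<Rightarrow> real"
  define b where "b i = (if i \<in> J then a i else 0)" for i
  have *: "(\<Sum>j\<in>I. b j * f j) = (\<Sum>j\<in>J. a j * f j)" for f :: "'i \<Rightarrow> real"
    using assms fin by (intro sum.mono_neutral_cong_right) (auto simp: b_def)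
  have "distr N borel (\<lambda>\<omega>. \<Sum>j\<in>I. b j * Z j \<omega>) = centred_normal (\<Sum>i\<in>I. \<Sum>j\<in>I. b i * b j * C i j)"
    using G unfolding centred_gaussian_def by blast
  also have "(\<Sum>i\<in>I. \<Sum>j\<in>I. b i * b j * C i j) = (\<Sum>i\<in>I. b i * (\<Sum>j\<in>I. b j * C i j))"
    by (simp add: sum_distrib_left mult.assoc)
  also have "\<dots> = (\<Sum>i\<in>J. a i * (\<Sum>j\<in>J. a j * C i j))" by (simp only: *)
  also have "\<dots> = (\<Sum>i\<in>J. \<Sum>j\<in>J. a i * a j * C i j)"
    by (simp add: sum_distrib_left mult.assoc)
  finally show "distr N borel (\<lambda>\<omega>. \<Sum>j\<in>J. a j * Z j \<omega>) = centred_normal (\<Sum>i\<in>J. \<Sum>j\<in>J. a i * a j * C i j)"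
    by (simp add: *)
qed (use G assms in \<open>auto simp: centred_gaussian_def\<close>)

lemma gaussian_coordinate:
  assumes "j \<in> I" shows "distr N borel (Z j) = centred_normal (C j j)"
proof -
  have "centred_gaussian N {j} Z C" by (rule gaussian_subset) (use assms in auto)
  then have "distr N borel (\<lambda>\<omega>. \<Sum>j\<in>{j}. 1 * Z j \<omega>) = centred_normal (\<Sum>i\<in>{j}. \<Sum>j\<in>{j}. 1 * 1 * C i j)"
    unfolding centred_gaussian_def by (elim conjE allE[of _ "\<lambda>_. 1"])
  then show ?thesis by simp
qed

lemma gaussian_second_moment:
  assumes "j \<in> I"
  shows "integrable N (\<lambda>\<omega>. (Z j \<omega>)\<^sup>2)" "(\<integral>\<omega>. (Z j \<omega>)\<^sup>2 \<partial>N) = \<bar>C j j\<bar>"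
proof -
  have [measurable]: "Z j \<in> borel_measurable N" using G assms by (auto simp: centred_gaussian_def)
  show "integrable N (\<lambda>\<omega>. (Z j \<omega>)\<^sup>2)" "(\<integral>\<omega>. (Z j \<omega>)\<^sup>2 \<partial>N) = \<bar>C j j\<bar>"
    using centred_normal_second_moment[of "C j j"]
    by (simp_all add: integrable_distr_eq integral_distr flip: gaussian_coordinate[OF assms])
qed

lemma gaussian_char:
  "char (distr N borel (\<lambda>\<omega>. \<Sum>j\<in>I. a j * Z j \<omega>)) t
    = exp (- (\<bar>\<Sum>i\<in>I. \<Sum>j\<in>I. a i * a j * C i j\<bar> * t\<^sup>2) / 2)"
  using G unfolding centred_gaussian_def by (simp add: char_centred_normal)

lemma gaussian_no_atom:
  assumes "j \<in> I" "C j j \<noteq> 0" shows "measure N {\<omega> \<in> space N. Z j \<omega> = t} = 0"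
proof -
  have "Z j \<in> borel_measurable N" using G assms by (auto simp: centred_gaussian_def)
  then have "measure N {\<omega> \<in> space N. Z j \<omega> = t} = measure (distr N borel (Z j)) {t}"
    by (subst measure_distr) (auto intro: arg_cong[where f="measure N"])
  then show ?thesis by (simp add: gaussian_coordinate assms centred_normal_singleton)
qed

text \<open>The minimum equals \<open>t\<close> only if one of finitely many coordinates hits
  \<open>t - c j\<close>, a null event because that coordinate has nonzero variance.\<close>

lemma gaussian_Min_cdf_cont:
  assumes "I \<noteq> {}" "\<And>j. j \<in> I \<Longrightarrow> C j j \<noteq> 0"
  shows "isCont (cdf (distr N borel (\<lambda>\<omega>. Min ((\<lambda>j. Z j \<omega> + c j) ` I)))) t"
proof -
  interpret N: prob_space N using G by (auto simp: centred_gaussian_def)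
  have Z: "\<And>j. j \<in> I \<Longrightarrow> Z j \<in> borel_measurable N" using G by (auto simp: centred_gaussian_def)
  have [measurable]: "(\<lambda>\<omega>. Min ((\<lambda>j. Z j \<omega> + c j) ` I)) \<in> borel_measurable N"
    using fin Z by measurable
  interpret D: real_distribution "distr N borel (\<lambda>\<omega>. Min ((\<lambda>j. Z j \<omega> + c j) ` I))"
    by (rule N.real_distribution_distr) measurable
  have ev: "{\<omega> \<in> space N. Z j \<omega> = s} \<in> sets N" if "j \<in> I" for j s
    using Z[OF that] by measurable
  have "measure N {\<omega> \<in> space N. Min ((\<lambda>j. Z j \<omega> + c j) ` I) = t}
      \<le> measure N (\<Union>j\<in>I. {\<omega> \<in> space N. Z j \<omega> = t - c j})"
  proof (rule N.finite_measure_mono)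
    show "{\<omega> \<in> space N. Min ((\<lambda>j. Z j \<omega> + c j) ` I) = t} \<subseteq> (\<Union>j\<in>I. {\<omega> \<in> space N. Z j \<omega> = t - c j})"
    proof
      fix \<omega> assume *: "\<omega> \<in> {\<omega> \<in> space N. Min ((\<lambda>j. Z j \<omega> + c j) ` I) = t}"
      then have "t \<in> (\<lambda>j. Z j \<omega> + c j) ` I"
        using Min_in[of "(\<lambda>j. Z j \<omega> + c j) ` I"] fin assms by auto
      then obtain j where "j \<in> I" "Z j \<omega> = t - c j" by auto
      then show "\<omega> \<in> (\<Union>j\<in>I. {\<omega> \<in> space N. Z j \<omega> = t - c j})" using * by blast
    qed
    show "(\<Union>j\<in>I. {\<omega> \<in> space N. Z j \<omega> = t - c j}) \<in> N.events"
      using fin ev by (intro sets.finite_UN) auto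
  qed
  also have "\<dots> \<le> (\<Sum>j\<in>I. measure N {\<omega> \<in> space N. Z j \<omega> = t - c j})"
    using fin ev by (intro N.finite_measure_subadditive_finite) auto
  also have "\<dots> = 0" using assms by (simp add: gaussian_no_atom)
  finally have "measure (distr N borel (\<lambda>\<omega>. Min ((\<lambda>j. Z j \<omega> + c j) ` I))) {t} = 0"
    by (subst measure_distr) (auto simp: vimage_def Int_def conj_commute measure_le_0_iff)
  then show ?thesis by (simp add: D.isCont_cdf)
qed

end

text \<open>Gaussian characteristic functions are continuous in the covariance, and a convergent
  covariance sequence is bounded, which supplies the moment bound. For a constant sequence the lemma
  says that the covariance determines the law of the minimum.\<close>

lemma gaussian_seq_weak_conv_Min:
  fixes Y :: "nat \<Rightarrow> 'i::countable \<Rightarrow> 'a \<Rightarrow> real"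
  assumes J: "finite J" "J \<noteq> {}"
    and Y: "\<And>n. centred_gaussian (M n) J (Y n) (D n)" and Z: "centred_gaussian N J Z C"
    and DC: "\<And>i j. i \<in> J \<Longrightarrow> j \<in> J \<Longrightarrow> (\<lambda>n. D n i j) \<longlonglongrightarrow> C i j"
  shows "weak_conv_m (\<lambda>n. distr (M n) borel (\<lambda>\<omega>. Min ((\<lambda>j. Y n j \<omega> + c j) ` J)))
    (distr N borel (\<lambda>\<omega>. Min ((\<lambda>j. Z j \<omega> + c j) ` J)))"
proof -
  have "\<exists>B. \<forall>n. \<bar>D n j j\<bar> \<le> B" if "j \<in> J" for j
    using convergent_imp_Bseq[OF convergentI[OF DC[OF that that]]] by (auto simp: Bseq_def)
  then obtain B where B: "\<And>j n. j \<in> J \<Longrightarrow> \<bar>D n j j\<bar> \<le> B j" by metis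
  define K where "K = (\<Sum>j\<in>J. \<bar>B j\<bar> + \<bar>C j j\<bar>)"
  have K: "\<bar>B j\<bar> + \<bar>C j j\<bar> \<le> K" if "j \<in> J" for j
    unfolding K_def using that J by (intro member_le_sum) auto
  show ?thesis
  proof (rule weak_conv_Min[OF J])
    fix i n assume i: "i \<in> J"
    show "integrable (M n) (\<lambda>\<omega>. (Y n i \<omega>)\<^sup>2)" "integrable N (\<lambda>\<omega>. (Z i \<omega>)\<^sup>2)"
      using gaussian_second_moment(1)[OF Y J(1) i] gaussian_second_moment(1)[OF Z J(1) i] by auto
    show "(\<integral>\<omega>. (Y n i \<omega>)\<^sup>2 \<partial>M n) \<le> K" "(\<integral>\<omega>. (Z i \<omega>)\<^sup>2 \<partial>N) \<le> K"
      using gaussian_second_moment(2)[OF Y J(1) i] gaussian_second_moment(2)[OF Z J(1) i]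
        B[OF i, of n] K[OF i] by auto
  next
    fix a
    show "(\<lambda>n. char (distr (M n) borel (\<lambda>\<omega>. \<Sum>i\<in>J. a i * Y n i \<omega>)) 1)
        \<longlonglongrightarrow> char (distr N borel (\<lambda>\<omega>. \<Sum>i\<in>J. a i * Z i \<omega>)) 1"
      unfolding gaussian_char[OF Y J(1)] gaussian_char[OF Z J(1)]
      by (intro tendsto_intros DC) simp_all
  qed (use Y Z in \<open>auto simp: centred_gaussian_def\<close>)
qed


section \<open>Interval probabilities and an explicit Gaussian vector\<close>

lemma std_normal_interval_pos:
  assumes "a < b" shows "measure std_normal_distribution {a<..<b} > 0"
proof -
  interpret S: real_distribution std_normal_distribution by (rule real_dist_normal_dist)
  have pos: "\<not> std_normal_density x \<le> 0" for x
    using normal_density_pos[of 1 0 x] by simp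
  have "emeasure std_normal_distribution {a<..<b} \<noteq> 0"
  proof
    assume "emeasure std_normal_distribution {a<..<b} = 0"
    then have "{a<..<b} \<in> null_sets std_normal_distribution" by (intro null_setsI) auto
    then have "AE x in lborel. x \<in> {a<..<b} \<longrightarrow> ennreal (std_normal_density x) = 0"
      by (simp add: null_sets_density_iff)
    then have "AE x in lborel. x \<notin> {a<..<b}"
      by (rule eventually_mono) (use pos in \<open>auto simp: ennreal_eq_0_iff\<close>)
    then have "{a<..<b} \<in> null_sets lborel"
      by (subst AE_iff_null_sets) auto
    then have "emeasure lborel {a<..<b} = 0" by (rule null_setsD1)
    then show False using assms by simp
  qed
  then show ?thesis by (simp add: S.emeasure_eq_measure zero_less_measure_iff)
qed

text \<open>Independence factorises the characteristic function of a linear form, and Levy's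
  uniqueness theorem then identifies its law. Any covariance that factors as a matrix times its
  transpose is realised this way.\<close>

lemma explicit_gaussian:
  fixes B :: "'i \<Rightarrow> 'x \<Rightarrow> real"
  assumes "finite A" "finite I"
  shows "centred_gaussian (PiM A (\<lambda>_. std_normal_distribution)) I
    (\<lambda>j \<eta>. \<Sum>x\<in>A. B j x * \<eta> x) (\<lambda>i j. \<Sum>x\<in>A. B i x * B j x)"
proof -
  interpret S: real_distribution std_normal_distribution by (rule real_dist_normal_dist)
  interpret P: product_prob_space "\<lambda>_::'x. std_normal_distribution" A ..
  let ?Q = "PiM A (\<lambda>_. std_normal_distribution)"
  interpret Q: prob_space ?Q by (intro prob_space_PiM S.prob_space_axioms)
  have coord [measurable]: "(\<lambda>\<eta>. \<eta> x) \<in> borel_measurable ?Q" if "x \<in> A" for x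
    using measurable_component_singleton[OF that, of "\<lambda>_. std_normal_distribution"] by simp
  show ?thesis
    unfolding centred_gaussian_def
  proof (intro conjI allI ballI)
    show "prob_space ?Q" by (intro prob_space_PiM S.prob_space_axioms)
    show "(\<lambda>\<eta>. \<Sum>x\<in>A. B j x * \<eta> x) \<in> borel_measurable ?Q" for j by measurable
    fix a :: "'i \<Rightarrow> real"
    define b where "b x = (\<Sum>j\<in>I. a j * B j x)" for x
    have lin: "(\<Sum>j\<in>I. a j * (\<Sum>x\<in>A. B j x * \<eta> x)) = (\<Sum>x\<in>A. b x * \<eta> x)" for \<eta>
      unfolding b_def sum_distrib_left sum_distrib_right by (subst sum.swap) (simp add: mult_ac)
    have "(\<Sum>i\<in>I. \<Sum>j\<in>I. a i * a j * (\<Sum>x\<in>A. B i x * B j x))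
        = (\<Sum>i\<in>I. \<Sum>j\<in>I. \<Sum>x\<in>A. (a i * B i x) * (a j * B j x))"
      by (simp add: sum_distrib_left mult_ac)
    also have "\<dots> = (\<Sum>i\<in>I. \<Sum>x\<in>A. \<Sum>j\<in>I. (a i * B i x) * (a j * B j x))"
      by (intro sum.cong refl sum.swap)
    also have "\<dots> = (\<Sum>x\<in>A. \<Sum>i\<in>I. \<Sum>j\<in>I. (a i * B i x) * (a j * B j x))" by (rule sum.swap)
    also have "\<dots> = (\<Sum>x\<in>A. (b x)\<^sup>2)"
      by (simp add: b_def power2_eq_square sum_product)
    finally have v: "(\<Sum>i\<in>I. \<Sum>j\<in>I. a i * a j * (\<Sum>x\<in>A. B i x * B j x)) = (\<Sum>x\<in>A. (b x)\<^sup>2)" .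
    have "char (distr ?Q borel (\<lambda>\<eta>. \<Sum>x\<in>A. b x * \<eta> x)) t = char (centred_normal (\<Sum>x\<in>A. (b x)\<^sup>2)) t"
      for t
    proof -
      have "char (distr ?Q borel (\<lambda>\<eta>. \<Sum>x\<in>A. b x * \<eta> x)) t
          = (CLINT \<eta>|?Q. iexp (t * (\<Sum>x\<in>A. b x * \<eta> x)))"
        unfolding char_def by (subst integral_distr) auto
      also have "\<dots> = (CLINT \<eta>|?Q. (\<Prod>x\<in>A. iexp ((t * b x) * \<eta> x)))"
        using assms by (simp add: sum_distrib_left mult_ac flip: exp_sum)
      also have "\<dots> = (\<Prod>x\<in>A. char std_normal_distribution (t * b x))"
        unfolding char_def by (rule P.product_integral_prod[OF assms(1)]) (rule S.integrable_iexp, auto)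
      also have "\<dots> = of_real (\<Prod>x\<in>A. exp (- ((t * b x)\<^sup>2) / 2))"
        by (simp add: char_std_normal_distribution)
      also have "(\<Prod>x\<in>A. exp (- ((t * b x)\<^sup>2) / 2)) = exp (- (\<bar>\<Sum>x\<in>A. (b x)\<^sup>2\<bar> * t\<^sup>2) / 2)"
      proof -
        have "(\<Sum>x\<in>A. - ((t * b x)\<^sup>2) / 2) = - ((\<Sum>x\<in>A. (b x)\<^sup>2) * t\<^sup>2) / 2"
          by (simp add: power_mult_distrib mult.commute[of "t\<^sup>2"] sum_negf flip: sum_distrib_right sum_divide_distrib)
        then show ?thesis using assms by (simp add: sum_nonneg flip: exp_sum)
      qed
      finally show ?thesis by (simp only: char_centred_normal)
    qed
    then have "distr ?Q borel (\<lambda>\<eta>. \<Sum>x\<in>A. b x * \<eta> x) = centred_normal (\<Sum>x\<in>A. (b x)\<^sup>2)"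
      by (intro Levy_uniqueness real_distribution_centred_normal
          prob_space.real_distribution_distr prob_space_PiM S.prob_space_axioms) auto
    then show "distr ?Q borel (\<lambda>\<eta>. \<Sum>j\<in>I. a j * (\<Sum>x\<in>A. B j x * \<eta> x)) =
        centred_normal (\<Sum>i\<in>I. \<Sum>j\<in>I. a i * a j * (\<Sum>x\<in>A. B i x * B j x))"
      by (simp only: lin v)
  qed
qed

text \<open>Moving \<open>\<eta>\<close> along \<open>u\<close> shifts the minimum, so its law charges every interval.\<close>

lemma gaussian_Min_cdf_strict:
  fixes Z :: "'i::countable \<Rightarrow> 'b \<Rightarrow> real"
  assumes G: "centred_gaussian N J Z C" and J: "finite J" "J \<noteq> {}" and A: "finite A"
    and C: "\<And>i j. i \<in> J \<Longrightarrow> j \<in> J \<Longrightarrow> C i j = (\<Sum>x\<in>A. B i x * B j x)"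
    and C0: "\<And>j. j \<in> J \<Longrightarrow> C j j \<noteq> 0"
    and u: "\<And>j. j \<in> J \<Longrightarrow> (\<Sum>x\<in>A. B j x * u x) = 1"
    and st: "s < t"
  shows "cdf (distr N borel (\<lambda>\<omega>. Min ((\<lambda>j. Z j \<omega>) ` J))) s < cdf (distr N borel (\<lambda>\<omega>. Min ((\<lambda>j. Z j \<omega>) ` J))) t"
proof -
  interpret S: real_distribution std_normal_distribution by (rule real_dist_normal_dist)
  let ?Q = "PiM A (\<lambda>_. std_normal_distribution)"
  let ?Y = "\<lambda>j \<eta>. \<Sum>x\<in>A. B j x * \<eta> x"
  let ?D = "distr ?Q borel (\<lambda>\<eta>. Min ((\<lambda>j. ?Y j \<eta>) ` J))"
  have Y: "centred_gaussian ?Q J ?Y (\<lambda>i j. \<Sum>x\<in>A. B i x * B j x)"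
    by (rule explicit_gaussian[OF A J(1)])
  then have mY: "?Y j \<in> borel_measurable ?Q" if "j \<in> J" for j
    using that by (auto simp: centred_gaussian_def)
  have mW [measurable]: "(\<lambda>\<eta>. Min ((\<lambda>j. ?Y j \<eta>) ` J)) \<in> borel_measurable ?Q"
    using J mY by measurable
  interpret Q: prob_space ?Q by (intro prob_space_PiM S.prob_space_axioms)
  interpret D: real_distribution ?D by (rule Q.real_distribution_distr[OF mW])
  \<comment> \<open>Weak convergence of a constant sequence: as the limiting distribution function
    is continuous everywhere, the two distribution functions agree at every point.\<close>
  have "weak_conv_m (\<lambda>n::nat. distr ?Q borel (\<lambda>\<eta>. Min ((\<lambda>j. ?Y j \<eta> + 0) ` J)))
      (distr N borel (\<lambda>\<omega>. Min ((\<lambda>j. Z j \<omega> + 0) ` J)))"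
    using C by (intro gaussian_seq_weak_conv_Min[OF J Y G]) auto
  then have eq: "cdf ?D r = cdf (distr N borel (\<lambda>\<omega>. Min ((\<lambda>j. Z j \<omega>) ` J))) r" for r
    using gaussian_Min_cdf_cont[OF G J C0, where c = "\<lambda>_. 0"]
    by (simp add: weak_conv_m_def weak_conv_def LIMSEQ_const_iff)
  define r where "r = (s + t) / 2"
  \<comment> \<open>\<open>K\<close> bounds the absolute row sums of \<open>B\<close>, with 1 added
    to keep it positive, so moving each coordinate by less than \<open>e\<close> changes every
    \<open>?Y j\<close> by at most \<open>(t - s) / 4\<close>.\<close>
  define K where "K = (\<Sum>j\<in>J. \<Sum>x\<in>A. \<bar>B j x\<bar>) + 1"
  define e where "e = (t - s) / (4 * K)"
  have K: "K \<ge> 1" by (simp add: K_def sum_nonneg)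
  have e: "e > 0" using st K by (simp add: e_def)
  \<comment> \<open>At the centre \<open>r * u\<close> of this box all coordinates
    \<open>?Y j\<close> equal \<open>r\<close>, the midpoint of \<open>s\<close> and
    \<open>t\<close>.\<close>
  define E where "E = Pi\<^sub>E A (\<lambda>x. {r * u x - e<..<r * u x + e})"
  have near: "\<bar>?Y j \<eta> - r\<bar> \<le> (t - s) / 4" if "\<eta> \<in> E" "j \<in> J" for \<eta> j
  proof -
    have "?Y j \<eta> - r = (\<Sum>x\<in>A. B j x * (\<eta> x - r * u x))"
      using u[OF that(2)]
      by (simp add: right_diff_distrib sum_subtractf mult.left_commute flip: sum_distrib_left)
    also have "\<bar>\<dots>\<bar> \<le> (\<Sum>x\<in>A. \<bar>B j x\<bar> * e)"
      using that by (intro order_trans[OF sum_abs] sum_mono)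
        (auto simp: abs_mult E_def PiE_iff abs_le_iff intro!: mult_left_mono dest!: bspec)
    also have "\<dots> = (\<Sum>x\<in>A. \<bar>B j x\<bar>) * e" by (simp add: sum_distrib_right)
    also have "\<dots> \<le> K * e"
      unfolding K_def using e J that
      by (intro mult_right_mono order_trans[OF member_le_sum[of j J "\<lambda>j. \<Sum>x\<in>A. \<bar>B j x\<bar>"]])
        (auto simp: sum_nonneg)
    also have "\<dots> = (t - s) / 4" using K by (simp add: e_def)
    finally show ?thesis .
  qed
  have "0 < (\<Prod>x\<in>A. measure std_normal_distribution {r * u x - e<..<r * u x + e})"
    using e by (intro prod_pos std_normal_interval_pos) auto
  also have "\<dots> = measure ?Q E"
  proof -
    interpret P: finite_product_prob_space "\<lambda>_. std_normal_distribution" A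
      by standard (rule A)
    show ?thesis unfolding E_def by (rule P.finite_measure_PiM_emb[symmetric]) auto
  qed
  also have "\<dots> \<le> measure ?Q ((\<lambda>\<eta>. Min ((\<lambda>j. ?Y j \<eta>) ` J)) -` {s<..t} \<inter> space ?Q)"
  proof (rule Q.finite_measure_mono)
    show "E \<subseteq> (\<lambda>\<eta>. Min ((\<lambda>j. ?Y j \<eta>) ` J)) -` {s<..t} \<inter> space ?Q"
    proof
      fix \<eta> assume "\<eta> \<in> E"
      have "Min ((\<lambda>j. ?Y j \<eta>) ` J) \<in> (\<lambda>j. ?Y j \<eta>) ` J" using J by (intro Min_in) auto
      then obtain j where j: "j \<in> J" "Min ((\<lambda>j. ?Y j \<eta>) ` J) = ?Y j \<eta>" by (rule imageE)
      have "\<bar>Min ((\<lambda>j. ?Y j \<eta>) ` J) - r\<bar> \<le> (t - s) / 4"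
        using near[OF \<open>\<eta> \<in> E\<close> j(1)] j(2) by simp
      then have "s < Min ((\<lambda>j. ?Y j \<eta>) ` J)" "Min ((\<lambda>j. ?Y j \<eta>) ` J) \<le> t"
        using st abs_le_D1 abs_le_D2 unfolding r_def by (fastforce simp: field_simps)+
      moreover have "\<eta> \<in> space ?Q"
        using \<open>\<eta> \<in> E\<close> by (auto simp: E_def space_PiM PiE_iff)
      ultimately show "\<eta> \<in> (\<lambda>\<eta>. Min ((\<lambda>j. ?Y j \<eta>) ` J)) -` {s<..t} \<inter> space ?Q"
        by simp
    qed
  qed measurable
  also have "\<dots> = measure ?D {s<..t}" by (subst measure_distr) auto
  also have "\<dots> = cdf ?D t - cdf ?D s" using D.cdf_diff_eq[OF st] by simp
  finally show ?thesis by (simp add: eq)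
qed

section \<open>Quantiles\<close>

lemma (in real_distribution) bdd_below_quantile_set:
  assumes "0 < \<alpha>" shows "bdd_below {t. \<alpha> \<le> cdf M t}"
proof -
  have "eventually (\<lambda>x. cdf M x < \<alpha>) at_bot"
    using cdf_lim_at_bot assms by (auto dest: order_tendstoD)
  then obtain b where b: "\<And>x. x \<le> b \<Longrightarrow> cdf M x < \<alpha>" by (auto simp: eventually_at_bot_linorder)
  show ?thesis
    by (rule bdd_belowI[of _ b]) (use b in \<open>force simp: not_le[symmetric] intro: less_imp_le\<close>)
qed

text \<open>\<open>Inf\<close> is meaningful only for nonempty sets that are bounded below; the
  limits of the distribution function at the two ends provide this for \<open>0 < \<alpha>\<close>
  and \<open>\<alpha> < 1\<close>.\<close>

lemma (in real_distribution) quantile_set_nonempty: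
  assumes "\<alpha> < 1" shows "{t. \<alpha> \<le> cdf M t} \<noteq> {}"
proof -
  have "eventually (\<lambda>x. \<alpha> < cdf M x) at_top"
    using cdf_lim_at_top_prob assms by (auto dest: order_tendstoD)
  then show ?thesis by (auto simp: eventually_at_top_linorder intro: less_imp_le)
qed

lemma (in real_distribution) quantile_le:
  assumes "0 < \<alpha>" "\<alpha> \<le> cdf M t" shows "quantile \<alpha> M \<le> t"
  unfolding quantile_def using assms by (intro cInf_lower bdd_below_quantile_set) auto

lemma (in real_distribution) le_quantile:
  assumes "\<alpha> < 1" "cdf M s < \<alpha>" shows "s \<le> quantile \<alpha> M"
  unfolding quantile_def
proof (rule cInf_greatest[OF quantile_set_nonempty[OF assms(1)]])
  fix t assume "t \<in> {t. \<alpha> \<le> cdf M t}"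
  then have "cdf M s < cdf M t" using assms by simp
  then show "s \<le> t" using cdf_nondecreasing[of t s] by (cases "s \<le> t") auto
qed

lemma (in real_distribution) cdf_less_of_less_quantile:
  assumes "0 < \<alpha>" "s < quantile \<alpha> M" shows "cdf M s < \<alpha>"
  using quantile_le[OF assms(1), of s] assms(2) by force

text \<open>The infimum is attained: every point to the right of the quantile satisfies the
  inequality, which passes to the limit by right continuity.\<close>

lemma (in real_distribution) cdf_quantile_ge:
  assumes "\<alpha> < 1" shows "\<alpha> \<le> cdf M (quantile \<alpha> M)"
proof (rule tendsto_lowerbound)
  show "(cdf M \<longlongrightarrow> cdf M (quantile \<alpha> M)) (at_right (quantile \<alpha> M))"
    using cdf_is_right_cont[of "quantile \<alpha> M"] by (simp add: continuous_within)
  show "\<forall>\<^sub>F s in at_right (quantile \<alpha> M). \<alpha> \<le> cdf M s"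
  proof (rule eventually_at_rightI)
    fix s assume "s \<in> {quantile \<alpha> M<..<quantile \<alpha> M + 1}"
    then show "\<alpha> \<le> cdf M s" using le_quantile[OF assms, of s] by force
  qed simp
qed simp

text \<open>Stability is obtained by contradiction, from weak convergence along a sequence of
  counterexamples.\<close>

lemma gaussian_Min_quantile_lower:
  fixes Z :: "'i::countable \<Rightarrow> 'b \<Rightarrow> real"
  assumes G: "centred_gaussian N J Z C" and J: "finite J" "J \<noteq> {}"
    and C0: "\<And>j. j \<in> J \<Longrightarrow> C j j \<noteq> 0" and \<alpha>: "0 < \<alpha>" "\<alpha> < 1"
    and s: "s < quantile \<alpha> (distr N borel (\<lambda>\<omega>. Min ((\<lambda>j. Z j \<omega>) ` J)))"
  shows "\<exists>d>0. \<forall>(M :: 'a measure) Y D. centred_gaussian M J Y D \<longrightarrow>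
    (\<forall>i\<in>J. \<forall>j\<in>J. \<bar>D i j - C i j\<bar> < d) \<longrightarrow> s \<le> quantile \<alpha> (distr M borel (\<lambda>\<omega>. Min ((\<lambda>j. Y j \<omega>) ` J)))"
proof (rule ccontr)
  let ?W = "\<lambda>N Z. distr N borel (\<lambda>\<omega>. Min ((\<lambda>j. Z j \<omega>) ` J))"
  have rd: "real_distribution (distr M borel (\<lambda>\<omega>. Min ((\<lambda>j. Y j \<omega>) ` J)))"
    if "centred_gaussian M J Y D" for M :: "'c measure" and Y D
  proof (rule prob_space.real_distribution_distr)
    show "prob_space M" using that by (simp add: centred_gaussian_def)
    have "\<And>j. j \<in> J \<Longrightarrow> Y j \<in> borel_measurable M" using that by (simp add: centred_gaussian_def)
    then show "(\<lambda>\<omega>. Min ((\<lambda>j. Y j \<omega>) ` J)) \<in> borel_measurable M" using J by measurable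
  qed
  assume neg: "\<not> ?thesis"
  then have "\<exists>(M :: 'a measure) Y D. centred_gaussian M J Y D \<and>
      (\<forall>i\<in>J. \<forall>j\<in>J. \<bar>D i j - C i j\<bar> < d) \<and> \<not> s \<le> quantile \<alpha> (?W M Y)" if "d > 0" for d
    using neg that by blast
  from this[of "inverse (real (Suc n))" for n] obtain M :: "nat \<Rightarrow> 'a measure" and Y D
    where Y: "\<And>n. centred_gaussian (M n) J (Y n) (D n)"
      and D: "\<And>n i j. i \<in> J \<Longrightarrow> j \<in> J \<Longrightarrow> \<bar>D n i j - C i j\<bar> < inverse (real (Suc n))"
      and q: "\<And>n. \<not> s \<le> quantile \<alpha> (?W (M n) (Y n))"
    by (auto simp del: of_nat_Suc) metis
  have "(\<lambda>n. D n i j) \<longlonglongrightarrow> C i j" if "i \<in> J" "j \<in> J" for i j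
  proof (rule LIM_zero_cancel, rule Lim_null_comparison)
    show "(\<lambda>n. inverse (real (Suc n))) \<longlonglongrightarrow> 0" by (rule LIMSEQ_inverse_real_of_nat)
    show "\<forall>\<^sub>F n in sequentially. norm (D n i j - C i j) \<le> inverse (real (Suc n))"
      using D[OF that] by (auto intro!: always_eventually less_imp_le)
  qed
  then have "weak_conv_m (\<lambda>n. distr (M n) borel (\<lambda>\<omega>. Min ((\<lambda>j. Y n j \<omega> + 0) ` J)))
      (distr N borel (\<lambda>\<omega>. Min ((\<lambda>j. Z j \<omega> + 0) ` J)))"
    by (rule gaussian_seq_weak_conv_Min[OF J Y G])
  then have "(\<lambda>n. cdf (?W (M n) (Y n)) s) \<longlonglongrightarrow> cdf (?W N Z) s"
    using gaussian_Min_cdf_cont[OF G J C0, where c = "\<lambda>_. 0"] by (simp add: weak_conv_m_def weak_conv_def)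
  \<comment> \<open>\<open>s\<close> lies below the limiting quantile, so the limit of the
    distribution functions at \<open>s\<close> is strictly below \<open>\<alpha>\<close>; eventually
    the sequence is too, and its quantiles cannot be smaller than \<open>s\<close>.\<close>
  moreover have "cdf (?W N Z) s < \<alpha>"
    by (rule real_distribution.cdf_less_of_less_quantile[OF rd[OF G] \<alpha>(1) s])
  ultimately have "\<forall>\<^sub>F n in sequentially. cdf (?W (M n) (Y n)) s < \<alpha>"
    by (rule order_tendstoD)
  then obtain n where "cdf (?W (M n) (Y n)) s < \<alpha>" by (auto simp: eventually_sequentially)
  then show False
    using real_distribution.le_quantile[OF rd[OF Y] \<alpha>(2), of n s] q[of n] by simp
qed

section \<open>Tails and quantiles of the standard normal law\<close>

lemma std_normal_tail_lower:
  assumes "0 \<le> x" shows "std_normal_density (x + 1) \<le> 1 - cdf std_normal_distribution x"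
proof -
  interpret S: real_distribution std_normal_distribution by (rule real_dist_normal_dist)
  have "ennreal (std_normal_density (x + 1)) = (\<integral>\<^sup>+y. ennreal (std_normal_density (x + 1)) * indicator {x<..x + 1} y \<partial>lborel)"
    by (simp add: nn_integral_cmult_indicator)
  \<comment> \<open>The density decreases on the nonnegative axis, so its value at the right end
    bounds it from below on \<open>{x<..x + 1}\<close>. The shift by 1 leaves the leading exponent
    of the tail unchanged.\<close>
  also have "\<dots> \<le> (\<integral>\<^sup>+y. ennreal (std_normal_density y) * indicator {x<..x + 1} y \<partial>lborel)"
    using assms by (intro nn_integral_mono)
      (auto simp: indicator_def std_normal_density_def intro!: ennreal_leI divide_right_mono power_mono)
  also have "\<dots> = emeasure std_normal_distribution {x<..x + 1}"
    by (subst emeasure_density) auto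
  finally have "std_normal_density (x + 1) \<le> measure std_normal_distribution {x<..x + 1}"
    by (simp add: S.emeasure_eq_measure)
  also have "\<dots> = cdf std_normal_distribution (x + 1) - cdf std_normal_distribution x"
    by (rule S.cdf_diff_eq[symmetric]) simp
  also have "\<dots> \<le> 1 - cdf std_normal_distribution x"
    using S.cdf_bounded_prob by simp
  finally show ?thesis .
qed

text \<open>Markov's inequality with the fourth moment, which is 3. The second moment would only
  bound the quantile by \<open>sqrt n\<close>; the fourth gives order \<open>n powr (1 / 4)\<close>,
  negligible against the growth \<open>sqrt n\<close> of the statistic at a knot.\<close>

lemma std_normal_tail_upper:
  assumes "0 < x" shows "1 - cdf std_normal_distribution x \<le> 3 / x ^ 4"
proof -
  interpret S: real_distribution std_normal_distribution by (rule real_dist_normal_dist)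
  have int4: "integrable std_normal_distribution (\<lambda>y. y ^ 4)"
    by (rule integrable_std_normal_distribution_moment)
  have "1 - cdf std_normal_distribution x = measure std_normal_distribution (UNIV - {..x})"
    using S.prob_compl[of "{..x}"] by (simp add: cdf_def)
  also have "\<dots> = S.expectation (indicator (UNIV - {..x}))" by simp
  also have "\<dots> \<le> S.expectation (\<lambda>y. y ^ 4 / x ^ 4)"
  proof (rule integral_mono)
    fix y
    have "1 \<le> y ^ 4 / x ^ 4" if "x < y" using that assms by (simp add: power_mono)
    then show "(indicator (UNIV - {..x}) y :: real) \<le> y ^ 4 / x ^ 4" by (auto simp: indicator_def)
  qed (use int4 in \<open>auto intro!: S.integrable_const_bound[where B=1]\<close>)
  also have "\<dots> = 3 / x ^ 4"
    using std_normal_distribution_even_moments(1)[of 2] by (simp add: fact_numeral)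
  finally show ?thesis .
qed

text \<open>The quantile is asymptotic to \<open>sqrt (2 * ln n)\<close>; the crude tail bound can
  reach any constant below 2, and 3/2 suffices for the exponents of
  \<open>upper_tail\<close>.\<close>

lemma std_normal_quantile_lower:
  "\<forall>\<^sub>F n::nat in sequentially. sqrt (3 / 2 * ln n) \<le> quantile (1 - 1 / real n) std_normal_distribution"
proof -
  have "\<forall>\<^sub>F n::nat in sequentially. 1 / real n < 1 / sqrt (2 * pi) * exp (- (13 / 16 * ln n + 13 / 2))"
    by real_asymp
  then show ?thesis
    using eventually_gt_at_top[of 0]
  proof eventually_elim
    case (elim n)
    define x where "x = sqrt (3 / 2 * ln n)"
    have "0 \<le> ln (real n)" using elim by simp
    then have x: "0 \<le> x" "x\<^sup>2 = 3 / 2 * ln n" by (simp_all add: x_def)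
    \<comment> \<open>From \<open>(x - 12)\<^sup>2 \<ge> 0\<close>, i.e.
      \<open>2 * x \<le> x\<^sup>2 / 12 + 12\<close>: the cross term costs only a factor 13/12 on
      \<open>x\<^sup>2\<close>, and 13/12 times 3/4 is 13/16, still below 1.\<close>
    have "(x + 1)\<^sup>2 / 2 \<le> 13 / 16 * ln n + 13 / 2"
      using zero_le_power2[of "x - 12"] x(2) by (simp add: power2_eq_square algebra_simps)
    then have "1 / sqrt (2 * pi) * exp (- (13 / 16 * ln n + 13 / 2)) \<le> std_normal_density (x + 1)"
      unfolding std_normal_density_def by (intro mult_left_mono) auto
    then have "cdf std_normal_distribution x < 1 - 1 / real n"
      using std_normal_tail_lower[OF x(1)] elim by linarith
    then show ?case
      unfolding x_def[symmetric]
      using elim by (intro real_distribution.le_quantile real_dist_normal_dist) auto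
  qed
qed

lemma std_normal_quantile_upper:
  "\<forall>\<^sub>F n::nat in sequentially. quantile (1 - 1 / real n) std_normal_distribution \<le> (3 * n) powr (1 / 4)"
  using eventually_gt_at_top[of 1]
proof eventually_elim
  case (elim n)
  have "((3 * n) powr (1 / 4)) ^ 4 = 3 * real n"
    using elim by (simp add: powr_power)
  then have "1 - 1 / real n \<le> cdf std_normal_distribution ((3 * n) powr (1 / 4))"
    using std_normal_tail_upper[of "(3 * n) powr (1 / 4)"] elim by simp
  then show ?case
    using elim by (intro real_distribution.quantile_le real_dist_normal_dist) auto
qed

section \<open>Rows of independent samples\<close>

definition sample_mean :: "nat \<Rightarrow> (int \<Rightarrow> real) \<Rightarrow> (nat \<Rightarrow> int) \<Rightarrow> real" where
  "sample_mean n f x = (\<Sum>l\<in>{1..n}. f (x l)) / real n"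

abbreviation mean :: "int pmf \<Rightarrow> (int \<Rightarrow> real) \<Rightarrow> real" where
  "mean p f \<equiv> measure_pmf.expectation p f"

lemma integrable_pmf_bounded:
  assumes "\<And>x. \<bar>f x\<bar> \<le> B" shows "integrable (measure_pmf p) (f :: _ \<Rightarrow> real)"
  using assms by (intro measure_pmf.integrable_const_bound[where B=B]) auto

lemma abs_mean_le:
  assumes "\<And>x. \<bar>f x\<bar> \<le> B" shows "\<bar>mean p f\<bar> \<le> B"
proof -
  have "\<bar>mean p f\<bar> \<le> mean p (\<lambda>x. \<bar>f x\<bar>)" by (rule integral_abs_bound)
  also have "\<dots> \<le> mean p (\<lambda>_. B)"
    using assms integrable_pmf_bounded[of f B p] by (intro integral_mono) auto
  finally show ?thesis by simp
qed

lemma power2_le_of_abs_le: "\<bar>y :: real\<bar> \<le> B \<Longrightarrow> y\<^sup>2 \<le> B\<^sup>2"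
  by (metis abs_ge_zero power2_abs power_mono)

lemma abs_centred_le:
  assumes "\<And>x. \<bar>f x\<bar> \<le> B" "0 \<le> s" shows "\<bar>(f x - mean p f) / s\<bar> \<le> 2 * B / s"
proof -
  have "\<bar>f x - mean p f\<bar> \<le> 2 * B"
    using assms(1)[of x] abs_mean_le[of f B p, OF assms(1)] by linarith
  then show ?thesis using assms(2) by (auto simp: abs_divide intro: divide_right_mono)
qed

text \<open>Cross terms vanish, as each new summand is centred and independent of the partial sum. A
  bound through \<open>B\<close> instead of the variances is enough for tightness.\<close>

lemma (in prob_space) second_moment_sum_indep:
  fixes Y :: "'b \<Rightarrow> 'a \<Rightarrow> real" and B :: real
  assumes "finite A" "indep_vars (\<lambda>_. borel) Y A"
    and "\<And>i \<omega>. i \<in> A \<Longrightarrow> \<bar>Y i \<omega>\<bar> \<le> B" and "\<And>i. i \<in> A \<Longrightarrow> expectation (Y i) = 0"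
  shows "integrable M (\<lambda>\<omega>. (\<Sum>i\<in>A. Y i \<omega>)\<^sup>2) \<and> expectation (\<lambda>\<omega>. (\<Sum>i\<in>A. Y i \<omega>)\<^sup>2) \<le> card A * B\<^sup>2"
  using assms
proof (induction A rule: finite_induct)
  case (insert a A)
  let ?S = "\<lambda>\<omega>. \<Sum>i\<in>A. Y i \<omega>"
  have ind: "indep_vars (\<lambda>_. borel) Y A"
    using insert.prems(1) by (rule indep_vars_subset) auto
  have IH: "integrable M (\<lambda>\<omega>. (?S \<omega>)\<^sup>2)" "expectation (\<lambda>\<omega>. (?S \<omega>)\<^sup>2) \<le> card A * B\<^sup>2"
    using insert.IH[OF ind] insert.prems by auto
  have m: "Y i \<in> borel_measurable M" if "i \<in> insert a A" for i
    using insert.prems(1) that by (auto simp: indep_vars_def2)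
  then have mS: "?S \<in> borel_measurable M" by (intro borel_measurable_sum) auto
  have intY: "integrable M (Y a)"
    using m insert.prems(2) by (intro integrable_const_bound[where B=B]) auto
  have Y2: "(Y a \<omega>)\<^sup>2 \<le> B\<^sup>2" for \<omega>
    using insert.prems(2)[of a \<omega>] by (simp add: power2_le_of_abs_le)
  then have intY2: "integrable M (\<lambda>\<omega>. (Y a \<omega>)\<^sup>2)"
    using m by (intro integrable_const_bound[where B="B\<^sup>2"]) auto
  have "expectation (\<lambda>\<omega>. (Y a \<omega>)\<^sup>2) \<le> expectation (\<lambda>_. B\<^sup>2)"
    using intY2 Y2 by (intro integral_mono) auto
  then have EY2: "expectation (\<lambda>\<omega>. (Y a \<omega>)\<^sup>2) \<le> B\<^sup>2" by (simp add: prob_space)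
  have intS: "integrable M ?S"
    by (rule square_integrable_imp_integrable[OF mS IH(1)])
  have iv: "indep_var borel (Y a) borel ?S"
    by (rule indep_vars_sum) (use insert in auto)
  have prod: "integrable M (\<lambda>\<omega>. Y a \<omega> * ?S \<omega>)" "expectation (\<lambda>\<omega>. Y a \<omega> * ?S \<omega>) = 0"
    using indep_var_integrable[OF iv intY intS] indep_var_lebesgue_integral[OF iv intY intS]
      insert.prems(3) by simp_all
  have eq: "(\<lambda>\<omega>. (\<Sum>i\<in>insert a A. Y i \<omega>)\<^sup>2) = (\<lambda>\<omega>. (Y a \<omega>)\<^sup>2 + 2 * (Y a \<omega> * ?S \<omega>) + (?S \<omega>)\<^sup>2)"
    using insert.hyps by (simp add: power2_sum fun_eq_iff)
  show ?case
    unfolding eq using intY2 prod IH EY2 insert.hyps by (auto simp: algebra_simps)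
qed simp

section \<open>Scaled deviations of sample means: moments, characteristic functions,
  concentration\<close>

locale sample_array = prob_space \<Omega> for \<Omega> :: "'a measure" +
  fixes X :: "nat \<Rightarrow> nat \<Rightarrow> 'a \<Rightarrow> int" and P :: "nat \<Rightarrow> int pmf"
  assumes iid: "iid_rows \<Omega> X P"
begin

lemma X_meas: "i \<in> {1..n} \<Longrightarrow> X n i \<in> measurable \<Omega> (count_space UNIV)"
  using iid unfolding iid_rows_def indep_vars_def2 by auto

lemma fX_meas: "i \<in> {1..n} \<Longrightarrow> (\<lambda>\<omega>. f (X n i \<omega>) :: real) \<in> borel_measurable \<Omega>"
  using measurable_compose[OF X_meas, of i n f borel] by simp

lemma indep_fX: "indep_vars (\<lambda>_. borel) (\<lambda>i \<omega>. f (X n i \<omega>) :: real) {1..n}"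
  using iid unfolding iid_rows_def
  by (intro indep_vars_compose2[where X="X n" and M'="\<lambda>_. count_space UNIV" and Y="\<lambda>_. f"]) auto

lemma distr_fX:
  assumes "i \<in> {1..n}"
  shows "distr \<Omega> borel (\<lambda>\<omega>. f (X n i \<omega>) :: real) = distr (measure_pmf (P n)) borel f"
proof -
  have "distr (measure_pmf (P n)) borel f = distr (distr \<Omega> (count_space UNIV) (X n i)) borel f"
    using iid assms by (simp add: iid_rows_def)
  also have "\<dots> = distr \<Omega> borel (f \<circ> X n i)"
    using X_meas[OF assms] by (intro distr_distr) auto
  finally show ?thesis by (simp add: comp_def)
qed

lemma expectation_fX:
  assumes "i \<in> {1..n}"
  shows "expectation (\<lambda>\<omega>. f (X n i \<omega>)) = mean (P n) f"
proof -
  have "expectation (\<lambda>\<omega>. f (X n i \<omega>)) = (\<integral>y. y \<partial>distr \<Omega> borel (\<lambda>\<omega>. f (X n i \<omega>)))"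
    using fX_meas[OF assms] by (subst integral_distr) auto
  also have "\<dots> = mean (P n) f"
    unfolding distr_fX[OF assms] by (subst integral_distr) auto
  finally show ?thesis .
qed

definition dev :: "nat \<Rightarrow> (int \<Rightarrow> real) \<Rightarrow> 'a \<Rightarrow> real" where
  "dev n f \<omega> = sqrt (real n) * (sample_mean n f (\<lambda>i. X n i \<omega>) - mean (P n) f)"

lemma sample_mean_meas: "(\<lambda>\<omega>. sample_mean n f (\<lambda>i. X n i \<omega>)) \<in> borel_measurable \<Omega>"
  unfolding sample_mean_def by (intro borel_measurable_divide borel_measurable_sum fX_meas) auto

lemma dev_meas: "dev n f \<in> borel_measurable \<Omega>"
  unfolding dev_def[abs_def] using sample_mean_meas by measurable

lemma dev_eq_sum: "dev n f \<omega> = (\<Sum>i\<in>{1..n}. (f (X n i \<omega>) - mean (P n) f) / sqrt (real n))"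
proof (cases "n = 0")
  case False
  define s where "s = sqrt (real n)"
  have s: "s > 0" "real n = s * s" using False by (simp_all add: s_def)
  have "dev n f \<omega> = (\<Sum>i\<in>{1..n}. f (X n i \<omega>)) / s - s * mean (P n) f"
    unfolding dev_def sample_mean_def s_def[symmetric] s(2) using s(1) by (simp add: field_simps)
  also have "\<dots> = (\<Sum>i\<in>{1..n}. f (X n i \<omega>)) / s - real (card {1..n}) * (mean (P n) f / s)"
    using s by simp
  also have "\<dots> = (\<Sum>i\<in>{1..n}. (f (X n i \<omega>) - mean (P n) f) / s)"
    by (simp only: diff_divide_distrib sum_subtractf sum_divide_distrib sum_constant)
  finally show ?thesis by (simp only: s_def)
qed (simp add: dev_def)

text \<open>Each of the \<open>n\<close> centred summands is at most \<open>2 * B / sqrt n\<close>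
  in absolute value, so the bound does not depend on \<open>n\<close> and gives tightness.\<close>

lemma dev_second_moment:
  assumes B: "\<And>x. \<bar>f x\<bar> \<le> B"
  shows "integrable \<Omega> (\<lambda>\<omega>. (dev n f \<omega>)\<^sup>2)" "expectation (\<lambda>\<omega>. (dev n f \<omega>)\<^sup>2) \<le> (2 * B)\<^sup>2"
proof -
  let ?g = "\<lambda>x. (f x - mean (P n) f) / sqrt (real n)"
  have bd: "\<bar>?g x\<bar> \<le> 2 * B / sqrt (real n)" for x
    by (rule abs_centred_le) (use B in auto)
  have Eg: "expectation (\<lambda>\<omega>. ?g (X n i \<omega>)) = 0" if "i \<in> {1..n}" for i
    unfolding expectation_fX[OF that, of ?g] using integrable_pmf_bounded[of f B "P n"] B by simp
  have *: "integrable \<Omega> (\<lambda>\<omega>. (\<Sum>i\<in>{1..n}. ?g (X n i \<omega>))\<^sup>2) \<and>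
      expectation (\<lambda>\<omega>. (\<Sum>i\<in>{1..n}. ?g (X n i \<omega>))\<^sup>2) \<le> card {1..n} * (2 * B / sqrt (real n))\<^sup>2"
    by (rule second_moment_sum_indep[where Y="\<lambda>i \<omega>. ?g (X n i \<omega>)", OF _ indep_fX bd Eg]) auto
  have "card {1..n} * (2 * B / sqrt (real n))\<^sup>2 \<le> (2 * B)\<^sup>2"
    by (cases "n = 0") (auto simp: power_divide)
  with * show "integrable \<Omega> (\<lambda>\<omega>. (dev n f \<omega>)\<^sup>2)" "expectation (\<lambda>\<omega>. (dev n f \<omega>)\<^sup>2) \<le> (2 * B)\<^sup>2"
    unfolding dev_eq_sum by auto
qed

text \<open>The law \<open>P n\<close> changes with \<open>n\<close>, so a limit theorem for a
  single i.i.d. sequence does not apply; the Taylor error is made explicit instead. It is of order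
  \<open>n powr (-3/2)\<close> per summand and therefore still vanishes after multiplication by
  \<open>n\<close>.\<close>

lemma dev_char_approx:
  assumes B: "\<And>x. \<bar>f x\<bar> \<le> B" and n: "n \<ge> 1"
  defines "v \<equiv> mean (P n) (\<lambda>x. (f x)\<^sup>2) - (mean (P n) f)\<^sup>2"
  obtains \<phi> :: complex where "char (distr \<Omega> borel (dev n f)) 1 = \<phi> ^ n" "cmod \<phi> \<le> 1"
    "cmod (\<phi> - (1 - v / n / 2)) \<le> (2 * B / sqrt n) ^ 3 / 6"
proof
  let ?\<mu> = "mean (P n) f"
  let ?g = "\<lambda>x. (f x - ?\<mu>) / sqrt (real n)"
  have if': "integrable (P n) f" by (rule integrable_pmf_bounded) (rule B)
  have if2: "integrable (P n) (\<lambda>x. (f x)\<^sup>2)"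
    using B by (intro integrable_pmf_bounded[of _ "B\<^sup>2"]) (simp add: power2_le_of_abs_le)
  have bd: "\<bar>?g x\<bar> \<le> 2 * B / sqrt (real n)" for x
    by (rule abs_centred_le) (use B in auto)
  have ig: "integrable (P n) ?g" by (rule integrable_pmf_bounded[OF bd])
  have ig2: "integrable (P n) (\<lambda>x. (?g x)\<^sup>2)"
    by (rule integrable_pmf_bounded[of _ "(2 * B / sqrt n)\<^sup>2"])
      (simp only: abs_power2 power2_le_of_abs_le[OF bd])
  have Eg: "mean (P n) ?g = 0" using if' by simp
  have "mean (P n) (\<lambda>x. (?g x)\<^sup>2) = mean (P n) (\<lambda>x. (f x - ?\<mu>)\<^sup>2) / n"
    using n by (simp add: power_divide)
  also have "mean (P n) (\<lambda>x. (f x - ?\<mu>)\<^sup>2) = v"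
    unfolding v_def by (rule measure_pmf.variance_eq[OF if' if2])
  finally have Vg: "measure_pmf.variance (P n) ?g = v / n" by (simp only: Eg diff_zero)
  define \<phi> where "\<phi> = char (distr (P n) borel ?g) 1"
  have "char (distr \<Omega> borel (dev n f)) 1 = (\<Prod>i\<in>{1..n}. char (distr \<Omega> borel (\<lambda>\<omega>. ?g (X n i \<omega>))) 1)"
    unfolding dev_eq_sum[abs_def] by (rule char_distr_sum[OF indep_fX])
  also have "\<dots> = (\<Prod>i\<in>{1..n}. \<phi>)"
    unfolding \<phi>_def by (intro prod.cong refl) (simp only: distr_fX[of _ n ?g])
  finally show "char (distr \<Omega> borel (dev n f)) 1 = \<phi> ^ n" by simp
  show "cmod \<phi> \<le> 1"
    unfolding \<phi>_def
    by (intro real_distribution.cmod_char_le_1 prob_space.real_distribution_distr prob_space_measure_pmf) auto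
  have "cmod (\<phi> - (1 - 1\<^sup>2 * (v / n) / 2)) \<le> (1\<^sup>2 / 6) * mean (P n) (\<lambda>x. min (6 * (?g x)\<^sup>2) (\<bar>1\<bar> * \<bar>?g x\<bar> ^ 3))"
    unfolding \<phi>_def
    using prob_space.char_approx3'[OF prob_space_measure_pmf _ ig ig2 Eg Vg refl, of 1] by simp
  also have "mean (P n) (\<lambda>x. min (6 * (?g x)\<^sup>2) (\<bar>1\<bar> * \<bar>?g x\<bar> ^ 3)) \<le> mean (P n) (\<lambda>_. (2 * B / sqrt n) ^ 3)"
  proof (rule integral_mono)
    have b3: "\<bar>?g x\<bar> ^ 3 \<le> (2 * B / sqrt n) ^ 3" for x using bd by (intro power_mono) auto
    show *: "min (6 * (?g x)\<^sup>2) (\<bar>1\<bar> * \<bar>?g x\<bar> ^ 3) \<le> (2 * B / sqrt n) ^ 3" for x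
      using b3[of x] by (auto simp: min_le_iff_disj)
    have "0 \<le> min (6 * (?g x)\<^sup>2) (\<bar>1\<bar> * \<bar>?g x\<bar> ^ 3)" for x by simp
    with * show "integrable (P n) (\<lambda>x. min (6 * (?g x)\<^sup>2) (\<bar>1\<bar> * \<bar>?g x\<bar> ^ 3))"
      by (intro integrable_pmf_bounded[of _ "(2 * B / sqrt n) ^ 3"]) (simp only: abs_of_nonneg)
  qed simp
  finally show "cmod (\<phi> - (1 - v / n / 2)) \<le> (2 * B / sqrt n) ^ 3 / 6" by simp
qed

text \<open>Hoeffding's inequality on \<open>{- B - 1..B + 1}\<close>: the interval is widened by 1
  at both ends so that it is nondegenerate even if \<open>B = 0\<close>.\<close>

lemma hoeffding_mean:
  assumes B: "\<And>x. \<bar>f x\<bar> \<le> B" and n: "n \<ge> 1" and e: "e \<ge> 0"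
  shows "prob {\<omega> \<in> space \<Omega>. \<bar>sample_mean n f (\<lambda>i. X n i \<omega>) - mean (P n) f\<bar> \<ge> e}
    \<le> 2 * exp (- 2 * real n * e\<^sup>2 / (2 * B + 2)\<^sup>2)"
proof -
  have "0 \<le> B" using B[of 0] by linarith
  then have eqs: "B + 1 - (- B - 1) = 2 * B + 2" "real (card {1..n}) = real n"
    "expectation (\<lambda>\<omega>. f (X n 1 \<omega>)) = mean (P n) f" and ne: "- B - 1 < B + 1" "{1..n} \<noteq> {}"
    using n by (auto intro!: expectation_fX)
  interpret H: Hoeffding_ineq_iid \<Omega> "{1..n}" "\<lambda>i \<omega>. f (X n i \<omega>)" "\<lambda>\<omega>. f (X n 1 \<omega>)" "- B - 1" "B + 1"
    "expectation (\<lambda>\<omega>. f (X n 1 \<omega>))"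
  proof unfold_locales
    show "indep_vars (\<lambda>_. borel) (\<lambda>i \<omega>. f (X n i \<omega>)) {1..n}" by (rule indep_fX)
    show "distr \<Omega> borel (\<lambda>\<omega>. f (X n i \<omega>)) = distr \<Omega> borel (\<lambda>\<omega>. f (X n 1 \<omega>))" if "i \<in> {1..n}" for i
      using distr_fX[OF that] distr_fX[of 1 n] n by simp
    show "random_variable borel (\<lambda>\<omega>. f (X n 1 \<omega>))" using fX_meas[of 1 n] n by simp
    show "AE \<omega> in \<Omega>. f (X n 1 \<omega>) \<in> {- B - 1..B + 1}"
    proof (rule AE_I2)
      fix \<omega> show "f (X n 1 \<omega>) \<in> {- B - 1..B + 1}" using B[of "X n 1 \<omega>"] by auto
    qed
  qed simp_all
  show ?thesis
    using H.Hoeffding_ineq_abs_ge'[OF e ne] by (simp only: sample_mean_def eqs)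
qed

end

section \<open>A Chernoff bound with the second moment in the exponent\<close>

lemma exp_le_quadratic: "exp x \<le> 1 + x + x\<^sup>2 / 2 * exp \<bar>x :: real\<bar>"
proof -
  obtain t where t: "\<bar>t\<bar> \<le> \<bar>x\<bar>" "exp x = (\<Sum>m<2. x ^ m / fact m) + exp t / fact 2 * x ^ 2"
    using Maclaurin_exp_le[of x 2] by blast
  have "exp t * x\<^sup>2 \<le> exp \<bar>x\<bar> * x\<^sup>2" using t(1) by (intro mult_right_mono) auto
  then show ?thesis using t(2) by (simp add: numeral_2_eq_2 mult.commute)
qed

text \<open>Exponential Markov inequality with \<open>exp_le_quadratic\<close>: the linear term is
  dropped because the mean is nonpositive, and the quadratic one keeps the second moment. The factor
  \<open>exp (l * B)\<close> tends to 1 as \<open>l\<close> tends to 0, so it costs little for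
  moderate deviations.\<close>

lemma (in sample_array) chernoff_upper:
  assumes B: "\<And>x. \<bar>f x\<bar> \<le> B" and l: "l \<ge> 0" and neg: "mean (P n) f \<le> 0"
  shows "prob {\<omega> \<in> space \<Omega>. a \<le> (\<Sum>i\<in>{1..n}. f (X n i \<omega>))}
    \<le> exp (- l * a + n * (l\<^sup>2 / 2 * exp (l * B) * mean (P n) (\<lambda>x. (f x)\<^sup>2)))"
proof -
  have if': "integrable (P n) f" by (rule integrable_pmf_bounded) (rule B)
  have if2: "integrable (P n) (\<lambda>x. (f x)\<^sup>2)"
    using B by (intro integrable_pmf_bounded[of _ "B\<^sup>2"]) (simp add: power2_le_of_abs_le)
  have el: "exp (l * f x) \<le> exp (l * B)" for x
    using B[of x] l by (simp add: mult_left_mono abs_le_iff)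
  have ie: "integrable (P n) (\<lambda>x. exp (l * f x))"
    using el by (intro integrable_pmf_bounded[of _ "exp (l * B)"]) simp
  have "mean (P n) (\<lambda>x. exp (l * f x)) \<le> mean (P n) (\<lambda>x. 1 + l * f x + l\<^sup>2 / 2 * exp (l * B) * (f x)\<^sup>2)"
  proof (rule integral_mono[OF ie])
    fix x
    have "exp (l * f x) \<le> 1 + l * f x + (l * f x)\<^sup>2 / 2 * exp \<bar>l * f x\<bar>" by (rule exp_le_quadratic)
    also have "\<dots> \<le> 1 + l * f x + (l * f x)\<^sup>2 / 2 * exp (l * B)"
      using B[of x] l by (intro add_left_mono mult_left_mono) (auto simp: abs_mult mult_left_mono)
    finally show "exp (l * f x) \<le> 1 + l * f x + l\<^sup>2 / 2 * exp (l * B) * (f x)\<^sup>2"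
      by (simp add: power_mult_distrib mult_ac)
  qed (use if' if2 in auto)
  also have "\<dots> = 1 + l * mean (P n) f + l\<^sup>2 / 2 * exp (l * B) * mean (P n) (\<lambda>x. (f x)\<^sup>2)"
    using if' if2 by simp
  also have "\<dots> \<le> 1 + l\<^sup>2 / 2 * exp (l * B) * mean (P n) (\<lambda>x. (f x)\<^sup>2)"
    using mult_nonneg_nonpos[OF l neg] by simp
  also have "\<dots> \<le> exp (l\<^sup>2 / 2 * exp (l * B) * mean (P n) (\<lambda>x. (f x)\<^sup>2))" by (rule exp_ge_add_one_self)
  finally have mgf: "mean (P n) (\<lambda>x. exp (l * f x)) \<le> \<dots>" .
  have iX: "integrable \<Omega> (\<lambda>\<omega>. exp (l * f (X n i \<omega>)))" if "i \<in> {1..n}" for i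
    using el fX_meas[OF that, of "\<lambda>x. exp (l * f x)"]
    by (intro integrable_const_bound[where B="exp (l * B)"]) auto
  have ind: "indep_vars (\<lambda>_. borel) (\<lambda>i \<omega>. exp (l * f (X n i \<omega>))) {1..n}"
    using indep_fX[of "\<lambda>x. exp (l * f x)" n] .
  let ?S = "\<lambda>\<omega>. \<Sum>i\<in>{1..n}. f (X n i \<omega>)"
  have mS: "?S \<in> borel_measurable \<Omega>" by (intro borel_measurable_sum fX_meas)
  have S: "exp (l * ?S \<omega>) = (\<Prod>i\<in>{1..n}. exp (l * f (X n i \<omega>)))" for \<omega>
    by (simp add: exp_sum sum_distrib_left)
  have iS: "integrable \<Omega> (\<lambda>\<omega>. exp (l * ?S \<omega>))"
    unfolding S by (rule indep_vars_integrable[OF _ ind iX]) auto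
  have "prob {\<omega> \<in> space \<Omega>. a \<le> ?S \<omega>} = expectation (indicator {\<omega> \<in> space \<Omega>. a \<le> ?S \<omega>})"
    using mS by simp
  also have "\<dots> \<le> expectation (\<lambda>\<omega>. exp (- l * a) * exp (l * ?S \<omega>))"
  proof (rule integral_mono)
    show "integrable \<Omega> (indicat_real {\<omega> \<in> space \<Omega>. a \<le> ?S \<omega>})"
      using mS by (intro integrable_real_indicator) (auto simp: emeasure_eq_measure)
    show "integrable \<Omega> (\<lambda>\<omega>. exp (- l * a) * exp (l * ?S \<omega>))" using iS by simp
    fix \<omega>
    have "1 \<le> exp (- l * a + l * ?S \<omega>)" if "a \<le> ?S \<omega>"
      using mult_left_mono[OF that l] by simp
    then show "indicat_real {\<omega> \<in> space \<Omega>. a \<le> ?S \<omega>} \<omega> \<le> exp (- l * a) * exp (l * ?S \<omega>)"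
      by (auto simp: indicator_def simp flip: exp_add)
  qed
  also have "expectation (\<lambda>\<omega>. exp (- l * a) * exp (l * ?S \<omega>))
      = exp (- l * a) * expectation (\<lambda>\<omega>. \<Prod>i\<in>{1..n}. exp (l * f (X n i \<omega>)))"
    unfolding S by (rule integral_mult_right_zero)
  also have "expectation (\<lambda>\<omega>. \<Prod>i\<in>{1..n}. exp (l * f (X n i \<omega>)))
      = (\<Prod>i\<in>{1..n}. expectation (\<lambda>\<omega>. exp (l * f (X n i \<omega>))))"
    by (rule indep_vars_lebesgue_integral[OF _ ind iX]) auto
  also have "\<dots> = (\<Prod>i\<in>{1..n}. mean (P n) (\<lambda>x. exp (l * f x)))"
    by (intro prod.cong refl expectation_fX)
  also have "\<dots> = mean (P n) (\<lambda>x. exp (l * f x)) ^ n" by simp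
  also have "exp (- l * a) * mean (P n) (\<lambda>x. exp (l * f x)) ^ n \<le> exp (- l * a) * exp (l\<^sup>2 / 2 * exp (l * B) * mean (P n) (\<lambda>x. (f x)\<^sup>2)) ^ n"
    by (intro mult_left_mono power_mono mgf) auto
  also have "\<dots> = exp (- l * a + n * (l\<^sup>2 / 2 * exp (l * B) * mean (P n) (\<lambda>x. (f x)\<^sup>2)))"
    by (simp only: exp_add exp_of_nat_mult)
  finally show ?thesis .
qed

section \<open>Contiguous alternatives\<close>

locale contiguous_array = sample_array \<Omega> X P for \<Omega> :: "'a measure" and X P +
  fixes m M :: int and p :: "int pmf" and h :: "int \<Rightarrow> real"
  assumes supp: "set_pmf p = {m..M}" and h_sum: "(\<Sum>j\<in>{m..M}. h j) = 0"
    and P_eq: "\<forall>\<^sub>F n in sequentially. \<forall>j\<in>{m..M}. pmf (P n) j = pmf p j + h j / sqrt (real n)"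
begin

lemma supp_P: "\<forall>\<^sub>F n in sequentially. set_pmf (P n) \<subseteq> {m..M}"
  using P_eq
proof eventually_elim
  case (elim n)
  have "measure_pmf.prob (P n) {m..M} = (\<Sum>j\<in>{m..M}. pmf p j) + (\<Sum>j\<in>{m..M}. h j) / sqrt (real n)"
    using elim by (simp add: measure_measure_pmf_finite sum.distrib sum_divide_distrib)
  also have "\<dots> = 1" using supp by (simp add: h_sum sum_pmf_eq_1)
  finally have "AE x in measure_pmf (P n). x \<in> {m..M}"
    by (subst measure_pmf.prob_eq_1[symmetric]) auto
  then show ?case by (auto simp: AE_measure_pmf_iff)
qed

lemma mean_p: "mean p f = (\<Sum>j\<in>{m..M}. f j * pmf p j)"
  using supp by (intro integral_measure_pmf_real) auto

lemma mean_P: "\<forall>\<^sub>F n in sequentially. mean (P n) f = mean p f + (\<Sum>j\<in>{m..M}. f j * h j) / sqrt (real n)"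
  using P_eq supp_P
proof eventually_elim
  case (elim n)
  have "mean (P n) f = (\<Sum>j\<in>{m..M}. f j * pmf (P n) j)"
    using elim by (intro integral_measure_pmf_real) auto
  then show ?case
    using elim by (simp add: mean_p distrib_left sum.distrib sum_divide_distrib)
qed

lemma mean_tendsto: "(\<lambda>n. mean (P n) f) \<longlonglongrightarrow> mean p f"
proof -
  have "(\<lambda>n. a + c / sqrt (real n)) \<longlonglongrightarrow> a" for a c :: real by real_asymp
  then show ?thesis by (rule Lim_transform_eventually) (use mean_P[of f] in \<open>auto elim: eventually_mono\<close>)
qed

text \<open>The covering events spare measurability proofs for the exceptional sets.\<close>

definition rare :: "(nat \<Rightarrow> 'a \<Rightarrow> bool) \<Rightarrow> bool" where
  "rare B \<longleftrightarrow> (\<exists>C. \<forall>\<^sub>F n in sequentially. \<exists>A\<in>events. {\<omega> \<in> space \<Omega>. B n \<omega>} \<subseteq> A \<and> prob A \<le> C / sqrt (real n))"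

lemma rareI:
  assumes "\<forall>\<^sub>F n in sequentially. {\<omega> \<in> space \<Omega>. B n \<omega>} \<in> events \<and> prob {\<omega> \<in> space \<Omega>. B n \<omega>} \<le> 1 / sqrt (real n)"
  shows "rare B"
  unfolding rare_def using assms by (intro exI[of _ 1]) (auto elim!: eventually_mono)

lemma rare_mono:
  assumes "rare B" "\<forall>\<^sub>F n in sequentially. \<forall>\<omega>\<in>space \<Omega>. B' n \<omega> \<longrightarrow> B n \<omega>" shows "rare B'"
proof -
  obtain C where "\<forall>\<^sub>F n in sequentially. \<exists>A\<in>events. {\<omega> \<in> space \<Omega>. B n \<omega>} \<subseteq> A \<and> prob A \<le> C / sqrt (real n)"
    using assms(1) by (auto simp: rare_def)
  then have "\<forall>\<^sub>F n in sequentially. \<exists>A\<in>events. {\<omega> \<in> space \<Omega>. B' n \<omega>} \<subseteq> A \<and> prob A \<le> C / sqrt (real n)"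
    using assms(2)
  proof eventually_elim
    case (elim n)
    then obtain A where "A \<in> events" "{\<omega> \<in> space \<Omega>. B n \<omega>} \<subseteq> A" "prob A \<le> C / sqrt (real n)" by blast
    then show ?case using elim(2) by (intro bexI[of _ A]) auto
  qed
  then show ?thesis by (auto simp: rare_def)
qed

lemma rare_False: "rare (\<lambda>n \<omega>. False)"
  by (rule rareI) (auto intro!: always_eventually)

lemma rare_disj:
  assumes "rare B" "rare B'" shows "rare (\<lambda>n \<omega>. B n \<omega> \<or> B' n \<omega>)"
proof -
  obtain C C' where "\<forall>\<^sub>F n in sequentially. \<exists>A\<in>events. {\<omega> \<in> space \<Omega>. B n \<omega>} \<subseteq> A \<and> prob A \<le> C / sqrt (real n)"
    "\<forall>\<^sub>F n in sequentially. \<exists>A\<in>events. {\<omega> \<in> space \<Omega>. B' n \<omega>} \<subseteq> A \<and> prob A \<le> C' / sqrt (real n)"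
    using assms by (auto simp: rare_def)
  then have "\<forall>\<^sub>F n in sequentially. \<exists>A\<in>events. {\<omega> \<in> space \<Omega>. B n \<omega> \<or> B' n \<omega>} \<subseteq> A \<and> prob A \<le> (C + C') / sqrt (real n)"
  proof eventually_elim
    case (elim n)
    then obtain A A' where A: "A \<in> events" "{\<omega> \<in> space \<Omega>. B n \<omega>} \<subseteq> A" "prob A \<le> C / sqrt (real n)"
      and A': "A' \<in> events" "{\<omega> \<in> space \<Omega>. B' n \<omega>} \<subseteq> A'" "prob A' \<le> C' / sqrt (real n)" by blast
    have "prob (A \<union> A') \<le> prob A + prob A'" using A A' by (intro measure_Un_le) auto
    also have "\<dots> \<le> (C + C') / sqrt (real n)" using A A' by (simp add: add_divide_distrib)
    finally show ?case using A A' by (intro bexI[of _ "A \<union> A'"]) auto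
  qed
  then show ?thesis by (auto simp: rare_def)
qed

lemma rare_finite_ex:
  assumes "finite S" "\<And>s. s \<in> S \<Longrightarrow> rare (B s)" shows "rare (\<lambda>n \<omega>. \<exists>s\<in>S. B s n \<omega>)"
  using assms
proof (induction S rule: finite_induct)
  case empty then show ?case using rare_False by simp
next
  case (insert s S)
  then show ?case using rare_disj[of "B s" "\<lambda>n \<omega>. \<exists>s\<in>S. B s n \<omega>"] by simp
qed

lemma rare_bigo:
  assumes "rare B" shows "(\<lambda>n. prob {\<omega> \<in> space \<Omega>. B n \<omega>}) \<in> O(\<lambda>n. 1 / sqrt (real n))"
proof -
  obtain C where "\<forall>\<^sub>F n in sequentially. \<exists>A\<in>events. {\<omega> \<in> space \<Omega>. B n \<omega>} \<subseteq> A \<and> prob A \<le> C / sqrt (real n)"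
    using assms by (auto simp: rare_def)
  then have "\<forall>\<^sub>F n in sequentially. norm (prob {\<omega> \<in> space \<Omega>. B n \<omega>}) \<le> C * norm (1 / sqrt (real n))"
  proof eventually_elim
    case (elim n)
    then obtain A where "A \<in> events" "{\<omega> \<in> space \<Omega>. B n \<omega>} \<subseteq> A" "prob A \<le> C / sqrt (real n)" by blast
    then have "prob {\<omega> \<in> space \<Omega>. B n \<omega>} \<le> C / sqrt (real n)"
      by (meson finite_measure_mono order_trans)
    then show ?case by simp
  qed
  then show ?thesis by (rule bigoI)
qed

text \<open>\<open>C\<close> and the range of \<open>n\<close> are fixed before \<open>U\<close> and
  \<open>V\<close>, so one comparison serves all pairs of events, and both directions when the
  exceptional condition is symmetric.\<close>

lemma rare_prob_le:
  assumes "rare B"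
  obtains C where "\<forall>\<^sub>F n in sequentially. \<forall>U V. U \<in> events \<longrightarrow> V \<in> events \<longrightarrow>
    (\<forall>\<omega>\<in>U. \<omega> \<in> V \<or> B n \<omega>) \<longrightarrow> prob U \<le> prob V + C / sqrt (real n)"
proof -
  obtain C where "\<forall>\<^sub>F n in sequentially. \<exists>A\<in>events. {\<omega> \<in> space \<Omega>. B n \<omega>} \<subseteq> A \<and> prob A \<le> C / sqrt (real n)"
    using assms by (auto simp: rare_def)
  then have "\<forall>\<^sub>F n in sequentially. \<forall>U V. U \<in> events \<longrightarrow> V \<in> events \<longrightarrow>
    (\<forall>\<omega>\<in>U. \<omega> \<in> V \<or> B n \<omega>) \<longrightarrow> prob U \<le> prob V + C / sqrt (real n)"
  proof (rule eventually_mono, intro allI impI)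
    fix n U V
    assume elim: "\<exists>A\<in>events. {\<omega> \<in> space \<Omega>. B n \<omega>} \<subseteq> A \<and> prob A \<le> C / sqrt (real n)"
      "U \<in> events" "V \<in> events" "\<forall>\<omega>\<in>U. \<omega> \<in> V \<or> B n \<omega>"
    then obtain A where A: "A \<in> events" "{\<omega> \<in> space \<Omega>. B n \<omega>} \<subseteq> A" "prob A \<le> C / sqrt (real n)" by blast
    have "prob U \<le> prob (V \<union> A)"
      using elim A sets.sets_into_space[OF elim(2)] by (intro finite_measure_mono) auto
    also have "\<dots> \<le> prob V + prob A" using A elim by (intro measure_Un_le) auto
    finally show "prob U \<le> prob V + C / sqrt (real n)" using A by simp
  qed
  then show ?thesis by (rule that)
qed

text \<open>For large \<open>n\<close> the means under \<open>P n\<close> and \<open>p\<close>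
  differ by less than \<open>e / 2\<close>; Hoeffding's inequality handles the other half, and its
  exponential rate is below \<open>1 / sqrt n\<close>.\<close>

lemma lln:
  assumes B: "\<And>x. \<bar>f x\<bar> \<le> B" and e: "e > 0"
  shows "rare (\<lambda>n \<omega>. \<bar>sample_mean n f (\<lambda>i. X n i \<omega>) - mean p f\<bar> \<ge> e)"
proof (rule rareI)
  have "0 \<le> B" using B[of 0] by linarith
  define c where "c = 2 * (e / 2)\<^sup>2 / (2 * B + 2)\<^sup>2"
  have "c > 0" using \<open>0 \<le> B\<close> e by (simp add: c_def)
  then have "\<forall>\<^sub>F n in sequentially. 2 * exp (- c * real n) \<le> 1 / sqrt (real n)" by real_asymp
  moreover have "\<forall>\<^sub>F n in sequentially. \<bar>mean (P n) f - mean p f\<bar> < e / 2"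
    using tendstoD[OF mean_tendsto, of "e / 2" f] e by (simp add: dist_real_def)
  ultimately show "\<forall>\<^sub>F n in sequentially.
    {\<omega> \<in> space \<Omega>. \<bar>sample_mean n f (\<lambda>i. X n i \<omega>) - mean p f\<bar> \<ge> e} \<in> events \<and>
    prob {\<omega> \<in> space \<Omega>. \<bar>sample_mean n f (\<lambda>i. X n i \<omega>) - mean p f\<bar> \<ge> e} \<le> 1 / sqrt (real n)"
    using eventually_ge_at_top[of 1]
  proof eventually_elim
    case (elim n)
    have ev: "{\<omega> \<in> space \<Omega>. \<bar>sample_mean n f (\<lambda>i. X n i \<omega>) - c\<bar> \<ge> d} \<in> events" for c d
      using sample_mean_meas[of n f] by measurable
    have "prob {\<omega> \<in> space \<Omega>. \<bar>sample_mean n f (\<lambda>i. X n i \<omega>) - mean p f\<bar> \<ge> e}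
        \<le> prob {\<omega> \<in> space \<Omega>. \<bar>sample_mean n f (\<lambda>i. X n i \<omega>) - mean (P n) f\<bar> \<ge> e / 2}"
    proof (rule finite_measure_mono[OF _ ev], rule subsetI, rule CollectI)
      fix \<omega> assume "\<omega> \<in> {\<omega> \<in> space \<Omega>. \<bar>sample_mean n f (\<lambda>i. X n i \<omega>) - mean p f\<bar> \<ge> e}"
      then have \<omega>: "\<omega> \<in> space \<Omega>" "\<bar>sample_mean n f (\<lambda>i. X n i \<omega>) - mean p f\<bar> \<ge> e" by simp_all
      from \<omega>(2) have "e / 2 \<le> \<bar>sample_mean n f (\<lambda>i. X n i \<omega>) - mean (P n) f\<bar>"
        using elim(2) by linarith
      with \<omega>(1) show "\<omega> \<in> space \<Omega> \<and> e / 2 \<le> \<bar>sample_mean n f (\<lambda>i. X n i \<omega>) - mean (P n) f\<bar>" ..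
    qed
    also have "\<dots> \<le> 2 * exp (- 2 * real n * (e / 2)\<^sup>2 / (2 * B + 2)\<^sup>2)"
      using e elim by (intro hoeffding_mean B) auto
    also have "\<dots> = 2 * exp (- c * real n)" by (simp add: c_def mult_ac)
    finally show ?case using ev elim(1) by auto
  qed
qed

text \<open>For large \<open>n\<close> this event is null, because \<open>P n\<close> is carried by
  \<open>{m..M}\<close>; it need not be empty.\<close>

lemma off_range: "rare (\<lambda>n \<omega>. \<exists>i\<in>{1..n}. X n i \<omega> \<notin> {m..M})"
proof (rule rareI)
  show "\<forall>\<^sub>F n in sequentially.
    {\<omega> \<in> space \<Omega>. \<exists>i\<in>{1..n}. X n i \<omega> \<notin> {m..M}} \<in> events \<and>
    prob {\<omega> \<in> space \<Omega>. \<exists>i\<in>{1..n}. X n i \<omega> \<notin> {m..M}} \<le> 1 / sqrt (real n)"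
    using supp_P
  proof eventually_elim
    case (elim n)
    have ev: "{\<omega> \<in> space \<Omega>. X n i \<omega> \<notin> {m..M}} \<in> events" if "i \<in> {1..n}" for i
      using measurable_sets[OF X_meas[OF that], of "- {m..M}"] by (simp add: vimage_def Int_def conj_commute)
    have ev': "{\<omega> \<in> space \<Omega>. \<exists>i\<in>{1..n}. X n i \<omega> \<notin> {m..M}} \<in> events"
      by (intro sets.sets_Collect_finite_Ex ev) auto
    have "AE \<omega> in \<Omega>. X n i \<omega> \<in> {m..M}" if "i \<in> {1..n}" for i
    proof -
      have *: "distr \<Omega> (count_space UNIV) (X n i) = measure_pmf (P n)"
        using iid that by (simp add: iid_rows_def)
      have "AE x in distr \<Omega> (count_space UNIV) (X n i). x \<in> {m..M}"
        unfolding * using elim by (auto simp: AE_measure_pmf_iff)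
      then show ?thesis using X_meas[OF that] by (subst (asm) AE_distr_iff) auto
    qed
    then have "AE \<omega> in \<Omega>. \<forall>i\<in>{1..n}. X n i \<omega> \<in> {m..M}" by (intro AE_finite_allI) auto
    then have "prob {\<omega> \<in> space \<Omega>. \<exists>i\<in>{1..n}. X n i \<omega> \<notin> {m..M}} = 0"
      using prob_Collect_eq_0[OF ev'] by simp
    then show ?case using ev' by simp
  qed
qed

text \<open>The characteristic function and \<open>(1 - v / (2 * n)) ^ n\<close> are
  \<open>n\<close>-th powers of numbers of modulus at most 1, so they differ by at most
  \<open>n\<close> times the difference of the bases. This absorbs the dependence of the variance on
  \<open>n\<close>.\<close>

lemma clt_char:
  assumes B: "\<And>x. \<bar>f x\<bar> \<le> B"
  shows "(\<lambda>n. char (distr \<Omega> borel (dev n f)) 1) \<longlonglongrightarrow> exp (- (mean p (\<lambda>x. (f x)\<^sup>2) - (mean p f)\<^sup>2) / 2)"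
proof -
  define v where "v = mean p (\<lambda>x. (f x)\<^sup>2) - (mean p f)\<^sup>2"
  define vn where "vn n = mean (P n) (\<lambda>x. (f x)\<^sup>2) - (mean (P n) f)\<^sup>2" for n
  have vn: "vn \<longlonglongrightarrow> v" unfolding vn_def[abs_def] v_def by (intro tendsto_intros mean_tendsto)
  have v0: "0 \<le> v"
  proof -
    have "v = measure_pmf.variance p f"
      unfolding v_def using power2_le_of_abs_le[OF B]
      by (intro measure_pmf.variance_eq[symmetric] integrable_pmf_bounded[of f B] integrable_pmf_bounded[of _ "B\<^sup>2"] B) auto
    then show ?thesis by (simp add: measure_pmf.variance_positive)
  qed
  define K where "K = (2 * B) ^ 3 / 6"
  have main: "\<forall>\<^sub>F n in sequentially.
      cmod (char (distr \<Omega> borel (dev n f)) 1 - complex_of_real ((1 + (- v / 2) / n) ^ n))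
        \<le> K / sqrt n + \<bar>vn n - v\<bar> / 2"
    \<comment> \<open>\<open>n \<ge> v\<close> keeps \<open>1 - v / (2 * n)\<close> between 1/2 and
      1.\<close>
    using eventually_ge_at_top[of "nat \<lceil>v\<rceil>"] eventually_ge_at_top[of 1]
  proof eventually_elim
    case (elim n)
    then have n: "v \<le> n" "n \<ge> 1" by (simp_all add: nat_ceiling_le_eq)
    obtain \<phi> where \<phi>: "char (distr \<Omega> borel (dev n f)) 1 = \<phi> ^ n" "cmod \<phi> \<le> 1"
      "cmod (\<phi> - (1 - vn n / n / 2)) \<le> (2 * B / sqrt n) ^ 3 / 6"
      by (rule dev_char_approx[where f=f, OF B n(2), folded vn_def])
    let ?w = "complex_of_real (1 + (- v / 2) / n)"
    have w: "cmod ?w \<le> 1"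
      using n v0 by (simp only: norm_of_real) (simp add: abs_le_iff field_simps)
    have "cmod (\<phi> - ?w) \<le> cmod (\<phi> - (1 - vn n / n / 2)) + cmod (complex_of_real ((v - vn n) / n / 2))"
    proof -
      have "\<phi> - ?w = (\<phi> - (1 - vn n / n / 2)) + complex_of_real ((v - vn n) / n / 2)"
        by (simp add: diff_divide_distrib)
      then show ?thesis by (metis norm_triangle_ineq)
    qed
    also have "\<dots> \<le> (2 * B / sqrt n) ^ 3 / 6 + \<bar>vn n - v\<bar> / n / 2"
      using \<phi>(3) unfolding norm_of_real by (simp add: abs_divide abs_minus_commute)
    finally have d: "cmod (\<phi> - ?w) \<le> (2 * B / sqrt n) ^ 3 / 6 + \<bar>vn n - v\<bar> / n / 2" .
    have "cmod (\<phi> ^ n - ?w ^ n) \<le> n * cmod (\<phi> - ?w)" by (rule norm_power_diff[OF \<phi>(2) w])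
    also have "\<dots> \<le> n * ((2 * B / sqrt n) ^ 3 / 6 + \<bar>vn n - v\<bar> / n / 2)"
      using d by (intro mult_left_mono) auto
    also have "\<dots> = n * (K / sqrt n ^ 3) + \<bar>vn n - v\<bar> / 2"
      using n by (simp add: K_def power_divide distrib_left)
    also have "n * (K / sqrt n ^ 3) = K / sqrt n"
      using n by (simp add: power3_eq_cube)
    finally show ?case unfolding \<phi>(1) by simp
  qed
  have "(\<lambda>n. K / sqrt n + \<bar>vn n - v\<bar> / 2) \<longlonglongrightarrow> 0 + \<bar>v - v\<bar> / 2"
  proof (intro tendsto_intros vn)
    show "(\<lambda>n. K / sqrt (real n)) \<longlonglongrightarrow> 0" by real_asymp
  qed simp
  then have "(\<lambda>n. char (distr \<Omega> borel (dev n f)) 1 - complex_of_real ((1 + (- v / 2) / n) ^ n)) \<longlonglongrightarrow> 0"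
    by (intro Lim_null_comparison[OF main]) simp
  moreover have "(\<lambda>n. complex_of_real ((1 + (- v / 2) / n) ^ n)) \<longlonglongrightarrow> complex_of_real (exp (- v / 2))"
    by (intro tendsto_of_real tendsto_exp_limit_sequentially)
  ultimately show ?thesis unfolding v_def[symmetric] by (rule Lim_transform[rotated])
qed

text \<open>Linear combinations of deviations are deviations of one bounded function, which reduces
  the multivariate limit theorem to \<open>clt_char\<close>.\<close>

lemma dev_linear:
  assumes "finite J" "\<And>j x. j \<in> J \<Longrightarrow> \<bar>g j x\<bar> \<le> B"
  shows "(\<Sum>j\<in>J. a j * dev n (g j) \<omega>) = dev n (\<lambda>x. \<Sum>j\<in>J. a j * g j x) \<omega>"
proof -
  have "mean (P n) (\<lambda>x. \<Sum>j\<in>J. a j * g j x) = (\<Sum>j\<in>J. a j * mean (P n) (g j))"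
    using assms integrable_pmf_bounded[of "g _" B "P n"] by simp
  moreover have "sample_mean n (\<lambda>x. \<Sum>j\<in>J. a j * g j x) x = (\<Sum>j\<in>J. a j * sample_mean n (g j) x)" for x
    unfolding sample_mean_def by (subst sum.swap) (simp add: sum_distrib_left sum_divide_distrib)
  ultimately show ?thesis
    unfolding dev_def by (simp add: sum_distrib_left right_diff_distrib sum_subtractf mult_ac)
qed

text \<open>The threshold is \<open>sqrt (8/9 * s)\<close>, a lower bound for the estimated standard deviation, times
  \<open>sqrt (3/2 * ln n)\<close>, a lower bound for the normal quantile.\<close>

lemma upper_tail:
  assumes B: "\<And>x. \<bar>f x\<bar> \<le> B" and neg: "\<forall>\<^sub>F n in sequentially. mean (P n) f \<le> 0"
    and s: "mean p (\<lambda>x. (f x)\<^sup>2) = s" "s > 0"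
  shows "rare (\<lambda>n \<omega>. sqrt (4 / 3 * s * ln n) \<le> sqrt n * sample_mean n f (\<lambda>i. X n i \<omega>))"
proof (rule rareI)
  \<comment> \<open>Minimiser over \<open>l\<close> of
    \<open>- l * a + n * l\<^sup>2 * s / 2\<close>, namely \<open>a / (n * s)\<close>, where
    \<open>a\<close> is the threshold of the unnormalised sum.\<close>
  define l where "l n = sqrt (4 / 3 * ln (real n) / (s * real n))" for n
  have "l \<longlonglongrightarrow> 0" unfolding l_def[abs_def] using s(2) by real_asymp
  then have "(\<lambda>n. exp (l n * B) * mean (P n) (\<lambda>x. (f x)\<^sup>2)) \<longlonglongrightarrow> exp (0 * B) * s"
    unfolding s(1)[symmetric] by (intro tendsto_intros mean_tendsto)
  \<comment> \<open>With this factor the exponent is at most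
    \<open>- 4/3 + (4/3 / 2) * (5/4)\<close> times \<open>ln n\<close>, that is
    \<open>- ln n / 2\<close>; 5/4 is the largest factor that yields
    \<open>1 / sqrt n\<close>.\<close>
  then have "\<forall>\<^sub>F n in sequentially. exp (l n * B) * mean (P n) (\<lambda>x. (f x)\<^sup>2) < 5 / 4 * s"
    using s(2) by (intro order_tendstoD) auto
  then show "\<forall>\<^sub>F n in sequentially.
    {\<omega> \<in> space \<Omega>. sqrt (4 / 3 * s * ln n) \<le> sqrt n * sample_mean n f (\<lambda>i. X n i \<omega>)} \<in> events \<and>
    prob {\<omega> \<in> space \<Omega>. sqrt (4 / 3 * s * ln n) \<le> sqrt n * sample_mean n f (\<lambda>i. X n i \<omega>)} \<le> 1 / sqrt (real n)"
    using neg eventually_ge_at_top[of 1]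
  proof eventually_elim
    case (elim n)
    have ln0: "0 \<le> ln (real n)" using elim by simp
    have l0: "0 \<le> l n" using ln0 s(2) by (simp add: l_def)
    have l2: "(l n)\<^sup>2 = 4 / 3 * ln (real n) / (s * real n)" using ln0 s(2) by (simp add: l_def)
    define a where "a = sqrt (4 / 3 * s * ln n) * sqrt n"
    have la: "l n * a = 4 / 3 * ln (real n)"
    proof -
      have "l n * a = sqrt ((4 / 3 * ln (real n)) ^ 2)"
        using elim s(2) unfolding l_def a_def real_sqrt_mult[symmetric]
        by (intro arg_cong[where f=sqrt]) (simp add: field_simps power2_eq_square)
      then show ?thesis using ln0 by simp
    qed
    have "{\<omega> \<in> space \<Omega>. sqrt (4 / 3 * s * ln n) \<le> sqrt n * sample_mean n f (\<lambda>i. X n i \<omega>)}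
        = {\<omega> \<in> space \<Omega>. a \<le> (\<Sum>i\<in>{1..n}. f (X n i \<omega>))}" (is "?E = ?E'")
    proof -
      have "sqrt (4 / 3 * s * ln n) \<le> sqrt n * (S / n) \<longleftrightarrow> a \<le> S" for S
      proof -
        have "sqrt n * (S / n) = S / sqrt n" using elim by (simp add: field_simps)
        then show ?thesis using elim by (simp add: a_def pos_le_divide_eq)
      qed
      then show ?thesis unfolding sample_mean_def by (simp only:)
    qed
    moreover have "?E \<in> events" using sample_mean_meas[of n f] by measurable
    moreover have "prob ?E' \<le> exp (- l n * a + n * ((l n)\<^sup>2 / 2 * exp (l n * B) * mean (P n) (\<lambda>x. (f x)\<^sup>2)))"
      by (rule chernoff_upper[OF B l0 elim(2)])
    moreover have "- l n * a + n * ((l n)\<^sup>2 / 2 * exp (l n * B) * mean (P n) (\<lambda>x. (f x)\<^sup>2)) \<le> - ln n / 2"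
    proof -
      have "n * ((l n)\<^sup>2 / 2 * exp (l n * B) * mean (P n) (\<lambda>x. (f x)\<^sup>2))
          = 2 / 3 * ln n / s * (exp (l n * B) * mean (P n) (\<lambda>x. (f x)\<^sup>2))"
        using elim s(2) unfolding l2 by (simp add: field_simps)
      also have "\<dots> \<le> 2 / 3 * ln n / s * (5 / 4 * s)"
        using elim ln0 s(2) by (intro mult_left_mono) auto
      also have "\<dots> = 5 / 6 * ln n" using s(2) by simp
      finally show ?thesis using la by linarith
    qed
    moreover have "exp (- ln n / 2) = 1 / sqrt n"
      using elim by (simp add: exp_minus ln_sqrt[symmetric] inverse_eq_divide)
    ultimately show ?case by (metis (no_types, lifting) exp_le_cancel_iff order_trans)
  qed
qed

section \<open>Discrete samples: measurability and conditioning\<close>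

lemma sample_event_meas: "sample_event \<Omega> n (X n) x \<in> events"
proof -
  have "{\<omega> \<in> space \<Omega>. X n i \<omega> = x i} \<in> events" if "i \<in> {1..n}" for i
    using measurable_sets[OF X_meas[OF that], of "{x i}"] by (simp add: vimage_def Int_def conj_commute)
  then show ?thesis unfolding sample_event_def by (intro sets.sets_Collect_finite_All) auto
qed

text \<open>There are only countably many samples of size \<open>n\<close>, so any property of the
  sample is a countable union of elementary events. Statements about quantiles become measurable
  without analysing the quantile as a function.\<close>

lemma sample_pred_meas:
  assumes "\<And>x y. (\<And>i. i \<in> {1..n} \<Longrightarrow> x i = y i) \<Longrightarrow> Q x = Q y"
  shows "{\<omega> \<in> space \<Omega>. Q (\<lambda>i. X n i \<omega>)} \<in> events"
proof -
  have "{\<omega> \<in> space \<Omega>. Q (\<lambda>i. X n i \<omega>)}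
      = (\<Union>x\<in>{x \<in> Pi\<^sub>E {1..n} (\<lambda>_. UNIV). Q x}. sample_event \<Omega> n (X n) x)" (is "?L = ?R")
  proof (intro equalityI subsetI)
    fix \<omega> assume \<omega>: "\<omega> \<in> ?L"
    \<comment> \<open>Only extensional functions are enumerated: there are countably many of them,
      unlike functions on all naturals.\<close>
    define x where "x = restrict (\<lambda>i. X n i \<omega>) {1..n}"
    have "Q x \<longleftrightarrow> Q (\<lambda>i. X n i \<omega>)" by (rule assms) (simp add: x_def)
    then show "\<omega> \<in> ?R" using \<omega> by (auto simp: sample_event_def x_def intro!: exI[of _ x])
  next
    fix \<omega> assume "\<omega> \<in> ?R"
    then obtain x where "Q x" "\<omega> \<in> space \<Omega>" "\<And>i. i \<in> {1..n} \<Longrightarrow> X n i \<omega> = x i"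
      by (auto simp: sample_event_def)
    then show "\<omega> \<in> ?L" using assms[of "\<lambda>i. X n i \<omega>" x] by simp
  qed
  moreover have "?R \<in> events"
    by (intro sets.countable_UN'' countable_subset[OF _ countable_PiE[of "{1..n}" "\<lambda>_. UNIV"]] sample_event_meas) auto
  ultimately show ?thesis by simp
qed

text \<open>The conditional law is prescribed only for samples of positive probability; the
  remaining ones are countably many and together null.\<close>

lemma null_samples: "rare (\<lambda>n \<omega>. measure \<Omega> (sample_event \<Omega> n (X n) (\<lambda>i. X n i \<omega>)) = 0)"
proof (rule rareI, rule always_eventually, rule allI)
  fix n
  let ?x = "\<lambda>\<omega>. sample_event \<Omega> n (X n) (\<lambda>i. X n i \<omega>)"
  have cong: "sample_event \<Omega> n (X n) x = sample_event \<Omega> n (X n) y"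
    if "\<And>i. i \<in> {1..n} \<Longrightarrow> x i = y i" for x y
    using that by (auto simp: sample_event_def)
  have ev: "{\<omega> \<in> space \<Omega>. prob (?x \<omega>) = 0} \<in> events"
    by (rule sample_pred_meas[where Q="\<lambda>x. prob (sample_event \<Omega> n (X n) x) = 0"]) (metis cong)
  define R where "R = {x \<in> Pi\<^sub>E {1..n} (\<lambda>_. UNIV :: int set). prob (sample_event \<Omega> n (X n) x) = 0}"
  have "countable R" unfolding R_def
    by (rule countable_subset[OF _ countable_PiE[of "{1..n}" "\<lambda>_. UNIV"]]) auto
  then have "(\<Union>x\<in>R. sample_event \<Omega> n (X n) x) \<in> null_sets \<Omega>"
    by (intro null_sets_UN') (auto simp: R_def emeasure_eq_measure sample_event_meas null_sets_def)
  moreover have "{\<omega> \<in> space \<Omega>. prob (?x \<omega>) = 0} \<subseteq> (\<Union>x\<in>R. sample_event \<Omega> n (X n) x)"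
  proof
    fix \<omega> assume \<omega>: "\<omega> \<in> {\<omega> \<in> space \<Omega>. prob (?x \<omega>) = 0}"
    define x where "x = restrict (\<lambda>i. X n i \<omega>) {1..n}"
    have eq: "sample_event \<Omega> n (X n) x = ?x \<omega>" by (rule cong) (simp add: x_def)
    have "x \<in> Pi\<^sub>E {1..n} (\<lambda>_. UNIV)" by (simp add: x_def)
    then have "x \<in> R" using \<omega> by (simp add: R_def eq)
    moreover have "\<omega> \<in> sample_event \<Omega> n (X n) x" using \<omega> by (auto simp: sample_event_def x_def)
    ultimately show "\<omega> \<in> (\<Union>x\<in>R. sample_event \<Omega> n (X n) x)" by blast
  qed
  ultimately have "{\<omega> \<in> space \<Omega>. prob (?x \<omega>) = 0} \<in> null_sets \<Omega>"
    using ev by (auto intro: null_sets_subset)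
  then show "{\<omega> \<in> space \<Omega>. prob (?x \<omega>) = 0} \<in> events \<and> prob {\<omega> \<in> space \<Omega>. prob (?x \<omega>) = 0} \<le> 1 / sqrt (real n)"
    using ev by (simp add: measure_eq_0_null_sets)
qed

end

section \<open>The estimated set of non-knots\<close>

locale test_setting = contiguous_array \<Omega> X P m M p h for \<Omega> :: "'a measure" and X P m M p h +
  fixes k :: nat and \<delta> :: real
  assumes k1: "k \<ge> 1" and mMk: "m \<le> M - int k"
    and p_min: "Min (nabla k (pmf p) ` {m..M - int k}) = 0"
    and contig: "contiguous_alternatives k m M p h \<delta> P"
begin

abbreviation "Sk \<equiv> {m..M - int k}"
abbreviation "I0 \<equiv> non_knots k m M p"
abbreviation "g j \<equiv> \<lambda>x. nabla_ind k x j"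
abbreviation "B0 \<equiv> (2::real) ^ k"
abbreviation "obs n \<omega> \<equiv> \<lambda>i. X n i \<omega>"

lemma g_bound: "\<bar>g j x\<bar> \<le> B0"
  by (rule abs_nabla_ind_le)

lemma gg_bound: "\<bar>g i x * g j x\<bar> \<le> B0 * B0"
  unfolding abs_mult by (rule mult_mono[OF g_bound g_bound]) auto

lemma nabla_p: "j \<in> Sk \<Longrightarrow> nabla k (pmf p) j = mean p (g j)"
  unfolding mean_p by (subst nabla_eq_sum) (auto simp: mult.commute)

lemma mean_P_g:
  "\<forall>\<^sub>F n in sequentially. \<forall>j\<in>Sk. mean (P n) (g j) = nabla k (pmf p) j + nabla k h j / sqrt (real n)"
proof (intro eventually_ball_finite ballI)
  fix j assume j: "j \<in> Sk"
  have "(\<Sum>x\<in>{m..M}. g j x * h x) = nabla k h j"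
    by (simp only: nabla_eq_sum[OF j] mult.commute)
  then show "\<forall>\<^sub>F n in sequentially. mean (P n) (g j) = nabla k (pmf p) j + nabla k h j / sqrt (real n)"
    using mean_P[of "g j"] by (simp only: nabla_p[OF j])
qed simp

lemma nabla_P:
  "\<forall>\<^sub>F n in sequentially. \<forall>j\<in>Sk. nabla k (pmf (P n)) j = nabla k (pmf p) j + nabla k h j / sqrt (real n)"
  using mean_P_g supp_P
proof eventually_elim
  case (elim n)
  show ?case
  proof
    fix j assume j: "j \<in> Sk"
    have "mean (P n) (g j) = (\<Sum>x\<in>{m..M}. g j x * pmf (P n) x)"
      using elim by (intro integral_measure_pmf_real) auto
    also have "\<dots> = nabla k (pmf (P n)) j" by (simp only: nabla_eq_sum[OF j] mult.commute)
    finally show "nabla k (pmf (P n)) j = nabla k (pmf p) j + nabla k h j / sqrt (real n)"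
      using elim j by simp
  qed
qed

lemma nabla_emp: "nabla k (emp_pmf n x) j = sample_mean n (g j) x"
  by (simp only: nabla_emp_pmf sample_mean_def)

lemma emp_cov_eq: "emp_cov k n x i j
    = sample_mean n (\<lambda>y. g i y * g j y) x - sample_mean n (g i) x * sample_mean n (g j) x"
  by (simp only: emp_cov_def nabla_emp sample_mean_def)

lemma Sigma_eq: "Sigma_k k p i j = mean p (\<lambda>x. g i x * g j x) - mean p (g i) * mean p (g j)"
proof -
  have int: "integrable p (g i)" "integrable p (g j)" "integrable p (\<lambda>x. g i x * g j x)"
    by (rule integrable_pmf_bounded, rule g_bound gg_bound)+
  have "(g i x - a) * (g j x - b) = g i x * g j x - b * g i x - a * g j x + a * b" for a b x
    by (simp add: algebra_simps)
  then show ?thesis unfolding Sigma_k_def pmf_cov_def using int by simp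
qed

text \<open>Rows of a factor of \<open>Sigma_k\<close>: covariances under \<open>p\<close> are inner
  products of centred functions weighted by the masses, so the latent normals are indexed by the
  atoms of \<open>p\<close>.\<close>

definition Bf :: "int \<Rightarrow> int \<Rightarrow> real" where
  "Bf j x = sqrt (pmf p x) * (g j x - mean p (g j))"

lemma Sigma_factor: "Sigma_k k p i j = (\<Sum>x\<in>{m..M}. Bf i x * Bf j x)"
proof -
  have "Sigma_k k p i j = (\<Sum>x\<in>{m..M}. ((g i x - mean p (g i)) * (g j x - mean p (g j))) * pmf p x)"
    unfolding Sigma_k_def pmf_cov_def by (rule mean_p)
  also have "\<dots> = (\<Sum>x\<in>{m..M}. Bf i x * Bf j x)"
  proof (rule sum.cong[OF refl])
    fix x
    have "Bf i x * Bf j x = (sqrt (pmf p x) * sqrt (pmf p x)) * ((g i x - mean p (g i)) * (g j x - mean p (g j)))"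
      unfolding Bf_def by (simp only: mult_ac)
    then show "((g i x - mean p (g i)) * (g j x - mean p (g j))) * pmf p x = Bf i x * Bf j x"
      by simp
  qed
  finally show ?thesis .
qed

text \<open>Dividing by \<open>sqrt (pmf p x)\<close> cancels the weight in \<open>Bf\<close>, the
  centring term vanishes as \<open>\<phi>\<close> has sum 0, and what remains is
  \<open>nabla k \<phi> j = 1\<close>.\<close>

lemma exists_shift:
  "\<exists>u. \<forall>j\<in>Sk. (\<Sum>x\<in>{m..M}. Bf j x * u x) = 1"
proof -
  have "m \<le> M" using mMk by simp
  obtain \<phi> where \<phi>: "(\<Sum>x\<in>{m..M}. \<phi> x) = 0" "\<And>j. nabla k \<phi> j = 1"
    by (rule exists_nabla_eq_1[OF k1 \<open>m \<le> M\<close>]) (rule that)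
  have "(\<Sum>x\<in>{m..M}. Bf j x * (\<phi> x / sqrt (pmf p x))) = 1" if "j \<in> Sk" for j
  proof -
    have "(\<Sum>x\<in>{m..M}. Bf j x * (\<phi> x / sqrt (pmf p x))) = (\<Sum>x\<in>{m..M}. \<phi> x * g j x - mean p (g j) * \<phi> x)"
    proof (rule sum.cong[OF refl])
      fix x assume "x \<in> {m..M}"
      then have "pmf p x > 0" using supp by (auto simp: pmf_positive_iff)
      then show "Bf j x * (\<phi> x / sqrt (pmf p x)) = \<phi> x * g j x - mean p (g j) * \<phi> x"
        by (simp add: Bf_def field_simps)
    qed
    also have "\<dots> = nabla k \<phi> j"
      by (simp only: sum_subtractf sum_distrib_left[symmetric] \<phi>(1) mult_zero_right diff_zero nabla_eq_sum[OF that])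
    finally show ?thesis using \<phi>(2) by simp
  qed
  then show ?thesis by (intro exI[of _ "\<lambda>x. \<phi> x / sqrt (pmf p x)"] ballI)
qed

text \<open>A zero variance would make the whole row \<open>Bf j\<close> vanish, contradicting its
  inner product 1 with the vector of \<open>exists_shift\<close>.\<close>

lemma Sigma_pos:
  assumes "j \<in> Sk" shows "Sigma_k k p j j > 0"
proof -
  obtain u where u: "\<And>j. j \<in> Sk \<Longrightarrow> (\<Sum>x\<in>{m..M}. Bf j x * u x) = 1" using exists_shift by blast
  have eq: "Sigma_k k p j j = (\<Sum>x\<in>{m..M}. (Bf j x)\<^sup>2)" by (simp add: Sigma_factor power2_eq_square)
  have "Sigma_k k p j j \<noteq> 0"
  proof
    assume "Sigma_k k p j j = 0"
    then have "\<forall>x\<in>{m..M}. (Bf j x)\<^sup>2 = 0" unfolding eq by (subst (asm) sum_nonneg_eq_0_iff) auto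
    then show False using u[OF assms] by simp
  qed
  moreover have "Sigma_k k p j j \<ge> 0" unfolding eq by (intro sum_nonneg) auto
  ultimately show ?thesis by simp
qed

lemma I0_facts: "finite I0" "I0 \<noteq> {}" "I0 \<subseteq> Sk"
proof -
  show "I0 \<subseteq> Sk" by (auto simp: non_knots_def)
  then show "finite I0" by (rule finite_subset) simp
  have "Min (nabla k (pmf p) ` Sk) \<in> nabla k (pmf p) ` Sk" using mMk by (intro Min_in) auto
  then show "I0 \<noteq> {}" unfolding p_min by (auto simp: non_knots_def)
qed

lemma nabla_p_I0: "j \<in> I0 \<Longrightarrow> nabla k (pmf p) j = 0"
  by (simp add: non_knots_def)

lemma nabla_p_knot:
  assumes "j \<in> Sk - I0" shows "nabla k (pmf p) j > 0"
proof -
  have "0 \<le> nabla k (pmf p) j" unfolding p_min[symmetric] using assms by (intro Min_le) auto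
  moreover have "nabla k (pmf p) j \<noteq> 0" using assms by (auto simp: non_knots_def)
  ultimately show ?thesis by simp
qed

text \<open>The factor 2 lets deviations below \<open>d\<close> keep empirical values at knots above
  \<open>d\<close> and those at non-knots below \<open>d\<close>.\<close>

lemma knots_gap:
  obtains d where "d > 0" "\<And>j. j \<in> Sk - I0 \<Longrightarrow> nabla k (pmf p) j \<ge> 2 * d"
proof
  \<comment> \<open>The element 1 covers the case that every point is a non-knot.\<close>
  let ?S = "insert 1 (nabla k (pmf p) ` (Sk - I0))"
  have "Min ?S > 0" using nabla_p_knot by (subst Min_gr_iff) auto
  then show "Min ?S / 2 > 0" by simp
  fix j assume "j \<in> Sk - I0"
  then have "Min ?S \<le> nabla k (pmf p) j" by (intro Min_le) auto
  then show "nabla k (pmf p) j \<ge> 2 * (Min ?S / 2)" by simp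
qed

section \<open>Consistency of the range, the differences and the covariances\<close>

lemma missing_point:
  assumes "c \<in> {m..M}" shows "rare (\<lambda>n \<omega>. c \<notin> obs n \<omega> ` {1..n})"
proof (rule rare_mono)
  have c: "pmf p c > 0" using assms supp by (auto simp: pmf_positive_iff)
  have mc: "mean p (\<lambda>x. of_bool (x = c)) = pmf p c"
    using assms by (simp add: mean_p of_bool_def if_distrib[of "\<lambda>y. y * _"] cong: if_cong)
  show "rare (\<lambda>n \<omega>. \<bar>sample_mean n (\<lambda>x. of_bool (x = c)) (obs n \<omega>) - mean p (\<lambda>x. of_bool (x = c))\<bar> \<ge> pmf p c)"
    using c by (intro lln[where B=1]) auto
  show "\<forall>\<^sub>F n in sequentially. \<forall>\<omega>\<in>space \<Omega>. c \<notin> obs n \<omega> ` {1..n} \<longrightarrow>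
      pmf p c \<le> \<bar>sample_mean n (\<lambda>x. of_bool (x = c)) (obs n \<omega>) - mean p (\<lambda>x. of_bool (x = c))\<bar>"
  proof (intro always_eventually allI ballI impI)
    fix n \<omega> assume "c \<notin> obs n \<omega> ` {1..n}"
    \<comment> \<open>An unobserved point has empirical frequency 0, hence a deviation of
      \<open>pmf p c\<close>.\<close>
    then have "sample_mean n (\<lambda>x. of_bool (x = c)) (obs n \<omega>) = 0"
      unfolding sample_mean_def by (subst sum.neutral) auto
    then show "pmf p c \<le> \<bar>sample_mean n (\<lambda>x. of_bool (x = c)) (obs n \<omega>) - mean p (\<lambda>x. of_bool (x = c))\<bar>"
      using c by (simp only: mc)
  qed
qed

lemma S_hat_wrong: "rare (\<lambda>n \<omega>. S_hat k n (obs n \<omega>) \<noteq> Sk)"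
proof (rule rare_mono)
  have "m \<in> {m..M}" "M \<in> {m..M}" using mMk by auto
  then show "rare (\<lambda>n \<omega>. (\<exists>i\<in>{1..n}. X n i \<omega> \<notin> {m..M}) \<or> m \<notin> obs n \<omega> ` {1..n} \<or> M \<notin> obs n \<omega> ` {1..n})"
    by (intro rare_disj off_range missing_point)
  show "\<forall>\<^sub>F n in sequentially. \<forall>\<omega>\<in>space \<Omega>. S_hat k n (obs n \<omega>) \<noteq> Sk \<longrightarrow>
      (\<exists>i\<in>{1..n}. X n i \<omega> \<notin> {m..M}) \<or> m \<notin> obs n \<omega> ` {1..n} \<or> M \<notin> obs n \<omega> ` {1..n}"
  proof (intro always_eventually allI ballI impI, rule ccontr)
    fix n \<omega>
    assume ne: "S_hat k n (obs n \<omega>) \<noteq> Sk"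
      and "\<not> ((\<exists>i\<in>{1..n}. X n i \<omega> \<notin> {m..M}) \<or> m \<notin> obs n \<omega> ` {1..n} \<or> M \<notin> obs n \<omega> ` {1..n})"
    then have *: "\<And>x. x \<in> obs n \<omega> ` {1..n} \<Longrightarrow> m \<le> x \<and> x \<le> M" "m \<in> obs n \<omega> ` {1..n}" "M \<in> obs n \<omega> ` {1..n}"
      by auto
    have "Min (obs n \<omega> ` {1..n}) = m" "Max (obs n \<omega> ` {1..n}) = M"
      by (rule Min_eqI Max_eqI; use * in auto)+
    then show False using ne by (simp add: S_hat_def)
  qed
qed

lemma nabla_emp_far:
  assumes "d > 0" shows "rare (\<lambda>n \<omega>. \<exists>j\<in>Sk. \<bar>nabla k (emp_pmf n (obs n \<omega>)) j - nabla k (pmf p) j\<bar> \<ge> d)"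
proof (rule rare_finite_ex)
  fix j assume j: "j \<in> Sk"
  show "rare (\<lambda>n \<omega>. \<bar>nabla k (emp_pmf n (obs n \<omega>)) j - nabla k (pmf p) j\<bar> \<ge> d)"
    unfolding nabla_emp nabla_p[OF j] by (rule lln[OF g_bound assms])
qed simp

lemma emp_cov_far:
  assumes "d > 0"
  shows "rare (\<lambda>n \<omega>. \<exists>i\<in>Sk. \<exists>j\<in>Sk. \<bar>emp_cov k n (obs n \<omega>) i j - Sigma_k k p i j\<bar> \<ge> d)"
proof (intro rare_finite_ex)
  fix i j
  \<comment> \<open>Error budget: \<open>e\<close> for the second moment and at most
    \<open>B0 * e\<close> for each factor of the product of means.\<close>
  define D where "D = 1 + 2 * B0"
  define e where "e = d / (2 * D)"
  have D: "D > 0" by (simp add: D_def add_pos_pos)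
  have e: "e > 0" using assms D by (simp add: e_def)
  have ed: "e + B0 * e + B0 * e < d"
  proof -
    have "e + B0 * e + B0 * e = D * e" by (simp add: D_def algebra_simps)
    also have "\<dots> = d / 2" using D by (simp add: e_def)
    finally show ?thesis using assms by simp
  qed
  define far where "far f n \<omega> \<longleftrightarrow> \<bar>sample_mean n f (obs n \<omega>) - mean p f\<bar> \<ge> e" for f n \<omega>
  have far: "rare (far f)" if "\<And>x. \<bar>f x\<bar> \<le> B" for f B
    unfolding far_def[abs_def] by (rule lln[OF that e])
  show "rare (\<lambda>n \<omega>. \<bar>emp_cov k n (obs n \<omega>) i j - Sigma_k k p i j\<bar> \<ge> d)"
  proof (rule rare_mono)
    show "rare (\<lambda>n \<omega>. far (\<lambda>x. g i x * g j x) n \<omega> \<or> far (g i) n \<omega> \<or> far (g j) n \<omega>)"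
      by (intro rare_disj far[OF g_bound] far[OF gg_bound])
    show "\<forall>\<^sub>F n in sequentially. \<forall>\<omega>\<in>space \<Omega>. d \<le> \<bar>emp_cov k n (obs n \<omega>) i j - Sigma_k k p i j\<bar> \<longrightarrow>
        far (\<lambda>x. g i x * g j x) n \<omega> \<or> far (g i) n \<omega> \<or> far (g j) n \<omega>"
    proof (intro always_eventually allI ballI impI, rule ccontr)
      fix n \<omega>
      define s a b where "s = sample_mean n (\<lambda>x. g i x * g j x) (obs n \<omega>)"
        and "a = sample_mean n (g i) (obs n \<omega>)" and "b = sample_mean n (g j) (obs n \<omega>)"
      define s' a' b' where "s' = mean p (\<lambda>x. g i x * g j x)" and "a' = mean p (g i)" and "b' = mean p (g j)"
      assume d: "d \<le> \<bar>emp_cov k n (obs n \<omega>) i j - Sigma_k k p i j\<bar>"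
        and "\<not> (far (\<lambda>x. g i x * g j x) n \<omega> \<or> far (g i) n \<omega> \<or> far (g j) n \<omega>)"
      then have c: "\<bar>s - s'\<bar> \<le> e" "\<bar>a - a'\<bar> \<le> e" "\<bar>b - b'\<bar> \<le> e"
        unfolding far_def s_def s'_def a_def a'_def b_def b'_def by auto
      have b': "\<bar>b'\<bar> \<le> B0" unfolding b'_def by (rule abs_mean_le[OF g_bound])
      have a: "\<bar>a\<bar> \<le> B0"
      proof (cases "n = 0")
        case False
        have "\<bar>\<Sum>l\<in>{1..n}. g i (X n l \<omega>)\<bar> \<le> (\<Sum>l\<in>{1..n}. B0)"
          by (intro order_trans[OF sum_abs] sum_mono g_bound)
        then show ?thesis using False by (simp add: a_def sample_mean_def abs_divide field_simps)
      qed (simp add: a_def sample_mean_def)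
      \<comment> \<open>Uses \<open>a * b - a' * b' = a * (b - b') + b' * (a - a')\<close>, which
        calls for bounds on \<open>a\<close> and \<open>b'\<close>.\<close>
      have "emp_cov k n (obs n \<omega>) i j - Sigma_k k p i j = (s - s') - a * (b - b') - b' * (a - a')"
        unfolding emp_cov_eq Sigma_eq s_def[symmetric] s'_def[symmetric] a_def[symmetric] a'_def[symmetric]
          b_def[symmetric] b'_def[symmetric] by (simp add: algebra_simps)
      also have "\<bar>\<dots>\<bar> \<le> \<bar>s - s'\<bar> + \<bar>a * (b - b')\<bar> + \<bar>b' * (a - a')\<bar>" by linarith
      also have "\<dots> \<le> e + B0 * e + B0 * e"
        unfolding abs_mult using c a b' e by (intro add_mono mult_mono) auto
      finally show False using d ed by linarith
    qed
  qed
qed simp_all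

text \<open>At a non-knot the mean is nonpositive by contiguity, and exclusion means crossing a
  level of order at least \<open>sqrt (ln n)\<close>; at a knot the statistic grows like
  \<open>sqrt n\<close>, while the critical level is at most of order
  \<open>n powr (1 / 4)\<close>.\<close>

lemma I0_hat_wrong: "rare (\<lambda>n \<omega>. I0_hat k n (obs n \<omega>) \<noteq> I0)"
proof -
  define z where "z n = quantile (1 - 1 / real n) std_normal_distribution" for n :: nat
  define C where "C j = Sigma_k k p j j" for j
  define nab where "nab n \<omega> j = nabla k (emp_pmf n (obs n \<omega>)) j" for n \<omega> j
  define sel where "sel n \<omega> j \<longleftrightarrow> (if sigma_hat k n (obs n \<omega>) j = 0
      then sqrt n * nab n \<omega> j \<le> z n * sigma_hat k n (obs n \<omega>) j
      else sqrt n * nab n \<omega> j / sigma_hat k n (obs n \<omega>) j \<le> z n)" for n \<omega> j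
  have I0_hat: "I0_hat k n (obs n \<omega>) = {j \<in> S_hat k n (obs n \<omega>). sel n \<omega> j}" for n \<omega>
    unfolding I0_hat_def sel_def z_def nab_def Let_def ..
  have wrong: "rare (\<lambda>n \<omega>. sel n \<omega> j \<noteq> (j \<in> I0))" if j: "j \<in> Sk" for j
  proof -
    have C: "C j > 0" unfolding C_def by (rule Sigma_pos[OF j])
    \<comment> \<open>The tolerance \<open>C j / 9\<close> yields the factor 8/9, and 8/9 times 3/2
      is the constant 4/3 of \<open>upper_tail\<close>. It also keeps the estimated deviation
      positive, so the zero branch of the selection rule does not occur.\<close>
    have far: "rare (\<lambda>n \<omega>. \<exists>i\<in>Sk. \<exists>l\<in>Sk. \<bar>emp_cov k n (obs n \<omega>) i l - Sigma_k k p i l\<bar> \<ge> C j / 9)"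
      by (rule emp_cov_far) (use C in simp)
    have cov: "8 / 9 * C j \<le> emp_cov k n (obs n \<omega>) j j \<and> emp_cov k n (obs n \<omega>) j j \<le> 2 * C j"
      if "\<not> (\<exists>i\<in>Sk. \<exists>l\<in>Sk. \<bar>emp_cov k n (obs n \<omega>) i l - Sigma_k k p i l\<bar> \<ge> C j / 9)" for n \<omega>
    proof -
      have "\<bar>emp_cov k n (obs n \<omega>) j j - C j\<bar> < C j / 9" using that j unfolding C_def by force
      then show ?thesis using C by linarith
    qed
    show ?thesis
    proof (cases "j \<in> I0")
      case True
      \<comment> \<open>At a non-knot the mean vanishes under \<open>p\<close>, so the variance is
        the second moment that \<open>upper_tail\<close> works with.\<close>
      have m0: "mean p (g j) = 0" using nabla_p[OF j] nabla_p_I0[OF True] by simp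
      have C2: "mean p (\<lambda>x. (g j x)\<^sup>2) = C j" unfolding C_def Sigma_eq m0 by (simp add: power2_eq_square)
      have neg: "\<forall>\<^sub>F n in sequentially. mean (P n) (g j) \<le> 0"
        using mean_P_g
      proof eventually_elim
        case (elim n)
        have "nabla k h j \<le> 0" using contig True by (simp add: contiguous_alternatives_def)
        then show ?case using elim j nabla_p_I0[OF True] by (simp add: divide_nonpos_nonneg)
      qed
      have tail: "rare (\<lambda>n \<omega>. sqrt (4 / 3 * C j * ln n) \<le> sqrt n * nab n \<omega> j)"
        unfolding nab_def nabla_emp by (rule upper_tail[OF g_bound neg C2 C])
      show ?thesis
      proof (rule rare_mono[OF rare_disj[OF far tail]])
        show "\<forall>\<^sub>F n in sequentially. \<forall>\<omega>\<in>space \<Omega>. sel n \<omega> j \<noteq> (j \<in> I0) \<longrightarrow>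
          (\<exists>i\<in>Sk. \<exists>l\<in>Sk. \<bar>emp_cov k n (obs n \<omega>) i l - Sigma_k k p i l\<bar> \<ge> C j / 9) \<or>
          sqrt (4 / 3 * C j * ln n) \<le> sqrt n * nab n \<omega> j"
          using std_normal_quantile_lower eventually_ge_at_top[of 1]
        proof (eventually_elim, intro ballI impI disjCI)
          fix n \<omega>
          assume zl: "sqrt (3 / 2 * ln n) \<le> quantile (1 - 1 / real n) std_normal_distribution" and n: "1 \<le> n"
            and s: "sel n \<omega> j \<noteq> (j \<in> I0)" and t: "\<not> sqrt (4 / 3 * C j * ln n) \<le> sqrt n * nab n \<omega> j"
          show "\<exists>i\<in>Sk. \<exists>l\<in>Sk. \<bar>emp_cov k n (obs n \<omega>) i l - Sigma_k k p i l\<bar> \<ge> C j / 9"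
          proof (rule ccontr)
            assume "\<not> ?thesis"
            from cov[OF this] have cv: "8 / 9 * C j \<le> emp_cov k n (obs n \<omega>) j j" by simp
            define sg where "sg = sigma_hat k n (obs n \<omega>) j"
            have sg: "sqrt (8 / 9 * C j) \<le> sg" unfolding sg_def sigma_hat_def using cv by simp
            then have sg0: "sg > 0" using C by (smt (verit) real_sqrt_gt_0_iff mult_pos_pos zero_less_divide_iff)
            have "sqrt (4 / 3 * C j * ln n) = sqrt (8 / 9 * C j) * sqrt (3 / 2 * ln n)"
              by (simp add: real_sqrt_mult[symmetric])
            also have "\<dots> \<le> sg * z n" using sg sg0 zl n unfolding z_def by (intro mult_mono) auto
            finally have "sqrt n * nab n \<omega> j \<le> sg * z n" using t by simp
            then have "sqrt n * nab n \<omega> j / sg \<le> z n"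
              by (simp only: pos_divide_le_eq[OF sg0] mult.commute[of "z n"])
            then have "sel n \<omega> j" unfolding sel_def sg_def[symmetric] using sg0 by simp
            then show False using s True by simp
          qed
        qed
      qed
    next
      case False
      define c where "c = nabla k (pmf p) j"
      have c: "c > 0" unfolding c_def using nabla_p_knot j False by simp
      have far2: "rare (\<lambda>n \<omega>. \<exists>l\<in>Sk. \<bar>nab n \<omega> l - nabla k (pmf p) l\<bar> \<ge> c / 2)"
        unfolding nab_def by (rule nabla_emp_far) (use c in simp)
      have growth: "\<forall>\<^sub>F n in sequentially. sqrt (2 * C j) * (3 * real n) powr (1 / 4) < sqrt (real n) * (c / 2)"
        using c C by real_asymp
      show ?thesis
      proof (rule rare_mono[OF rare_disj[OF far far2]])
        show "\<forall>\<^sub>F n in sequentially. \<forall>\<omega>\<in>space \<Omega>. sel n \<omega> j \<noteq> (j \<in> I0) \<longrightarrow>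
          (\<exists>i\<in>Sk. \<exists>l\<in>Sk. \<bar>emp_cov k n (obs n \<omega>) i l - Sigma_k k p i l\<bar> \<ge> C j / 9) \<or>
          (\<exists>l\<in>Sk. \<bar>nab n \<omega> l - nabla k (pmf p) l\<bar> \<ge> c / 2)"
          using std_normal_quantile_upper growth eventually_ge_at_top[of 1]
        proof (eventually_elim, intro ballI impI disjCI)
          fix n \<omega>
          assume zu: "quantile (1 - 1 / real n) std_normal_distribution \<le> real (3 * n) powr (1 / 4)"
            and gr: "sqrt (2 * C j) * (3 * real n) powr (1 / 4) < sqrt (real n) * (c / 2)" and n: "1 \<le> n"
            and s: "sel n \<omega> j \<noteq> (j \<in> I0)" and t: "\<not> (\<exists>l\<in>Sk. \<bar>nab n \<omega> l - nabla k (pmf p) l\<bar> \<ge> c / 2)"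
          show "\<exists>i\<in>Sk. \<exists>l\<in>Sk. \<bar>emp_cov k n (obs n \<omega>) i l - Sigma_k k p i l\<bar> \<ge> C j / 9"
          proof (rule ccontr)
            assume "\<not> ?thesis"
            from cov[OF this] have cv: "8 / 9 * C j \<le> emp_cov k n (obs n \<omega>) j j" "emp_cov k n (obs n \<omega>) j j \<le> 2 * C j"
              by simp_all
            define sg where "sg = sigma_hat k n (obs n \<omega>) j"
            have sg: "sg \<le> sqrt (2 * C j)" unfolding sg_def sigma_hat_def using cv by simp
            have "emp_cov k n (obs n \<omega>) j j > 0" using cv C by linarith
            then have sg0: "sg > 0" unfolding sg_def sigma_hat_def by simp
            have "\<bar>nab n \<omega> j - c\<bar> < c / 2" using t j unfolding c_def by force
            then have "c / 2 \<le> nab n \<omega> j" by linarith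
            then have "sqrt n * (c / 2) \<le> sqrt n * nab n \<omega> j" by (intro mult_left_mono) auto
            moreover have "sel n \<omega> j" using s False by simp
            then have "sqrt n * nab n \<omega> j / sg \<le> z n"
              unfolding sel_def sg_def[symmetric] using sg0 by simp
            then have "sqrt n * nab n \<omega> j \<le> sg * z n"
              by (simp only: pos_divide_le_eq[OF sg0] mult.commute[of "z n"])
            moreover have "sg * z n \<le> sg * (3 * real n) powr (1 / 4)"
              using sg0 zu unfolding z_def by (intro mult_left_mono) auto
            moreover have "\<dots> \<le> sqrt (2 * C j) * (3 * real n) powr (1 / 4)"
              using sg by (intro mult_right_mono) auto
            ultimately show False using gr by linarith
          qed
        qed
      qed
    qed
  qed
  have "rare (\<lambda>n \<omega>. \<exists>j\<in>Sk. sel n \<omega> j \<noteq> (j \<in> I0))"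
    by (rule rare_finite_ex[OF _ wrong]) auto
  from rare_disj[OF S_hat_wrong this] show ?thesis
  proof (rule rare_mono)
    show "\<forall>\<^sub>F n in sequentially. \<forall>\<omega>\<in>space \<Omega>. I0_hat k n (obs n \<omega>) \<noteq> I0 \<longrightarrow>
        S_hat k n (obs n \<omega>) \<noteq> Sk \<or> (\<exists>j\<in>Sk. sel n \<omega> j \<noteq> (j \<in> I0))"
    proof (intro always_eventually allI ballI impI, rule ccontr)
      fix n \<omega>
      assume ne: "I0_hat k n (obs n \<omega>) \<noteq> I0"
        and "\<not> (S_hat k n (obs n \<omega>) \<noteq> Sk \<or> (\<exists>j\<in>Sk. sel n \<omega> j \<noteq> (j \<in> I0)))"
      then have "S_hat k n (obs n \<omega>) = Sk" "\<And>j. j \<in> Sk \<Longrightarrow> sel n \<omega> j = (j \<in> I0)" by blast+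
      then have "I0_hat k n (obs n \<omega>) = {j \<in> Sk. j \<in> I0}" unfolding I0_hat by (simp only: cong: conj_cong)
      also have "\<dots> = I0" using I0_facts(3) by blast
      finally show False using ne by contradiction
    qed
  qed
qed

end

section \<open>Limit laws and power\<close>

context test_setting
begin

abbreviation "Wn c n \<omega> \<equiv> Min ((\<lambda>j. dev n (g j) \<omega> + c j) ` I0)"

lemma Wn_meas: "Wn c n \<in> borel_measurable \<Omega>"
  using I0_facts(1) dev_meas by measurable

text \<open>Values at knots converge to positive limits, so eventually the minimum is attained among
  the non-knots, where only \<open>nabla k h j / sqrt n\<close> is left.\<close>

lemma min_P: "\<forall>\<^sub>F n in sequentially. Min (nabla k (pmf (P n)) ` Sk) = - \<delta> / sqrt (real n)"
proof -
  have hmin: "Min (nabla k h ` I0) = - \<delta>" and "\<delta> > 0"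
    using contig by (auto simp: contiguous_alternatives_def)
  have knots: "\<forall>\<^sub>F n in sequentially. \<forall>j\<in>Sk - I0. 0 < nabla k (pmf p) j + nabla k h j / sqrt (real n)"
  proof (intro eventually_ball_finite ballI)
    fix j assume "j \<in> Sk - I0"
    then have "nabla k (pmf p) j > 0" by (rule nabla_p_knot)
    moreover have "(\<lambda>n. a + b / sqrt (real n)) \<longlonglongrightarrow> a" for a b :: real by real_asymp
    ultimately show "\<forall>\<^sub>F n in sequentially. 0 < nabla k (pmf p) j + nabla k h j / sqrt (real n)"
      by (intro order_tendstoD) auto
  qed simp
  show ?thesis
    using nabla_P knots
  proof eventually_elim
    case (elim n)
    show ?case
    proof (rule Min_eqI)
      have "- \<delta> \<in> nabla k h ` I0" unfolding hmin[symmetric] using I0_facts by (intro Min_in) auto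
      then obtain j where j: "j \<in> I0" "nabla k h j = - \<delta>" by auto
      then have "nabla k (pmf (P n)) j = - \<delta> / sqrt n"
        using elim(1) I0_facts(3) nabla_p_I0[OF j(1)] by auto
      then show "- \<delta> / sqrt n \<in> nabla k (pmf (P n)) ` Sk" using j I0_facts(3) by (metis imageI subsetD)
      fix y assume "y \<in> nabla k (pmf (P n)) ` Sk"
      then obtain j where j: "j \<in> Sk" "y = nabla k (pmf p) j + nabla k h j / sqrt n" using elim(1) by auto
      show "- \<delta> / sqrt n \<le> y"
      proof (cases "j \<in> I0")
        case True
        then have "- \<delta> \<le> nabla k h j" unfolding hmin[symmetric] using I0_facts by (intro Min_le) auto
        then show ?thesis using j(2) nabla_p_I0[OF True] 
            divide_right_mono[of "- \<delta>" "nabla k h j" "sqrt n"] by simp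
      next
        case False
        then have "0 < y" using elim(2) j by auto
        moreover have "- \<delta> / sqrt n \<le> 0" using \<open>\<delta> > 0\<close> by simp
        ultimately show ?thesis by linarith
      qed
    qed simp
  qed
qed

text \<open>With the gap \<open>d\<close>, the empirical minimum is taken over the non-knots. There
  the mean under \<open>P n\<close> is exactly \<open>nabla k h j / sqrt n\<close>, which after
  scaling becomes the shift.\<close>

lemma T_hat_eq: "rare (\<lambda>n \<omega>. T_hat k n (obs n \<omega>) \<noteq> Wn (nabla k h) n \<omega>)"
proof -
  obtain d where d: "d > 0" "\<And>j. j \<in> Sk - I0 \<Longrightarrow> nabla k (pmf p) j \<ge> 2 * d" by (rule knots_gap) (rule that)
  from rare_disj[OF S_hat_wrong nabla_emp_far[OF d(1)]] show ?thesis
  proof (rule rare_mono)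
    show "\<forall>\<^sub>F n in sequentially. \<forall>\<omega>\<in>space \<Omega>. T_hat k n (obs n \<omega>) \<noteq> Wn (nabla k h) n \<omega> \<longrightarrow>
       S_hat k n (obs n \<omega>) \<noteq> Sk \<or> (\<exists>j\<in>Sk. d \<le> \<bar>nabla k (emp_pmf n (obs n \<omega>)) j - nabla k (pmf p) j\<bar>)"
      using mean_P_g eventually_ge_at_top[of 1]
    proof (rule eventually_elim2, intro ballI impI)
      fix n :: nat and \<omega>
      assume mP: "\<forall>j\<in>Sk. mean (P n) (g j) = nabla k (pmf p) j + nabla k h j / sqrt (real n)" and n: "1 \<le> n"
        and ne: "T_hat k n (obs n \<omega>) \<noteq> Wn (nabla k h) n \<omega>"
      show "S_hat k n (obs n \<omega>) \<noteq> Sk \<or> (\<exists>j\<in>Sk. d \<le> \<bar>nabla k (emp_pmf n (obs n \<omega>)) j - nabla k (pmf p) j\<bar>)"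
      proof (rule ccontr)
        assume good: "\<not> ?thesis"
        define nab where "nab = nabla k (emp_pmf n (obs n \<omega>))"
        have S: "S_hat k n (obs n \<omega>) = Sk" and close: "\<And>j. j \<in> Sk \<Longrightarrow> \<bar>nab j - nabla k (pmf p) j\<bar> < d"
          using good unfolding nab_def by force+
        have Sk_ne: "Sk \<noteq> {}" using mMk by simp
        have "Min (nab ` Sk) = Min (nab ` I0)"
        proof (rule Min_eqI)
          have "Min (nab ` I0) \<in> nab ` I0" using I0_facts by (intro Min_in) auto
          then obtain i where i: "i \<in> I0" "Min (nab ` I0) = nab i" by auto
          then show "Min (nab ` I0) \<in> nab ` Sk" using I0_facts(3) by auto
          fix y assume "y \<in> nab ` Sk"
          then obtain j where j: "j \<in> Sk" "y = nab j" by auto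
          show "Min (nab ` I0) \<le> y"
          proof (cases "j \<in> I0")
            case True
            then show ?thesis using j I0_facts by (intro Min_le) auto
          next
            case False
            have "nab i < d" using close[of i] i(1) I0_facts(3) nabla_p_I0[OF i(1)] by auto
            moreover have "d < nab j" using close[OF j(1)] d(2)[of j] j(1) False by auto
            ultimately show ?thesis using i j by simp
          qed
        qed simp
        then have T: "T_hat k n (obs n \<omega>) = sqrt n * Min (nab ` I0)"
          unfolding T_hat_def rho_hat_def S nab_def[symmetric] using Sk_ne by simp
        also have "\<dots> = Min ((\<lambda>x. sqrt n * x) ` nab ` I0)"
          using I0_facts by (intro mono_Min_commute monoI mult_left_mono) auto
        also have "(\<lambda>x. sqrt n * x) ` nab ` I0 = (\<lambda>j. dev n (g j) \<omega> + nabla k h j) ` I0"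
          unfolding image_image
        proof (rule image_cong[OF refl])
          fix j assume j: "j \<in> I0"
          have "mean (P n) (g j) = nabla k h j / sqrt n" using mP j I0_facts(3) nabla_p_I0[OF j] by auto
          then show "sqrt n * nab j = dev n (g j) \<omega> + nabla k h j"
            unfolding dev_def nab_def nabla_emp using n by (simp add: right_diff_distrib)
        qed
        finally show False using ne by simp
      qed
    qed
  qed
qed

text \<open>Matches the variance in \<open>clt_char\<close> with the quadratic form in
  \<open>gaussian_char\<close>; the absolute value is harmless because the form is a
  variance.\<close>

lemma variance_lin:
  fixes a :: "int \<Rightarrow> real"
  defines "f \<equiv> \<lambda>x. \<Sum>j\<in>I0. a j * g j x"
  shows "mean p (\<lambda>x. (f x)\<^sup>2) - (mean p f)\<^sup>2 = \<bar>\<Sum>i\<in>I0. \<Sum>j\<in>I0. a i * a j * Sigma_k k p i j\<bar>"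
    and "\<And>x. \<bar>f x\<bar> \<le> (\<Sum>j\<in>I0. \<bar>a j\<bar> * B0)"
proof -
  show fb: "\<bar>f x\<bar> \<le> (\<Sum>j\<in>I0. \<bar>a j\<bar> * B0)" for x
    unfolding f_def by (rule order_trans[OF sum_abs]) (auto simp: abs_mult intro!: sum_mono mult_left_mono g_bound)
  have ig: "integrable p (g j)" "integrable p (\<lambda>x. g i x * g j x)" for i j
    by (rule integrable_pmf_bounded, rule g_bound gg_bound)+
  have "mean p f = (\<Sum>j\<in>I0. a j * mean p (g j))" unfolding f_def using ig by simp
  then have m2: "(mean p f)\<^sup>2 = (\<Sum>i\<in>I0. \<Sum>j\<in>I0. a i * a j * (mean p (g i) * mean p (g j)))"
    by (simp add: power2_eq_square sum_product mult_ac)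
  have "(f x)\<^sup>2 = (\<Sum>i\<in>I0. \<Sum>j\<in>I0. a i * a j * (g i x * g j x))" for x
    unfolding f_def by (simp add: power2_eq_square sum_product mult_ac)
  then have "mean p (\<lambda>x. (f x)\<^sup>2) = (\<Sum>i\<in>I0. \<Sum>j\<in>I0. a i * a j * mean p (\<lambda>x. g i x * g j x))"
    using ig by simp
  then have "mean p (\<lambda>x. (f x)\<^sup>2) - (mean p f)\<^sup>2 = (\<Sum>i\<in>I0. \<Sum>j\<in>I0. a i * a j * Sigma_k k p i j)"
    unfolding m2 Sigma_eq by (simp add: right_diff_distrib sum_subtractf)
  moreover have "mean p (\<lambda>x. (f x)\<^sup>2) - (mean p f)\<^sup>2 \<ge> 0"
  proof -
    have "mean p (\<lambda>x. (f x)\<^sup>2) - (mean p f)\<^sup>2 = measure_pmf.variance p f"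
      using power2_le_of_abs_le[OF fb] fb
      by (intro measure_pmf.variance_eq[symmetric] integrable_pmf_bounded[of f "\<Sum>j\<in>I0. \<bar>a j\<bar> * B0"]
          integrable_pmf_bounded[of _ "(\<Sum>j\<in>I0. \<bar>a j\<bar> * B0)\<^sup>2"]) auto
    then show ?thesis by (simp add: measure_pmf.variance_positive)
  qed
  ultimately show "mean p (\<lambda>x. (f x)\<^sup>2) - (mean p f)\<^sup>2 = \<bar>\<Sum>i\<in>I0. \<Sum>j\<in>I0. a i * a j * Sigma_k k p i j\<bar>"
    by simp
qed

text \<open>Outside a rare event the variables coincide, so the distribution functions differ by at
  most \<open>C / sqrt n\<close> at every point.\<close>

lemma weak_conv_transfer:
  assumes U: "\<And>n. U n \<in> borel_measurable \<Omega>" and V: "\<And>n. V n \<in> borel_measurable \<Omega>"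
    and eq: "rare (\<lambda>n \<omega>. U n \<omega> \<noteq> V n \<omega>)" and conv: "weak_conv_m (\<lambda>n. distr \<Omega> borel (V n)) D"
  shows "weak_conv_m (\<lambda>n. distr \<Omega> borel (U n)) D"
  unfolding weak_conv_m_def weak_conv_def
proof (intro allI impI)
  fix t assume "isCont (cdf D) t"
  then have Vt: "(\<lambda>n. cdf (distr \<Omega> borel (V n)) t) \<longlonglongrightarrow> cdf D t"
    using conv by (simp add: weak_conv_m_def weak_conv_def)
  obtain C where C: "\<forall>\<^sub>F n in sequentially. \<forall>A B. A \<in> events \<longrightarrow> B \<in> events \<longrightarrow>
    (\<forall>\<omega>\<in>A. \<omega> \<in> B \<or> U n \<omega> \<noteq> V n \<omega>) \<longrightarrow> prob A \<le> prob B + C / sqrt (real n)"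
    using rare_prob_le[OF eq] .
  have cdf: "cdf (distr \<Omega> borel Y) t = prob {\<omega> \<in> space \<Omega>. Y \<omega> \<le> t}" if "Y \<in> borel_measurable \<Omega>" for Y
    using that unfolding cdf_def by (subst measure_distr) (auto intro!: arg_cong[where f=prob])
  have "\<forall>\<^sub>F n in sequentially. norm (cdf (distr \<Omega> borel (U n)) t - cdf (distr \<Omega> borel (V n)) t) \<le> C / sqrt n"
    using C
  proof eventually_elim
    case (elim n)
    let ?A = "{\<omega> \<in> space \<Omega>. U n \<omega> \<le> t}" and ?B = "{\<omega> \<in> space \<Omega>. V n \<omega> \<le> t}"
    have "?A \<in> events" "?B \<in> events" using U[of n] V[of n] by measurable
    moreover have "\<forall>\<omega>\<in>?A. \<omega> \<in> ?B \<or> U n \<omega> \<noteq> V n \<omega>" "\<forall>\<omega>\<in>?B. \<omega> \<in> ?A \<or> U n \<omega> \<noteq> V n \<omega>" by auto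
    ultimately have "prob ?A \<le> prob ?B + C / sqrt n" "prob ?B \<le> prob ?A + C / sqrt n"
      using elim by blast+
    then show ?case by (simp add: cdf[OF U] cdf[OF V] abs_le_iff)
  qed
  moreover have "(\<lambda>n. C / sqrt (real n)) \<longlonglongrightarrow> 0" by real_asymp
  ultimately have "(\<lambda>n. cdf (distr \<Omega> borel (U n)) t - cdf (distr \<Omega> borel (V n)) t) \<longlonglongrightarrow> 0"
    by (rule Lim_null_comparison)
  from tendsto_add[OF this Vt] show "(\<lambda>n. cdf (distr \<Omega> borel (U n)) t) \<longlonglongrightarrow> cdf D t" by simp
qed

text \<open>Supplies the dependence on finitely many coordinates that
  \<open>sample_pred_meas\<close> asks for.\<close>

lemma sample_cong:
  assumes "\<And>i. i \<in> {1..n} \<Longrightarrow> x i = y i"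
  shows "rho_hat k n x = rho_hat k n y" "I0_hat k n x = I0_hat k n y"
proof -
  have sums: "(\<Sum>l\<in>{1..n}. f (x l)) = (\<Sum>l\<in>{1..n}. f (y l))" for f :: "int \<Rightarrow> real"
    by (rule sum.cong) (simp_all only: assms)
  have "x ` {1..n} = y ` {1..n}" by (rule image_cong[OF refl assms])
  then have S: "S_hat k n x = S_hat k n y" by (simp only: S_hat_def)
  have emp: "emp_pmf n x = emp_pmf n y"
    by (rule ext) (simp only: emp_pmf_def sums[of "\<lambda>v. of_bool (v = _)"])
  have "emp_cov k n x i j = emp_cov k n y i j" for i j
    by (simp only: emp_cov_def emp sums[of "\<lambda>v. nabla_ind k v i * nabla_ind k v j"])
  then have sg: "sigma_hat k n x = sigma_hat k n y" by (intro ext) (simp only: sigma_hat_def)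
  show "rho_hat k n x = rho_hat k n y" by (simp only: rho_hat_def S emp)
  show "I0_hat k n x = I0_hat k n y" by (simp only: I0_hat_def S emp sg)
qed

end

section \<open>Conditionally Gaussian critical values and power\<close>

locale test_setting_gaussian = test_setting \<Omega> X P m M p h k \<delta>
  for \<Omega> :: "'a measure" and X P m M p h k \<delta> +
  fixes Zh :: "nat \<Rightarrow> int \<Rightarrow> 'a \<Rightarrow> real" and N :: "'b measure" and Z :: "int \<Rightarrow> 'b \<Rightarrow> real"
  assumes cond_gauss: "conditionally_gaussian k m M \<Omega> X Zh"
    and Z_gauss: "centred_gaussian N Sk Z (Sigma_k k p)"
begin

lemma Z_I0: "centred_gaussian N I0 Z (Sigma_k k p)"
  by (rule gaussian_subset[OF Z_gauss _ I0_facts(3)]) simp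

lemma Sigma_I0: "j \<in> I0 \<Longrightarrow> Sigma_k k p j j \<noteq> 0"
  using Sigma_pos I0_facts(3) by force

lemma N_prob: "prob_space N"
  using Z_gauss by (simp add: centred_gaussian_def)

lemma Z_meas: "j \<in> I0 \<Longrightarrow> Z j \<in> borel_measurable N"
  using Z_I0 by (simp add: centred_gaussian_def)

text \<open>The shift \<open>c\<close> is free: \<open>nabla k h j + \<delta>\<close> gives the
  limit law of the centred statistic, and 0 gives the limit in the power bound.\<close>

lemma Wn_conv: "weak_conv_m (\<lambda>n. distr \<Omega> borel (Wn c n)) (distr N borel (\<lambda>\<omega>. Min ((\<lambda>j. Z j \<omega> + c j) ` I0)))"
proof -
  define K where "K = (2 * B0)\<^sup>2 + (\<Sum>j\<in>I0. \<bar>Sigma_k k p j j\<bar>)"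
  show ?thesis
  proof (rule weak_conv_Min[OF I0_facts(1,2) _ N_prob])
    show "prob_space \<Omega>" by (rule prob_space_axioms)
    show "dev n (g i) \<in> borel_measurable \<Omega>" for n i by (rule dev_meas)
    show "Z i \<in> borel_measurable N" if "i \<in> I0" for i using that by (rule Z_meas)
    show "integrable \<Omega> (\<lambda>\<omega>. (dev n (g i) \<omega>)\<^sup>2)" for n i by (rule dev_second_moment(1)[OF g_bound])
    show "expectation (\<lambda>\<omega>. (dev n (g i) \<omega>)\<^sup>2) \<le> K" for n i
      using dev_second_moment(2)[where f="g i" and n=n, OF g_bound] unfolding K_def
      by (rule order_trans) (auto intro: sum_nonneg)
    show "integrable N (\<lambda>\<omega>. (Z i \<omega>)\<^sup>2)" if "i \<in> I0" for i
      by (rule gaussian_second_moment(1)[OF Z_I0 I0_facts(1) that])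
    show "(\<integral>\<omega>. (Z i \<omega>)\<^sup>2 \<partial>N) \<le> K" if "i \<in> I0" for i
    proof -
      have "\<bar>Sigma_k k p i i\<bar> \<le> (\<Sum>j\<in>I0. \<bar>Sigma_k k p j j\<bar>)" using that I0_facts(1) by (intro member_le_sum) auto
      then show ?thesis
        unfolding gaussian_second_moment(2)[OF Z_I0 I0_facts(1) that] K_def by (simp add: add_increasing)
    qed
    fix a :: "int \<Rightarrow> real"
    show "(\<lambda>n. char (distr \<Omega> borel (\<lambda>\<omega>. \<Sum>i\<in>I0. a i * dev n (g i) \<omega>)) 1)
        \<longlonglongrightarrow> char (distr N borel (\<lambda>\<omega>. \<Sum>i\<in>I0. a i * Z i \<omega>)) 1"
      unfolding gaussian_char[OF Z_I0 I0_facts(1)] dev_linear[OF I0_facts(1) g_bound]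
      using clt_char[where f="\<lambda>x. \<Sum>j\<in>I0. a j * g j x", OF variance_lin(2)] unfolding variance_lin(1) by simp
  qed
qed

abbreviation "F \<equiv> cdf (distr N borel (\<lambda>\<omega>. Min ((\<lambda>j. Z j \<omega>) ` I0)))"

lemma W_meas: "(\<lambda>\<omega>. Min ((\<lambda>j. Z j \<omega>) ` I0)) \<in> borel_measurable N"
  using I0_facts(1) Z_meas by measurable

lemma F_eq: "F t = measure N {\<omega> \<in> space N. Min ((\<lambda>j. Z j \<omega>) ` I0) \<le> t}"
  using W_meas unfolding cdf_def by (subst measure_distr) (auto intro!: arg_cong[where f="measure N"])

lemma F_cont: "isCont F t"
  using gaussian_Min_cdf_cont[OF Z_I0 I0_facts(1,2) Sigma_I0, where c="\<lambda>_. 0"] by simp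

lemma F_strict: assumes "s < t" shows "F s < F t"
proof -
  obtain u where "\<forall>j\<in>Sk. (\<Sum>x\<in>{m..M}. Bf j x * u x) = 1" using exists_shift ..
  then have u: "(\<Sum>x\<in>{m..M}. Bf j x * u x) = 1" if "j \<in> I0" for j using that I0_facts(3) by blast
  show ?thesis
    by (rule gaussian_Min_cdf_strict[where A="{m..M}", OF Z_I0 I0_facts(1,2) _ Sigma_factor Sigma_I0 u assms]) simp_all
qed

lemma F_quantile: assumes "\<alpha> < 1"
  shows "\<alpha> \<le> F (quantile \<alpha> (distr N borel (\<lambda>\<omega>. Min ((\<lambda>j. Z j \<omega>) ` I0))))"
  by (rule real_distribution.cdf_quantile_ge[OF prob_space.real_distribution_distr[OF N_prob W_meas] assms])

theorem limit_distribution: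
  "weak_conv_m
     (\<lambda>n. distr \<Omega> borel (\<lambda>\<omega>. sqrt (real n) *
        (rho_hat k n (obs n \<omega>) - Min (nabla k (pmf (P n)) ` Sk))))
     (distr N borel (\<lambda>\<omega>. Min ((\<lambda>j. Z j \<omega> + nabla k h j) ` I0) + \<delta>))"
proof -
  \<comment> \<open>A common constant moves through the minimum, so the centring by
    \<open>- \<delta> / sqrt n\<close> becomes part of the shift.\<close>
  let ?c = "\<lambda>j. nabla k h j + \<delta>"
  have shift: "Min ((\<lambda>j. v j + ?c j) ` I0) = Min ((\<lambda>j. v j + nabla k h j) ` I0) + \<delta>" for v :: "int \<Rightarrow> real"
  proof -
    have "Min ((\<lambda>j. v j + nabla k h j) ` I0) + \<delta> = Min ((\<lambda>y. y + \<delta>) ` (\<lambda>j. v j + nabla k h j) ` I0)"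
      using I0_facts by (intro mono_Min_commute monoI) auto
    then show ?thesis by (simp add: image_image add.assoc)
  qed
  have "weak_conv_m (\<lambda>n. distr \<Omega> borel (Wn ?c n)) (distr N borel (\<lambda>\<omega>. Min ((\<lambda>j. Z j \<omega> + ?c j) ` I0)))"
    by (rule Wn_conv)
  then have conv: "weak_conv_m (\<lambda>n. distr \<Omega> borel (Wn ?c n))
      (distr N borel (\<lambda>\<omega>. Min ((\<lambda>j. Z j \<omega> + nabla k h j) ` I0) + \<delta>))"
    by (simp only: shift)
  let ?U = "\<lambda>n \<omega>. sqrt (real n) * (rho_hat k n (obs n \<omega>) - Min (nabla k (pmf (P n)) ` Sk))"
  show ?thesis
  proof (rule weak_conv_transfer[OF _ Wn_meas _ conv])
    show "?U n \<in> borel_measurable \<Omega>" for n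
      unfolding borel_measurable_iff_le
    proof
      fix a
      show "{\<omega> \<in> space \<Omega>. ?U n \<omega> \<le> a} \<in> events"
      proof (rule sample_pred_meas[where Q="\<lambda>x. sqrt (real n) * (rho_hat k n x - Min (nabla k (pmf (P n)) ` Sk)) \<le> a"])
        fix x y :: "nat \<Rightarrow> int" assume "\<And>i. i \<in> {1..n} \<Longrightarrow> x i = y i"
        then have "rho_hat k n x = rho_hat k n y" by (rule sample_cong)
        then show "(sqrt (real n) * (rho_hat k n x - Min (nabla k (pmf (P n)) ` Sk)) \<le> a)
            = (sqrt (real n) * (rho_hat k n y - Min (nabla k (pmf (P n)) ` Sk)) \<le> a)" by (simp only:)
      qed
    qed
    show "rare (\<lambda>n \<omega>. ?U n \<omega> \<noteq> Wn ?c n \<omega>)"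
    proof (rule rare_mono[OF T_hat_eq])
      show "\<forall>\<^sub>F n in sequentially. \<forall>\<omega>\<in>space \<Omega>. ?U n \<omega> \<noteq> Wn ?c n \<omega> \<longrightarrow> T_hat k n (obs n \<omega>) \<noteq> Wn (nabla k h) n \<omega>"
        using min_P eventually_ge_at_top[of 1]
      proof eventually_elim
        case (elim n)
        have "?U n \<omega> = T_hat k n (obs n \<omega>) + \<delta>" for \<omega>
          unfolding elim(1) T_hat_def using elim(2) by (simp add: distrib_left)
        then show ?case by (simp only: shift) simp
      qed
    qed
  qed
qed

text \<open>Off a rare event the selected set is \<open>I0\<close>, the sample has positive
  probability, and the conditional law is Gaussian with covariance close to \<open>Sigma_k\<close>;
  quantile stability then applies.\<close>

lemma t_hat_lower:
  assumes \<alpha>: "0 < \<alpha>" "\<alpha> < 1" and s: "s < quantile \<alpha> (distr N borel (\<lambda>\<omega>. Min ((\<lambda>j. Z j \<omega>) ` I0)))"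
  shows "rare (\<lambda>n \<omega>. t_hat \<Omega> n (X n) (Zh n) \<alpha> (I0_hat k n (obs n \<omega>)) \<omega> < s)"
proof -
  obtain d where d: "d > 0" "\<forall>(Q :: 'a measure) Y D. centred_gaussian Q I0 Y D \<longrightarrow>
      (\<forall>i\<in>I0. \<forall>j\<in>I0. \<bar>D i j - Sigma_k k p i j\<bar> < d) \<longrightarrow>
      s \<le> quantile \<alpha> (distr Q borel (\<lambda>\<omega>. Min ((\<lambda>j. Y j \<omega>) ` I0)))"
    using gaussian_Min_quantile_lower[where ?'a='a, OF Z_I0 I0_facts(1,2) Sigma_I0 \<alpha> s] by auto
  from rare_disj[OF I0_hat_wrong rare_disj[OF null_samples emp_cov_far[OF d(1)]]] show ?thesis
  proof (rule rare_mono)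
    show "\<forall>\<^sub>F n in sequentially. \<forall>\<omega>\<in>space \<Omega>. t_hat \<Omega> n (X n) (Zh n) \<alpha> (I0_hat k n (obs n \<omega>)) \<omega> < s \<longrightarrow>
       I0_hat k n (obs n \<omega>) \<noteq> I0 \<or> prob (sample_event \<Omega> n (X n) (obs n \<omega>)) = 0 \<or>
       (\<exists>i\<in>Sk. \<exists>j\<in>Sk. d \<le> \<bar>emp_cov k n (obs n \<omega>) i j - Sigma_k k p i j\<bar>)"
      using eventually_ge_at_top[of 1]
    proof (rule eventually_mono, intro ballI impI)
      fix n :: nat and \<omega>
      assume n: "1 \<le> n" and less: "t_hat \<Omega> n (X n) (Zh n) \<alpha> (I0_hat k n (obs n \<omega>)) \<omega> < s"
      show "I0_hat k n (obs n \<omega>) \<noteq> I0 \<or> prob (sample_event \<Omega> n (X n) (obs n \<omega>)) = 0 \<or>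
          (\<exists>i\<in>Sk. \<exists>j\<in>Sk. d \<le> \<bar>emp_cov k n (obs n \<omega>) i j - Sigma_k k p i j\<bar>)"
      proof (rule ccontr)
        assume good: "\<not> ?thesis"
        have I0h: "I0_hat k n (obs n \<omega>) = I0" using good by simp
        have "prob (sample_event \<Omega> n (X n) (obs n \<omega>)) > 0"
          using good measure_nonneg[of \<Omega> "sample_event \<Omega> n (X n) (obs n \<omega>)"] by linarith
        then have "centred_gaussian (given_sample \<Omega> n (X n) (obs n \<omega>)) Sk (Zh n) (emp_cov k n (obs n \<omega>))"
          using cond_gauss n unfolding conditionally_gaussian_def by blast
        then have "centred_gaussian (given_sample \<Omega> n (X n) (obs n \<omega>)) I0 (Zh n) (emp_cov k n (obs n \<omega>))"
          by (rule gaussian_subset) (use I0_facts in auto)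
        moreover have "\<forall>i\<in>I0. \<forall>j\<in>I0. \<bar>emp_cov k n (obs n \<omega>) i j - Sigma_k k p i j\<bar> < d"
        proof (intro ballI)
          fix i j assume "i \<in> I0" "j \<in> I0"
          then have "i \<in> Sk" "j \<in> Sk" using I0_facts(3) by auto
          then show "\<bar>emp_cov k n (obs n \<omega>) i j - Sigma_k k p i j\<bar> < d" using good by force
        qed
        ultimately have "s \<le> quantile \<alpha> (distr (given_sample \<Omega> n (X n) (obs n \<omega>)) borel (\<lambda>\<omega>. Min ((\<lambda>j. Zh n j \<omega>) ` I0)))"
          using d(2) by blast
        then show False using less I0_facts(2) unfolding t_hat_def I0h by simp
      qed
    qed
  qed
qed

text \<open>The critical value is a function of the sample alone, so the event is a property of a
  discrete sample.\<close>

lemma power_event_meas: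
  "{\<omega> \<in> space \<Omega>. T_hat k n (obs n \<omega>) < t_hat \<Omega> n (X n) (Zh n) \<alpha> (I0_hat k n (obs n \<omega>)) \<omega>} \<in> events"
proof -
  define q where "q x = (if I0_hat k n x = {} then 0
      else quantile \<alpha> (distr (given_sample \<Omega> n (X n) x) borel (\<lambda>\<omega>'. Min ((\<lambda>j. Zh n j \<omega>') ` I0_hat k n x))))" for x
  have q_cong: "q x = q y" if "\<And>i. i \<in> {1..n} \<Longrightarrow> x i = y i" for x y
  proof -
    have "sample_event \<Omega> n (X n) x = sample_event \<Omega> n (X n) y"
      using that by (auto simp: sample_event_def)
    moreover have "I0_hat k n x = I0_hat k n y" by (rule sample_cong) (rule that)
    ultimately show ?thesis by (simp only: q_def given_sample_def)
  qed
  have "{\<omega> \<in> space \<Omega>. T_hat k n (obs n \<omega>) < q (obs n \<omega>)} \<in> events"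
  proof (rule sample_pred_meas[where Q="\<lambda>x. T_hat k n x < q x"])
    fix x y :: "nat \<Rightarrow> int" assume "\<And>i. i \<in> {1..n} \<Longrightarrow> x i = y i"
    then show "(T_hat k n x < q x) = (T_hat k n y < q y)"
      using sample_cong(1)[of n x y] q_cong[of x y] by (simp only: T_hat_def)
  qed
  then show ?thesis by (simp only: t_hat_def q_def)
qed

text \<open>If the unshifted minimum is at most \<open>s + c\<close>, adding shifts that are at most
  \<open>- c\<close> brings the statistic down to at most \<open>s\<close>, below the critical
  value. The bound for \<open>s < t\<close> passes to \<open>t\<close> by continuity. The choices
  \<open>c = 0\<close> and \<open>c = \<kappa>\<close> give the two power claims.\<close>

theorem power_lower_bound:
  assumes \<alpha>: "0 < \<alpha>" "\<alpha> < 1" and c: "\<And>j. j \<in> I0 \<Longrightarrow> nabla k h j \<le> - c"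
  defines "t \<equiv> quantile \<alpha> (distr N borel (\<lambda>\<omega>. Min ((\<lambda>j. Z j \<omega>) ` I0)))"
  shows "ereal (F (t + c)) \<le> liminf (\<lambda>n. ereal (prob {\<omega> \<in> space \<Omega>.
      T_hat k n (obs n \<omega>) < t_hat \<Omega> n (X n) (Zh n) \<alpha> (I0_hat k n (obs n \<omega>)) \<omega>}))" (is "_ \<le> liminf (\<lambda>n. ereal (prob (?E n)))")
proof -
  have below: "ereal (F (s + c)) \<le> liminf (\<lambda>n. ereal (prob (?E n)))" if "s < t" for s
  proof -
    \<comment> \<open>Two gaps are required: \<open>r < t\<close> for \<open>t_hat_lower\<close>,
      and \<open>s < r\<close> for the strict inequality in the power event.\<close>
    obtain r where r: "s < r" "r < t" using dense \<open>s < t\<close> by blast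
    let ?V = "\<lambda>n. {\<omega> \<in> space \<Omega>. Wn (\<lambda>_. 0) n \<omega> \<le> s + c}"
    have bad: "rare (\<lambda>n \<omega>. T_hat k n (obs n \<omega>) \<noteq> Wn (nabla k h) n \<omega> \<or>
        t_hat \<Omega> n (X n) (Zh n) \<alpha> (I0_hat k n (obs n \<omega>)) \<omega> < r)"
      by (rule rare_disj[OF T_hat_eq t_hat_lower[OF \<alpha>]]) (use r in \<open>simp add: t_def\<close>)
    obtain C where C: "\<forall>\<^sub>F n in sequentially. \<forall>A B. A \<in> events \<longrightarrow> B \<in> events \<longrightarrow>
      (\<forall>\<omega>\<in>A. \<omega> \<in> B \<or> T_hat k n (obs n \<omega>) \<noteq> Wn (nabla k h) n \<omega> \<or>
        t_hat \<Omega> n (X n) (Zh n) \<alpha> (I0_hat k n (obs n \<omega>)) \<omega> < r) \<longrightarrow> prob A \<le> prob B + C / sqrt (real n)"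
      using rare_prob_le[OF bad] .
    have V: "?V n \<in> events" for n using Wn_meas[where c="\<lambda>_. 0" and n=n] by measurable
    have sub: "\<omega> \<in> ?E n \<or> T_hat k n (obs n \<omega>) \<noteq> Wn (nabla k h) n \<omega> \<or>
        t_hat \<Omega> n (X n) (Zh n) \<alpha> (I0_hat k n (obs n \<omega>)) \<omega> < r" if "\<omega> \<in> ?V n" for n \<omega>
    proof (rule ccontr)
      assume not: "\<not> ?thesis"
      \<comment> \<open>A minimiser \<open>j\<close> of the unshifted minimum bounds the shifted one
        from above.\<close>
      have "Wn (\<lambda>_. 0) n \<omega> \<in> (\<lambda>j. dev n (g j) \<omega> + 0) ` I0" using I0_facts by (intro Min_in) auto
      then obtain j where j: "j \<in> I0" "Wn (\<lambda>_. 0) n \<omega> = dev n (g j) \<omega>" by auto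
      have "Wn (nabla k h) n \<omega> \<le> dev n (g j) \<omega> + nabla k h j" using j I0_facts by (intro Min_le) auto
      also have "\<dots> \<le> s" using that j c[OF j(1)] by auto
      finally show False using not r that by auto
    qed
    have "\<forall>\<^sub>F n in sequentially. ereal (prob (?V n) - C / sqrt n) \<le> ereal (prob (?E n))"
      using C
    proof eventually_elim
      case (elim n)
      have "prob (?V n) \<le> prob (?E n) + C / sqrt n"
        by (rule elim[rule_format, OF V power_event_meas sub])
      then show ?case by simp
    qed
    then have le: "liminf (\<lambda>n. ereal (prob (?V n) - C / sqrt n)) \<le> liminf (\<lambda>n. ereal (prob (?E n)))"
      by (rule Liminf_mono)
    have lim: "(\<lambda>n. ereal (prob (?V n) - C / sqrt n)) \<longlonglongrightarrow> ereal (F (s + c))"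
    proof -
      have "(\<lambda>n. cdf (distr \<Omega> borel (Wn (\<lambda>_. 0) n)) (s + c)) \<longlonglongrightarrow> F (s + c)"
        using Wn_conv[where c="\<lambda>_. 0"] F_cont[of "s + c"] by (simp add: weak_conv_m_def weak_conv_def)
      moreover have "cdf (distr \<Omega> borel (Wn (\<lambda>_. 0) n)) (s + c) = prob (?V n)" for n
        using Wn_meas[where c="\<lambda>_. 0" and n=n] unfolding cdf_def
        by (subst measure_distr) (auto intro!: arg_cong[where f=prob])
      moreover have "(\<lambda>n. C / sqrt (real n)) \<longlonglongrightarrow> 0" by real_asymp
      ultimately have "(\<lambda>n. prob (?V n) - C / sqrt n) \<longlonglongrightarrow> F (s + c) - 0"
        by (intro tendsto_diff) simp_all
      then show ?thesis by simp
    qed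
    show ?thesis using le unfolding lim_imp_Liminf[OF sequentially_bot lim] .
  qed
  show ?thesis
  proof (rule tendsto_upperbound)
    have "isCont (\<lambda>s. F (s + c)) t" by (rule isCont_o2[OF _ F_cont]) simp
    then have "((\<lambda>s. F (s + c)) \<longlongrightarrow> F (t + c)) (at_left t)"
      by (simp add: isCont_def filterlim_at_split)
    then show "((\<lambda>s. ereal (F (s + c))) \<longlongrightarrow> ereal (F (t + c))) (at_left t)" by simp
    show "\<forall>\<^sub>F s in at_left t. ereal (F (s + c)) \<le> liminf (\<lambda>n. ereal (prob (?E n)))"
      using below by (intro eventually_at_leftI[of "t - 1"]) auto
  qed simp
qed

end

theorem theorem3:
  fixes k :: nat and m M :: int and p :: "int pmf"
    and P :: "nat \<Rightarrow> int pmf" and h :: "int \<Rightarrow> real" and \<delta> :: real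
    and \<Omega> :: "'a measure" and X :: "nat \<Rightarrow> nat \<Rightarrow> 'a \<Rightarrow> int" and Zh :: "nat \<Rightarrow> int \<Rightarrow> 'a \<Rightarrow> real"
    and N :: "'b measure" and Z :: "int \<Rightarrow> 'b \<Rightarrow> real"
  assumes "k \<ge> 1" and "m \<le> M - int k"
    and "set_pmf p = {m..M}"
    and "Min (nabla k (pmf p) ` {m..M - int k}) = 0"
    and "contiguous_alternatives k m M p h \<delta> P"
    and "prob_space \<Omega>" and "iid_rows \<Omega> X P"
    and "conditionally_gaussian k m M \<Omega> X Zh"
    and "centred_gaussian N {m..M - int k} Z (Sigma_k k p)"
  shows
    "weak_conv_m
       (\<lambda>n. distr \<Omega> borel (\<lambda>\<omega>. sqrt (real n) *
          (rho_hat k n (\<lambda>i. X n i \<omega>) - Min (nabla k (pmf (P n)) ` {m..M - int k}))))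
       (distr N borel (\<lambda>\<omega>. Min ((\<lambda>j. Z j \<omega> + nabla k h j) ` non_knots k m M p) + \<delta>))
     \<and>
     (\<lambda>n. measure \<Omega> {\<omega> \<in> space \<Omega>. I0_hat k n (\<lambda>i. X n i \<omega>) \<noteq> non_knots k m M p})
       \<in> O(\<lambda>n. 1 / sqrt (real n))
     \<and>
     (\<forall>\<alpha>\<in>{0<..<1}.
       let W = (\<lambda>\<omega>. Min ((\<lambda>j. Z j \<omega>) ` non_knots k m M p));
           t = quantile \<alpha> (distr N borel W);
           L = liminf (\<lambda>n. ereal (measure \<Omega> {\<omega> \<in> space \<Omega>.
                 T_hat k n (\<lambda>i. X n i \<omega>)
                   < t_hat \<Omega> n (X n) (Zh n) \<alpha> (I0_hat k n (\<lambda>i. X n i \<omega>)) \<omega>}))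
       in L \<ge> ereal \<alpha> \<and>
          (\<forall>\<kappa>\<in>{0<..\<delta>}. Max (nabla k h ` non_knots k m M p) = - \<kappa> \<longrightarrow>
             L \<ge> ereal (measure N {\<omega> \<in> space N. W \<omega> \<le> t + \<kappa>}) \<and>
             measure N {\<omega> \<in> space N. W \<omega> \<le> t + \<kappa>} > \<alpha>))"
proof -
  interpret \<Omega>: prob_space \<Omega> by fact
  interpret test_setting_gaussian \<Omega> X P m M p h k \<delta> Zh N Z
  proof unfold_locales
    show "(\<Sum>j\<in>{m..M}. h j) = 0"
      "\<forall>\<^sub>F n in sequentially. \<forall>j\<in>{m..M}. pmf (P n) j = pmf p j + h j / sqrt (real n)"
      using assms(5) by (simp_all add: contiguous_alternatives_def)
  qed (rule assms)+
  show ?thesis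
    unfolding Let_def
  proof (intro conjI ballI impI)
    show "(\<lambda>n. measure \<Omega> {\<omega> \<in> space \<Omega>. I0_hat k n (\<lambda>i. X n i \<omega>) \<noteq> non_knots k m M p}) \<in> O(\<lambda>n. 1 / sqrt (real n))"
      by (rule rare_bigo[OF I0_hat_wrong])
  next
    fix \<alpha> :: real assume "\<alpha> \<in> {0<..<1}"
    then have \<alpha>: "0 < \<alpha>" "\<alpha> < 1" by simp_all
    let ?t = "quantile \<alpha> (distr N borel (\<lambda>\<omega>. Min ((\<lambda>j. Z j \<omega>) ` non_knots k m M p)))"
    have "nabla k h j \<le> - 0" if "j \<in> non_knots k m M p" for j
      using that assms(5) by (simp add: contiguous_alternatives_def)
    from power_lower_bound[OF \<alpha> this] have "ereal (F ?t) \<le> liminf (\<lambda>n. ereal (measure \<Omega> {\<omega> \<in> space \<Omega>.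
        T_hat k n (\<lambda>i. X n i \<omega>) < t_hat \<Omega> n (X n) (Zh n) \<alpha> (I0_hat k n (\<lambda>i. X n i \<omega>)) \<omega>}))" by simp
    moreover have "ereal \<alpha> \<le> ereal (F ?t)" using F_quantile[OF \<alpha>(2)] by simp
    ultimately show "ereal \<alpha> \<le> liminf (\<lambda>n. ereal (measure \<Omega> {\<omega> \<in> space \<Omega>.
        T_hat k n (\<lambda>i. X n i \<omega>) < t_hat \<Omega> n (X n) (Zh n) \<alpha> (I0_hat k n (\<lambda>i. X n i \<omega>)) \<omega>}))"
      by (rule order_trans[rotated])
    fix \<kappa> assume \<kappa>: "\<kappa> \<in> {0<..\<delta>}" and Max: "Max (nabla k h ` non_knots k m M p) = - \<kappa>"
    have "nabla k h j \<le> - \<kappa>" if "j \<in> non_knots k m M p" for j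
      unfolding Max[symmetric] using that I0_facts(1) by (intro Max_ge) auto
    from power_lower_bound[OF \<alpha> this]
    show "ereal (measure N {\<omega> \<in> space N. Min ((\<lambda>j. Z j \<omega>) ` non_knots k m M p) \<le> ?t + \<kappa>})
      \<le> liminf (\<lambda>n. ereal (measure \<Omega> {\<omega> \<in> space \<Omega>.
        T_hat k n (\<lambda>i. X n i \<omega>) < t_hat \<Omega> n (X n) (Zh n) \<alpha> (I0_hat k n (\<lambda>i. X n i \<omega>)) \<omega>}))"
      unfolding F_eq .
    \<comment> \<open>Strictness comes from the second step: the distribution function increases
      strictly over the gap of length \<open>\<kappa>\<close>.\<close>
    have "\<alpha> \<le> F ?t" by (rule F_quantile[OF \<alpha>(2)])
    also have "\<dots> < F (?t + \<kappa>)" using \<kappa> by (intro F_strict) simp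
    finally show "\<alpha> < measure N {\<omega> \<in> space N. Min ((\<lambda>j. Z j \<omega>) ` non_knots k m M p) \<le> ?t + \<kappa>}"
      unfolding F_eq .
  qed (rule limit_distribution)
qed

end
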